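(* Let $\Phi(\vec x,t)$, $\vec x=(x,y)$, be a given potential and let $f_h$ be a solution of the semi-discrete entropy-weighted upwind discontinuous Galerkin (DG) scheme (written out in the context) for the Boltzmann equation with two position variables and three momentum variables $\vec\omega=(\omega,\mu,\varphi)$ in energy-angular coordinates for a Kane energy band, under periodic and specular reflection boundary conditions. Then $$0\;\ge\;\int_{\Omega_C}f_h\,\partial_tf_h\,e^{H}\,s(\omega)\,d\vec\omega\,d\vec x\;=\;\frac12\int_{\Omega_C}\partial_t\!\left(f_h^2\right)e^{H}\,s(\omega)\,d\vec\omega\,d\vec x .$$ In the last integral the time derivative acts only on $f_h^2$ and not on $e^H$.
   Context: **Coordinates.** The position is $\vec x=(x,y)$ in a rectangle. The momentum coordinates are $\vec\omega=(\omega,\mu,\varphi)$: $\omega=\varepsilon/(K_BT_L)\in[0,\omega_{\max}]$ is the normalized Kane energy, where $\varepsilon(1+\alpha\varepsilon)=\hbar^2k^2/(2m^* )$ with a constant $\alpha$; $\mu\in[-1,1]$ is the cosine of the polar angle with respect to the $x$-momentum axis; $\varphi\in[0,2\pi]$ is the azimuthal angle. Set $\alpha_K=\alpha K_BT_L$. $\Omega_C=\Omega_{x,y}\times\Omega_{\omega,\mu,\varphi}$ is the computational domain, and $s(\omega)=\sqrt{\omega(1+\alpha_K\omega)}\,(1+2\alpha_K\omega)$ is (up to a constant) the Jacobian of the momentum coordinates. Write $\partial=\partial_{(x,y,\omega,\mu,\varphi)}$. **Hamiltonian.** $H=\varepsilon-q\Phi$, with energies measured in units of $K_BT_L$ (so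 $\varepsilon$ becomes $\omega$ in these units). $\vec E=(E_x,E_y)=-\nabla_{\vec x}\Phi$. **Transport vector.** $\beta=(\beta_1,\dots,\beta_5)$ with $$(\beta_1,\beta_2)=c_x\,\omega(1+\alpha_K\omega)\,(\mu,\sqrt{1-\mu^2}\cos\varphi),\qquad \beta_3=-2c_k\,\omega(1+\alpha_K\omega)\big[\mu E_x+\sqrt{1-\mu^2}\cos\varphi\,E_y\big],$$ $$\beta_4=-c_k\sqrt{1-\mu^2}\,(1+2\alpha_K\omega)\big[\sqrt{1-\mu^2}\,E_x-\mu\cos\varphi\,E_y\big],\qquad \beta_5=c_k\frac{(1+2\alpha_K\omega)E_y\sin\varphi}{\sqrt{1-\mu^2}} .$$ Here $c_x,c_k>0$ are the dimensional scaling constants, related so that $\beta\cdot\partial H=0$; also $\partial\cdot\beta=0$. **Collision operator.** $Q(f)=\int S(\vec p\,'\to\vec p)f'\,d\vec p\,'-f\int S(\vec p\to\vec p\,')\,d\vec p\,'$ is linear, with nonnegative kernel $S$ (of electron-phonon type, possibly a measure supported on sets of prescribed energy differences), and satisfies the dissipative identity $$\int Q(f)\,g\,d\vec p=-\tfrac12\iint S(\vec p\,'\to\vec p)\,e^{-\varepsilon(p')}\Big(\tfrac{f'}{e^{-\varepsilon(p')}}-\tfrac{f}{e^{-\varepsilon(p)}}\Big)(g'-g)\,d\vec p\,'\,d\vec p,$$ where primes denote evaluation at $\vec p\,'$. The momentum volume element $d\vec p$ equals $s(\omega)\,d\vec\omega$ up to a constant. **Scheme.** $\Omega_C$ is partitioned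 into tensor-product cells, and $f_h(\cdot,t)$ and the test functions $g_h$ are piecewise polynomials of degree at most $k$ on the cells. On every cell $\Omega$, and for all $g_h$, $$\int_\Omega\big(\partial_tf_h\,g_h\,e^H s(\omega)-f_h\,\beta\cdot\partial(g_he^H)\big)d\vec\omega\,d\vec x+\int_{\partial\Omega}\widehat{f_h}\,\beta\cdot\hat n\,g_he^H\,d\sigma=\int_\Omega Q(f_h)\,g_h\,e^Hs(\omega)\,d\vec\omega\,d\vec x .$$ In the surface integral, $g_h$ is the trace from inside the cell, $\hat n$ is the outward normal, and $\widehat{f_h}$ is the upwind value $\widehat{f_h}(z)=\lim_{\delta\to0^+}f_h(z-\delta\beta(z))$. **Boundary conditions.** Each side of the position rectangle carries either periodic conditions (opposite sides identified, with $\Phi$ periodic there) or specular reflection: on the inflow part ($\beta\cdot\hat n<0$) the density equals $f(\vec x,\vec p,t)|_{-}=f(\vec x,\vec p\,',t)|_{+}$, the outflow value at the same position and at the specularly reflected momentum $\vec p\,'$ (same $|\vec p|$, reversed normal velocity component), and this is the exterior value used by the upwind flux. In momentum, $\varphi$ is periodic, $f_h$ vanishes at the energy cut-off $\omega=\omega_{\max}$, and the normal transport vanishes at $\omega=0$ and $\mu=\pm1$. *)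

theory Defs
  imports "HOL-Analysis.Analysis"
begin

text \<open>
  Points of phase space are vectors \<open>z :: real^5\<close> with components
  \<open>(z$1, z$2, z$3, z$4, z$5) = (x, y, \<omega>, \<mu>, \<phi>)\<close>; positions are pairs \<open>(x, y)\<close> and momenta
  are triples \<open>(\<omega>, \<mu>, \<phi>)\<close>.
\<close>

type_synonym phase_point = "real ^ 5"
type_synonym momentum = "real \<times> real \<times> real"

datatype position_bc = Periodic | Specular

text \<open>
  The scattering kernel may be a measure in either momentum argument, so \<open>S\<close> is given by its two
  partial measures: \<open>S_to M p\<close> is \<open>S(p' \<rightarrow> p) dp'\<close> and \<open>S_from M p\<close> is \<open>S(p \<rightarrow> p') dp'\<close>, both
  measures in the variable \<open>p'\<close> for fixed \<open>p\<close>. That they come from one and the same \<open>S\<close> is part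
  of \<open>scattering_kernel\<close> below.
\<close>

record kane_model =
  alpha :: real
  KT :: real
  charge :: real
  c_x :: real
  c_k :: real
  omega_max :: real
  x_min :: real
  x_max :: real
  y_min :: real
  y_max :: real
  Phi :: "real \<Rightarrow> real \<times> real \<Rightarrow> real"
  bc_x :: position_bc
  bc_y :: position_bc
  S_to :: "momentum \<Rightarrow> momentum measure"
  S_from :: "momentum \<Rightarrow> momentum measure"

definition position :: "phase_point \<Rightarrow> real \<times> real" where
  "position z = (z $ 1, z $ 2)"

definition momentum_of :: "phase_point \<Rightarrow> momentum" where
  "momentum_of z = (z $ 3, z $ 4, z $ 5)"

definition phase :: "real \<times> real \<Rightarrow> momentum \<Rightarrow> phase_point" where
  "phase x p = vector [fst x, snd x, fst p, fst (snd p), snd (snd p)]"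

lemma vector_5:
  "(vector [a, b, c, d, e] :: 'a::zero ^ 5) $ 1 = a"
  "(vector [a, b, c, d, e] :: 'a::zero ^ 5) $ 2 = b"
  "(vector [a, b, c, d, e] :: 'a::zero ^ 5) $ 3 = c"
  "(vector [a, b, c, d, e] :: 'a::zero ^ 5) $ 4 = d"
  "(vector [a, b, c, d, e] :: 'a::zero ^ 5) $ 5 = e"
  by (simp_all add: vector_def)


section \<open>The physical model\<close>

definition alpha_K :: "kane_model \<Rightarrow> real" where
  "alpha_K M = alpha M * KT M"

definition rect :: "kane_model \<Rightarrow> (real \<times> real) set" where
  "rect M = {x_min M .. x_max M} \<times> {y_min M .. y_max M}"

definition momentum_domain :: "kane_model \<Rightarrow> momentum set" where
  "momentum_domain M = {0 .. omega_max M} \<times> {-1 .. 1} \<times> {0 .. 2 * pi}"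

definition lo :: "kane_model \<Rightarrow> phase_point" where
  "lo M = vector [x_min M, y_min M, 0, -1, 0]"

definition hi :: "kane_model \<Rightarrow> phase_point" where
  "hi M = vector [x_max M, y_max M, omega_max M, 1, 2 * pi]"

definition Omega_C :: "kane_model \<Rightarrow> phase_point set" where
  "Omega_C M = cbox (lo M) (hi M)"

text \<open>
  Positivity of \<open>1 + 2 \<alpha>\<^sub>K \<omega>\<close> (automatic for \<open>\<alpha> \<ge> 0\<close>) says that \<open>\<omega>\<close> is a regular energy
  coordinate on the whole range \<open>0 \<le> \<omega> \<le> \<omega>\<^sub>m\<^sub>a\<^sub>x\<close>.
\<close>

definition admissible_constants :: "kane_model \<Rightarrow> bool" where
  "admissible_constants M \<longleftrightarrow>
     0 < KT M \<and> 0 < c_x M \<and> 0 < c_k M \<and> 0 < omega_max M \<and>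
     x_min M < x_max M \<and> y_min M < y_max M \<and>
     (\<forall>w\<in>{0 .. omega_max M}. 0 < 1 + 2 * alpha_K M * w)"

definition jac :: "kane_model \<Rightarrow> real \<Rightarrow> real" where
  "jac M w = sqrt (w * (1 + alpha_K M * w)) * (1 + 2 * alpha_K M * w)"

text \<open>
  The derivative is taken within the closed rectangle, i.e. one-sided on the boundary.
\<close>

definition Efield :: "kane_model \<Rightarrow> real \<Rightarrow> real \<times> real \<Rightarrow> real \<times> real" where
  "Efield M t x =
     (- frechet_derivative (Phi M t) (at x within rect M) (1, 0),
      - frechet_derivative (Phi M t) (at x within rect M) (0, 1))"

definition C1_potential :: "kane_model \<Rightarrow> real \<Rightarrow> bool" where
  "C1_potential M t \<longleftrightarrow>
     Phi M t differentiable_on rect M \<and> continuous_on (rect M) (Efield M t)"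

definition periodic_potential :: "kane_model \<Rightarrow> real \<Rightarrow> bool" where
  "periodic_potential M t \<longleftrightarrow>
     (bc_x M = Periodic \<longrightarrow>
        (\<forall>y\<in>{y_min M .. y_max M}. Phi M t (x_min M, y) = Phi M t (x_max M, y))) \<and>
     (bc_y M = Periodic \<longrightarrow>
        (\<forall>x\<in>{x_min M .. x_max M}. Phi M t (x, y_min M) = Phi M t (x, y_max M)))"

text \<open>\<open>(\<epsilon> - q \<Phi>) / (K\<^sub>B T\<^sub>L)\<close>, the Hamiltonian in units of \<open>K\<^sub>B T\<^sub>L\<close>.\<close>

definition ham :: "kane_model \<Rightarrow> real \<Rightarrow> phase_point \<Rightarrow> real" where
  "ham M t z = z $ 3 - charge M * Phi M t (position z) / KT M"

definition beta :: "kane_model \<Rightarrow> real \<Rightarrow> phase_point \<Rightarrow> phase_point" where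
  "beta M t z =
     (let w = z $ 3; \<mu> = z $ 4; \<phi> = z $ 5;
          Ex = fst (Efield M t (position z)); Ey = snd (Efield M t (position z));
          a = alpha_K M; r = sqrt (1 - \<mu>\<^sup>2)
      in vector
        [c_x M * w * (1 + a * w) * \<mu>,
         c_x M * w * (1 + a * w) * (r * cos \<phi>),
         - 2 * c_k M * w * (1 + a * w) * (\<mu> * Ex + r * cos \<phi> * Ey),
         - c_k M * r * (1 + 2 * a * w) * (r * Ex - \<mu> * cos \<phi> * Ey),
         c_k M * ((1 + 2 * a * w) * Ey * sin \<phi> / r)])"

text \<open>The derivative \<open>\<beta> \<cdot> \<partial>u\<close> along the transport vector.\<close>

definition beta_deriv ::
    "kane_model \<Rightarrow> real \<Rightarrow> (phase_point \<Rightarrow> real) \<Rightarrow> phase_point \<Rightarrow> real" where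
  "beta_deriv M t u z = frechet_derivative u (at z) (beta M t z)"


section \<open>The collision operator\<close>

definition dp :: "kane_model \<Rightarrow> momentum measure" where
  "dp M = density lborel (\<lambda>p. indicator (momentum_domain M) p * ennreal (jac M (fst p)))"

text \<open>
  The third conjunct expresses that \<open>S_to\<close> and \<open>S_from\<close> disintegrate the same measure
  \<open>S(p' \<rightarrow> p) dp' dp\<close>; the last one that the total scattering rate is finite, so that all
  collision integrals of bounded functions converge.
\<close>

definition scattering_kernel :: "kane_model \<Rightarrow> bool" where
  "scattering_kernel M \<longleftrightarrow>
     (\<forall>p. sets (S_to M p) = sets borel \<and> sets (S_from M p) = sets borel) \<and>
     (\<forall>A\<in>sets borel. (\<lambda>p. emeasure (S_to M p) A) \<in> borel_measurable borel \<and>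
                      (\<lambda>p. emeasure (S_from M p) A) \<in> borel_measurable borel) \<and>
     (\<forall>A\<in>sets borel. \<forall>B\<in>sets borel.
        (\<integral>\<^sup>+p\<in>B. emeasure (S_to M p) A \<partial>dp M) = (\<integral>\<^sup>+p\<in>A. emeasure (S_from M p) B \<partial>dp M)) \<and>
     (\<integral>\<^sup>+p. emeasure (S_from M p) UNIV \<partial>dp M) < \<infinity>"

definition collision :: "kane_model \<Rightarrow> (momentum \<Rightarrow> real) \<Rightarrow> momentum \<Rightarrow> real" where
  "collision M f p = (\<integral>p'. f p' \<partial>S_to M p) - f p * (\<integral>p'. 1 \<partial>S_from M p)"

definition dissipative :: "kane_model \<Rightarrow> bool" where
  "dissipative M \<longleftrightarrow>
     (\<forall>f g. f \<in> borel_measurable borel \<and> bounded (range f) \<and>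
            g \<in> borel_measurable borel \<and> bounded (range g) \<longrightarrow>
        (\<integral>p. collision M f p * g p \<partial>dp M) =
        - (1 / 2) * (\<integral>p. (\<integral>p'. exp (- fst p') *
              (f p' / exp (- fst p') - f p / exp (- fst p)) * (g p' - g p) \<partial>S_to M p) \<partial>dp M))"

text \<open>The collision operator acts on the momentum variables at frozen position.\<close>

definition Qcoll :: "kane_model \<Rightarrow> (phase_point \<Rightarrow> real) \<Rightarrow> phase_point \<Rightarrow> real" where
  "Qcoll M f z = collision M (\<lambda>p. f (phase (position z) p)) (momentum_of z)"


section \<open>The discontinuous Galerkin space\<close>

definition cell_partition :: "kane_model \<Rightarrow> phase_point set set \<Rightarrow> bool" where
  "cell_partition M cells \<longleftrightarrow>
     cells division_of Omega_C M \<and> (\<forall>K\<in>cells. interior K \<noteq> {})"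

text \<open>Polynomial functions of total degree at most \<open>k\<close>.\<close>

definition poly_deg_le :: "nat \<Rightarrow> (phase_point \<Rightarrow> real) set" where
  "poly_deg_le k =
     {P. \<exists>c :: (5 \<Rightarrow> nat) \<Rightarrow> real.
        \<forall>z. P z = (\<Sum>e | (\<Sum>i\<in>UNIV. e i) \<le> k. c e * (\<Prod>i\<in>UNIV. z $ i ^ e i))}"

text \<open>
  Members of the space are determined up to their values on the null set of cell boundaries, where
  only one-sided traces are ever used; the representative vanishing there is chosen.
\<close>

definition piecewise_poly :: "phase_point set set \<Rightarrow> nat \<Rightarrow> (phase_point \<Rightarrow> real) set" where
  "piecewise_poly cells k =
     {g. (\<forall>K\<in>cells. \<exists>P\<in>poly_deg_le k. \<forall>z\<in>interior K. g z = P z) \<and>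
         (\<forall>z. z \<notin> (\<Union>K\<in>cells. interior K) \<longrightarrow> g z = 0)}"

definition trace_in :: "phase_point set \<Rightarrow> (phase_point \<Rightarrow> real) \<Rightarrow> phase_point \<Rightarrow> real" where
  "trace_in K g z = Lim (at z within interior K) g"

definition vanishes_at_cutoff ::
    "kane_model \<Rightarrow> phase_point set set \<Rightarrow> (phase_point \<Rightarrow> real) \<Rightarrow> bool" where
  "vanishes_at_cutoff M cells g \<longleftrightarrow>
     (\<forall>K\<in>cells. \<forall>z\<in>K. z $ 3 = omega_max M \<longrightarrow> trace_in K g z = 0)"

text \<open>
  The condition at the energy cut-off is built into the space, hence shared by \<open>f\<^sub>h\<close> and the test
  functions. A solution that satisfies the scheme for all piecewise polynomial test functions
  satisfies it in particular for these.
\<close>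

definition dg_space ::
    "kane_model \<Rightarrow> phase_point set set \<Rightarrow> nat \<Rightarrow> (phase_point \<Rightarrow> real) set" where
  "dg_space M cells k = {g \<in> piecewise_poly cells k. vanishes_at_cutoff M cells g}"

definition dt :: "(real \<Rightarrow> phase_point \<Rightarrow> real) \<Rightarrow> real \<Rightarrow> phase_point \<Rightarrow> real" where
  "dt u t z = deriv (\<lambda>\<tau>. u \<tau> z) t"


section \<open>Upwind flux and boundary conditions\<close>

definition set_coord :: "phase_point \<Rightarrow> 5 \<Rightarrow> real \<Rightarrow> phase_point" where
  "set_coord z i a = (\<chi> j. if j = i then a else z $ j)"

definition opposite :: "kane_model \<Rightarrow> 5 \<Rightarrow> phase_point \<Rightarrow> phase_point" where
  "opposite M i z = set_coord z i (if z $ i = lo M $ i then hi M $ i else lo M $ i)"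

text \<open>
  The momentum components are proportional to \<open>\<mu>\<close>, \<open>sqrt (1 - \<mu>\<^sup>2) cos \<phi>\<close>, \<open>sqrt (1 - \<mu>\<^sup>2) sin \<phi>\<close>
  along \<open>x\<close>, \<open>y\<close>, \<open>z\<close>. Reversing the first is \<open>\<mu> \<mapsto> -\<mu>\<close>; reversing the second is
  \<open>\<phi> \<mapsto> \<pi> - \<phi>\<close> modulo \<open>2\<pi>\<close>.
\<close>

definition reflect :: "5 \<Rightarrow> phase_point \<Rightarrow> phase_point" where
  "reflect i z =
     (if i = 1 then set_coord z 4 (- (z $ 4))
      else set_coord z 5 (if z $ 5 \<le> pi then pi - z $ 5 else 3 * pi - z $ 5))"

definition limit_along :: "(phase_point \<Rightarrow> real) \<Rightarrow> phase_point \<Rightarrow> phase_point \<Rightarrow> real" where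
  "limit_along f z b = Lim (at_right 0) (\<lambda>\<delta>. f (z - \<delta> *\<^sub>R b))"

definition boundary_inflow :: "kane_model \<Rightarrow> real \<Rightarrow> 5 \<Rightarrow> phase_point \<Rightarrow> bool" where
  "boundary_inflow M t i z \<longleftrightarrow>
     (z $ i = lo M $ i \<and> 0 < beta M t z $ i) \<or> (z $ i = hi M $ i \<and> beta M t z $ i < 0)"

definition periodic_dir :: "kane_model \<Rightarrow> 5 \<Rightarrow> bool" where
  "periodic_dir M i \<longleftrightarrow>
     (i = 1 \<and> bc_x M = Periodic) \<or> (i = 2 \<and> bc_y M = Periodic) \<or> i = 5"

definition specular_dir :: "kane_model \<Rightarrow> 5 \<Rightarrow> bool" where
  "specular_dir M i \<longleftrightarrow> (i = 1 \<and> bc_x M = Specular) \<or> (i = 2 \<and> bc_y M = Specular)"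

text \<open>
  The exterior value on the inflow part of the sides of \<open>\<Omega>\<^sub>C\<close> orthogonal to coordinate \<open>i\<close>. On a
  periodic side the limit along \<open>-\<beta>\<close> is continued from the identified opposite side. On a specular
  side it is the outflow (hence upwind) value at the reflected momentum. The value \<open>0\<close> refers to
  the energy cut-off; at \<open>\<omega> = 0\<close> and \<open>\<mu> = \<plusminus>1\<close> there is no inflow because \<open>\<beta>\<^sub>3\<close>, \<open>\<beta>\<^sub>4\<close> vanish.
\<close>

definition exterior_value ::
    "kane_model \<Rightarrow> real \<Rightarrow> (phase_point \<Rightarrow> real) \<Rightarrow> 5 \<Rightarrow> phase_point \<Rightarrow> real" where
  "exterior_value M t f i z =
     (if periodic_dir M i then limit_along f (opposite M i z) (beta M t z)
      else if specular_dir M i then limit_along f (reflect i z) (beta M t (reflect i z))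
      else 0)"

definition upwind ::
    "kane_model \<Rightarrow> real \<Rightarrow> (phase_point \<Rightarrow> real) \<Rightarrow> 5 \<Rightarrow> phase_point \<Rightarrow> real" where
  "upwind M t f i z =
     (if boundary_inflow M t i z then exterior_value M t f i z
      else limit_along f z (beta M t z))"

text \<open>
  Surface measure of the hyperplane \<open>z $ i = a\<close>: Lebesgue measure in the other four coordinates.
\<close>

definition hyperplane_measure :: "5 \<Rightarrow> real \<Rightarrow> phase_point measure" where
  "hyperplane_measure i a =
     completion (distr (\<Pi>\<^sub>M j\<in>UNIV - {i}. lborel) borel (\<lambda>y. \<chi> j. if j = i then a else y j))"

definition outward_flux :: "phase_point set \<Rightarrow> (5 \<Rightarrow> phase_point \<Rightarrow> real) \<Rightarrow> real" where
  "outward_flux K F =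
     (\<Sum>i\<in>UNIV.
        (LINT z:K|hyperplane_measure i (interval_upperbound K $ i). F i z) -
        (LINT z:K|hyperplane_measure i (interval_lowerbound K $ i). F i z))"


section \<open>The semi-discrete scheme\<close>

definition scheme_on_cell ::
    "kane_model \<Rightarrow> (real \<Rightarrow> phase_point \<Rightarrow> real) \<Rightarrow> real \<Rightarrow> phase_point set \<Rightarrow>
     (phase_point \<Rightarrow> real) \<Rightarrow> bool" where
  "scheme_on_cell M fh t K g \<longleftrightarrow>
     (LINT z:K|lebesgue. dt fh t z * g z * exp (ham M t z) * jac M (z $ 3)
         - fh t z * beta_deriv M t (\<lambda>z. g z * exp (ham M t z)) z)
     + outward_flux K (\<lambda>i z. upwind M t (fh t) i z * beta M t z $ i * trace_in K g z
         * exp (ham M t z))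
     = (LINT z:K|lebesgue. Qcoll M (fh t) z * g z * exp (ham M t z) * jac M (z $ 3))"

text \<open>
  A solution on a set \<open>I\<close> of times is a differentiable curve in the DG space satisfying the scheme
  on every cell.
\<close>

definition dg_solution ::
    "kane_model \<Rightarrow> phase_point set set \<Rightarrow> nat \<Rightarrow> real set \<Rightarrow>
     (real \<Rightarrow> phase_point \<Rightarrow> real) \<Rightarrow> bool" where
  "dg_solution M cells k I fh \<longleftrightarrow>
     (\<forall>t\<in>I. fh t \<in> dg_space M cells k \<and>
            (\<forall>z. (\<lambda>\<tau>. fh \<tau> z) differentiable (at t)) \<and>
            dt fh t \<in> dg_space M cells k \<and>
            (\<forall>K\<in>cells. \<forall>g\<in>dg_space M cells k. scheme_on_cell M fh t K g))"

end

theory Submission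
  imports Defs "HOL-Probability.Giry_Monad"
begin

text \<open>
  Test the scheme with \<open>g\<^sub>h = f\<^sub>h\<close>. Since \<open>\<beta> \<cdot> \<partial>H = 0\<close> and \<open>\<partial> \<cdot> \<beta> = 0\<close>, the field \<open>e\<^sup>H \<beta>\<close> is divergence free
  and the volume term is \<open>f\<^sub>h \<beta> \<cdot> \<partial>(f\<^sub>h e\<^sup>H) = \<partial> \<cdot> (f\<^sub>h\<^sup>2 e\<^sup>H \<beta>) / 2\<close>, so that it becomes a surface term of
  \<open>f\<^sub>h\<^sup>2 / 2\<close> on each cell. Together with the upwind flux, a cell interface contributes
  \<open>(f\<^sup>- - f\<^sup>+)\<^sup>2 \<bar>\<beta> \<cdot> n\<bar> e\<^sup>H / 2\<close>; identified periodic sides contribute the same expression, and so does a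
  specular side after averaging over the reflection of the momentum, which reverses \<open>\<beta> \<cdot> n\<close> and preserves
  \<open>e\<^sup>H\<close>. The collision term is nonpositive because \<open>f\<^sub>h e\<^sup>H\<close> is, at fixed position, a multiple of
  \<open>f\<^sub>h / e\<^sup>-\<^sup>\<epsilon>\<close>.

  The cells need not match across interfaces. The surface terms are therefore compared along almost every
  line parallel to a coordinate axis, where the cells met by the line form a chain of adjacent intervals.
\<close>

section \<open>Slices of Lebesgue measure\<close>

text \<open>Two lacks of regularity shape the proof. \<open>Phi\<close> is only C1, so the electric
  field is merely continuous and \<open>beta\<close> is not differentiable as a vector field. Each
  component is, however, differentiable in its own coordinate: the electric field depends on the
  position alone, and the two position components do not contain it. So the divergence is taken
  coordinate by coordinate, and Fubini's theorem with the fundamental theorem of calculus on lines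
  takes the place of the divergence theorem. Moreover the azimuthal component blows up at the poles
  \<mu> = +-1 like 1 / sqrt (1 - \<mu>^2). This is the derivative of arcsin, hence integrable, and
  up to a constant 1 plus this function dominates all transport integrands.

  The scheme contains limits, Frechet derivatives and kernel integrals that are uncontrolled on
  certain null sets. Each is exchanged for an explicit Borel function equal to it almost everywhere,
  which the completed measures permit. Specular reflection is the only boundary condition for which
  the sign appears not on each line but only after integration over the side.\<close>

lemma (in pair_sigma_finite) integrable_prod_mult:
  fixes A :: "'a \<Rightarrow> real" and B :: "'b \<Rightarrow> real"
  assumes A: "integrable M1 A" and B: "integrable M2 B"
  shows "integrable (M1 \<Otimes>\<^sub>M M2) (\<lambda>(x, y). A x * B y)"
proof (rule Fubini_integrable)
  have [measurable]: "A \<in> borel_measurable M1" "B \<in> borel_measurable M2" using A B by auto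
  show "(\<lambda>(x, y). A x * B y) \<in> borel_measurable (M1 \<Otimes>\<^sub>M M2)" by measurable
  show "integrable M1 (\<lambda>x. \<integral>y. norm (case (x, y) of (x, y) \<Rightarrow> A x * B y) \<partial>M2)"
    using integrable_mult_left[OF integrable_abs[OF A], of "\<integral>y. \<bar>B y\<bar> \<partial>M2"] by (simp add: abs_mult)
  show "AE x in M1. integrable M2 (\<lambda>y. case (x, y) of (x, y) \<Rightarrow> A x * B y)"
    using B by (intro AE_I2) simp
qed

text \<open>Preimages under \<open>F\<close> and \<open>G\<close> differ only inside a null set, and
  the completion contains all subsets of null sets. This makes integrands measurable that are known
  only up to a null set, such as the upwind value, \<open>beta_deriv\<close> and the collision
  term.\<close>

lemma measurable_completion_AE:
  fixes F G :: "'a \<Rightarrow> 'b::topological_space"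
  assumes AE: "AE x in M. F x = G x" and [measurable]: "G \<in> borel_measurable M"
  shows "F \<in> borel_measurable (completion M)"
proof (rule measurableI)
  fix A :: "'b set" assume [measurable]: "A \<in> sets borel"
  show "F -` A \<inter> space (completion M) \<in> sets (completion M)"
  proof (rule completion.in_sets_AE)
    show "AE x in completion M. x \<in> G -` A \<inter> space M \<longleftrightarrow> x \<in> F -` A \<inter> space (completion M)"
      using AE_completion[OF AE] by eventually_elim auto
    have "G -` A \<inter> space M \<in> sets M" by measurable
    then show "G -` A \<inter> space M \<in> sets (completion M)" by (rule sets_completionI_sets)
  qed auto
qed auto

abbreviation transverse :: "'n::finite \<Rightarrow> ('n \<Rightarrow> real) measure" where
  "transverse i \<equiv> \<Pi>\<^sub>M j\<in>UNIV - {i}. lborel"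

text \<open>The value \<open>y i\<close> is ignored. Hence \<open>y\<close> may be a point of
  \<open>transverse i\<close>, whose entry at \<open>i\<close> is undefined, or the component
  function of a vector: \<open>slice i s (($) z)\<close> moves \<open>z\<close> along coordinate
  \<open>i\<close>.\<close>

definition slice :: "'n::finite \<Rightarrow> real \<Rightarrow> ('n \<Rightarrow> real) \<Rightarrow> real ^ 'n" where
  "slice i a y = (\<chi> j. if j = i then a else y j)"

lemma slice_nth [simp]: "slice i a y $ j = (if j = i then a else y j)"
  by (simp add: slice_def)

interpretation lborel_product: product_sigma_finite "\<lambda>_. lborel :: real measure"
  by (rule product_sigma_finite.intro) (rule lborel.sigma_finite_measure_axioms)

lemma sigma_finite_transverse: "sigma_finite_measure (transverse (i::'n::finite))"
  by (rule lborel_product.sigma_finite) simp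

lemma pair_sigma_finite_transverse: "pair_sigma_finite (transverse (i::'n::finite)) (lborel :: real measure)"
  by (intro pair_sigma_finite.intro sigma_finite_transverse lborel.sigma_finite_measure_axioms)

lemma borel_measurable_vec_lambda [measurable (raw)]:
  assumes "\<And>j. (\<lambda>x. f x j) \<in> borel_measurable M"
  shows "(\<lambda>x. (\<chi> j. f x j) :: real ^ 'n) \<in> borel_measurable M"
proof (subst borel_measurable_euclidean_space, intro ballI)
  fix b :: "real ^ 'n" assume "b \<in> Basis"
  then obtain j where "b = axis j 1" by (auto simp: Basis_vec_def)
  then show "(\<lambda>x. (\<chi> j. f x j) \<bullet> b) \<in> borel_measurable M"
    using assms[of j] by (simp add: inner_axis)
qed

lemma measurable_slice [measurable (raw)]:
  fixes i :: "'n::finite"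
  assumes "f \<in> borel_measurable M" "g \<in> M \<rightarrow>\<^sub>M transverse i"
  shows "(\<lambda>x. slice i (f x) (g x)) \<in> borel_measurable M"
  unfolding slice_def
proof (rule borel_measurable_vec_lambda)
  fix j
  show "(\<lambda>x. if j = i then f x else g x j) \<in> borel_measurable M"
  proof (cases "j = i")
    case False
    have "(\<lambda>x. g x j) \<in> M \<rightarrow>\<^sub>M lborel"
      using measurable_compose[OF assms(2) measurable_component_singleton[of j "UNIV - {i}" "\<lambda>_. lborel"]] False
      by simp
    then show ?thesis using False by simp
  qed (use assms in simp)
qed

lemma mem_box_slice:
  "slice i a y \<in> box l u \<longleftrightarrow> l $ i < a \<and> a < u $ i \<and> (\<forall>j. j \<noteq> i \<longrightarrow> l $ j < y j \<and> y j < u $ j)"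
  by (auto simp: mem_box_cart)

lemma mem_cbox_slice:
  "slice i a y \<in> cbox l u \<longleftrightarrow> l $ i \<le> a \<and> a \<le> u $ i \<and> (\<forall>j. j \<noteq> i \<longrightarrow> l $ j \<le> y j \<and> y j \<le> u $ j)"
  by (auto simp: mem_box_cart)

lemma prod_Basis_cart: "(\<Prod>b\<in>(Basis :: (real ^ 'n) set). f b) = (\<Prod>j\<in>UNIV. f (axis j 1))"
proof -
  have "Basis = range (\<lambda>j::'n. axis j (1::real))" by (auto simp: Basis_vec_def)
  moreover have "inj (\<lambda>j::'n. axis j (1::real))" by (auto simp: inj_def axis_eq_axis)
  ultimately have "prod f Basis = prod (f \<circ> (\<lambda>j. axis j (1::real))) UNIV"
    by (metis prod.reindex)
  then show ?thesis by (simp add: o_def)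
qed

text \<open>Both measures give a box the product of its side lengths, which characterizes Lebesgue
  measure. This is the source of Fubini's theorem with one coordinate singled out.\<close>

lemma lborel_eq_distr_slice:
  fixes i :: "'n::finite"
  shows "(lborel :: (real ^ 'n) measure) =
    distr (transverse i \<Otimes>\<^sub>M lborel) borel (\<lambda>(y, s). slice i s y)"
proof (rule lborel_eqI)
  fix l u :: "real ^ 'n" assume le: "\<And>b. b \<in> Basis \<Longrightarrow> l \<bullet> b \<le> u \<bullet> b"
  have le': "l $ j \<le> u $ j" for j
    using le[of "axis j 1"] by (simp add: inner_axis)
  interpret pair_sigma_finite "transverse i" "lborel :: real measure"
    by (rule pair_sigma_finite_transverse)
  let ?A = "PiE (UNIV - {i}) (\<lambda>j. {l $ j <..< u $ j})"
  have A[measurable]: "?A \<in> sets (transverse i)" by (intro sets_PiM_I_finite) auto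
  have "(\<lambda>(y, s). slice i s y) -` box l u \<inter> space (transverse i \<Otimes>\<^sub>M lborel) = ?A \<times> {l $ i <..< u $ i}"
  proof (rule set_eqI)
    fix p :: "('n \<Rightarrow> real) \<times> real"
    show "p \<in> (\<lambda>(y, s). slice i s y) -` box l u \<inter> space (transverse i \<Otimes>\<^sub>M lborel)
      \<longleftrightarrow> p \<in> ?A \<times> {l $ i <..< u $ i}"
      by (cases p) (simp add: mem_box_slice space_pair_measure space_PiM PiE_iff, blast)
  qed
  then have "emeasure (distr (transverse i \<Otimes>\<^sub>M lborel) borel (\<lambda>(y, s). slice i s y)) (box l u)
    = emeasure (transverse i \<Otimes>\<^sub>M lborel) (?A \<times> {l $ i <..< u $ i})"
    by (subst emeasure_distr) auto
  also have "\<dots> = emeasure (transverse i) ?A * emeasure lborel {l $ i <..< u $ i}"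
    by (intro lborel.emeasure_pair_measure_Times) auto
  also have "\<dots> = (\<Prod>j\<in>UNIV - {i}. ennreal (u $ j - l $ j)) * ennreal (u $ i - l $ i)"
    by (subst lborel_product.emeasure_PiM) (auto simp: le')
  also have "\<dots> = (\<Prod>j\<in>UNIV. ennreal (u $ j - l $ j))"
    by (subst prod.remove[of UNIV i]) (auto simp: mult.commute)
  also have "\<dots> = ennreal (\<Prod>b\<in>Basis. (u - l) \<bullet> b)"
    by (simp add: prod_Basis_cart inner_axis prod_ennreal le')
  finally show "emeasure (distr (transverse i \<Otimes>\<^sub>M lborel) borel (\<lambda>(y, s). slice i s y)) (box l u) =
    ennreal (\<Prod>b\<in>Basis. (u - l) \<bullet> b)" .
qed simp

lemma
  fixes F :: "real ^ 'n \<Rightarrow> real" and i :: 'n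
  assumes F: "integrable lborel F"
  shows AE_integrable_slice: "AE y in transverse i. integrable lborel (\<lambda>s. F (slice i s y))"
    and integrable_integral_slice: "integrable (transverse i) (\<lambda>y. \<integral>s. F (slice i s y) \<partial>lborel)"
    and integral_slice: "(\<integral>z. F z \<partial>lborel) = (\<integral>y. (\<integral>s. F (slice i s y) \<partial>lborel) \<partial>transverse i)"
proof -
  interpret pair_sigma_finite "transverse i" "lborel :: real measure"
    by (rule pair_sigma_finite_transverse)
  have [measurable]: "F \<in> borel_measurable borel" using F by auto
  have int: "integrable (transverse i \<Otimes>\<^sub>M lborel) (\<lambda>(y, s). F (slice i s y))"
    using F by (subst (asm) lborel_eq_distr_slice[of i], subst (asm) integrable_distr_eq)
      (auto simp: case_prod_unfold)
  show "AE y in transverse i. integrable lborel (\<lambda>s. F (slice i s y))"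
    using AE_integrable_fst[OF int] by simp
  show "integrable (transverse i) (\<lambda>y. \<integral>s. F (slice i s y) \<partial>lborel)"
    using integrable_fst[OF int] by simp
  have "(\<integral>z. F z \<partial>lborel) = (\<integral>(y, s). F (slice i s y) \<partial>(transverse i \<Otimes>\<^sub>M lborel))"
    by (subst lborel_eq_distr_slice[of i], subst integral_distr) (auto simp: case_prod_unfold)
  then show "(\<integral>z. F z \<partial>lborel) = (\<integral>y. (\<integral>s. F (slice i s y) \<partial>lborel) \<partial>transverse i)"
    using integral_fst[OF int] by simp
qed

lemma AE_transverse_neq:
  fixes i j :: "'n::finite"
  assumes "j \<noteq> i"
  shows "AE y in transverse i. y j \<noteq> c"
proof (rule AE_I')
  let ?A = "PiE (UNIV - {i}) (\<lambda>k. if k = j then {c} else UNIV)"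
  have "?A \<in> sets (transverse i)" by (intro sets_PiM_I_finite) auto
  moreover have "emeasure (transverse i) ?A = 0"
    using assms by (subst lborel_product.emeasure_PiM) (auto intro!: prod_zero bexI[of _ j])
  ultimately show "?A \<in> null_sets (transverse i)" by auto
  show "{y \<in> space (transverse i). \<not> y j \<noteq> c} \<subseteq> ?A"
    by (rule subsetI) (simp add: space_PiM PiE_iff)
qed

text \<open>Finitely many hyperplanes orthogonal to the transverse axes form a null set. With the
  cell ends as \<open>E\<close>, almost every line in direction \<open>i\<close> avoids the edges of
  all cells.\<close>

lemma AE_transverse_generic:
  fixes i :: "'n::finite"
  assumes "\<And>j. finite (E j)"
  shows "AE y in transverse i. \<forall>j. j \<noteq> i \<longrightarrow> y j \<notin> E j"
proof -
  have "AE y in transverse i. y j \<notin> E j" if "j \<noteq> i" for j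
  proof -
    have "AE y in transverse i. \<forall>c\<in>E j. y j \<noteq> c"
      by (rule AE_finite_allI) (use assms AE_transverse_neq[OF that] in auto)
    then show ?thesis by eventually_elim auto
  qed
  then show ?thesis by (subst AE_all_countable) auto
qed

lemma borel_measurable_vec_nth' [measurable]: "(\<lambda>z :: real ^ 'n. z $ j) \<in> borel_measurable borel"
  by (intro borel_measurable_continuous_onI continuous_intros)

text \<open>\<open>hyperplane_measure\<close> is completed, so an integrand that agrees with a Borel
  function off finitely many hyperplanes can be replaced by it. In this way fluxes defined by limits
  become computable.\<close>

lemma integral_hyperplane:
  fixes F G :: "phase_point \<Rightarrow> real"
  assumes E: "\<And>j. finite (E j)"
    and eq: "\<And>z. z $ i = a \<Longrightarrow> (\<And>j. j \<noteq> i \<Longrightarrow> z $ j \<notin> E j) \<Longrightarrow> F z = G z"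
    and G[measurable]: "G \<in> borel_measurable borel"
  shows "(\<integral>z. F z \<partial>hyperplane_measure i a) = (\<integral>y. G (slice i a y) \<partial>transverse i)"
proof -
  let ?D = "distr (transverse i) borel (slice i a)"
  have hm: "hyperplane_measure i a = completion ?D"
    by (simp add: hyperplane_measure_def slice_def[abs_def])
  have [measurable]: "E j \<in> sets borel" for j using E by (intro borel_closed finite_imp_closed)
  have "AE z in ?D. z $ i = a \<and> (\<forall>j. j \<noteq> i \<longrightarrow> z $ j \<notin> E j)"
  proof (subst AE_distr_iff)
    show "AE y in transverse i. slice i a y $ i = a \<and> (\<forall>j. j \<noteq> i \<longrightarrow> slice i a y $ j \<notin> E j)"
      using AE_transverse_generic[OF E] by eventually_elim auto
  qed measurable
  then have AE: "AE z in ?D. F z = G z"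
    by eventually_elim (auto intro: eq)
  have F: "F \<in> borel_measurable (completion ?D)"
    by (rule measurable_completion_AE[OF AE]) simp
  have "(\<integral>z. F z \<partial>completion ?D) = (\<integral>z. G z \<partial>completion ?D)"
    by (intro integral_cong_AE AE_completion[OF AE] measurable_completion F) auto
  also have "\<dots> = (\<integral>z. G z \<partial>?D)" by (intro integral_completion) simp
  also have "\<dots> = (\<integral>y. G (slice i a y) \<partial>transverse i)" by (subst integral_distr) auto
  finally show ?thesis by (simp add: hm)
qed

section \<open>Integrals of partial derivatives\<close>

text \<open>The cylinder over an open face, unbounded in direction \<open>i\<close>. One set thus
  describes the faces at both ends and all lines between them; points over the rim of a face are
  left out.\<close>

definition face :: "'n \<Rightarrow> real ^ 'n \<Rightarrow> real ^ 'n \<Rightarrow> (real ^ 'n::finite) set" where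
  "face i l u = {z. \<forall>j. j \<noteq> i \<longrightarrow> l $ j < z $ j \<and> z $ j < u $ j}"

lemma face_borel [measurable]: "face i l u \<in> sets borel"
proof -
  have "face i l u = {z \<in> space borel. \<forall>j. j \<noteq> i \<longrightarrow> l $ j < z $ j \<and> z $ j < u $ j}"
    by (auto simp: face_def)
  also have "\<dots> \<in> sets borel" by measurable
  finally show ?thesis .
qed

lemma slice_in_face [simp]: "slice i a y \<in> face i l u \<longleftrightarrow> (\<forall>j. j \<noteq> i \<longrightarrow> l $ j < y j \<and> y j < u $ j)"
  by (auto simp: face_def)

lemma slice_self [simp]: "slice i (z $ i) (($) z) = z"
  by (simp add: vec_eq_iff)

lemma slice_slice [simp]: "slice i a (($) (slice i b y)) = slice i a y"
  by (simp add: vec_eq_iff)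

text \<open>Fubini in direction \<open>i\<close>, then the fundamental theorem of calculus on each
  line. Differentiability is asked only in the open box and only along \<open>i\<close>, continuity
  only on lines over the open face. This admits derivatives that blow up at the ends of the lines,
  as for the fourth component of \<open>beta\<close> at the poles.\<close>

lemma integral_partial_derivative:
  fixes l u :: "real ^ 'n" and G D :: "real ^ 'n \<Rightarrow> real"
  assumes le: "l $ i \<le> u $ i"
    and int: "set_integrable lborel (cbox l u) D"
    and [measurable]: "G \<in> borel_measurable borel"
    and deriv: "\<And>z. z \<in> box l u \<Longrightarrow>
      ((\<lambda>s. G (slice i s (($) z))) has_real_derivative D z) (at (z $ i))"
    and cont: "\<And>z. z \<in> face i l u \<Longrightarrow> continuous_on {l $ i..u $ i} (\<lambda>s. G (slice i s (($) z)))"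
  shows "(LINT z:cbox l u|lborel. D z) =
    (\<integral>y. indicator (face i l u) (slice i (u $ i) y) * G (slice i (u $ i) y) -
          indicator (face i l u) (slice i (l $ i) y) * G (slice i (l $ i) y) \<partial>transverse i)"
proof -
  let ?F = "\<lambda>z. indicator (cbox l u) z *\<^sub>R D z"
  have F: "integrable lborel ?F" using int by (simp add: set_integrable_def)
  have "(LINT z:cbox l u|lborel. D z) = (\<integral>y. (\<integral>s. ?F (slice i s y) \<partial>lborel) \<partial>transverse i)"
    unfolding set_lebesgue_integral_def by (rule integral_slice[OF F])
  also have "\<dots> = (\<integral>y. indicator (face i l u) (slice i (u $ i) y) * G (slice i (u $ i) y) -
          indicator (face i l u) (slice i (l $ i) y) * G (slice i (l $ i) y) \<partial>transverse i)"
  proof (rule integral_cong_AE)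
    show "(\<lambda>y. \<integral>s. ?F (slice i s y) \<partial>lborel) \<in> borel_measurable (transverse i)"
      using integrable_integral_slice[OF F] by auto
    have "AE y in transverse i. \<forall>j. j \<noteq> i \<longrightarrow> y j \<notin> {l $ j, u $ j}"
      by (rule AE_transverse_generic) auto
    then show "AE y in transverse i. (\<integral>s. ?F (slice i s y) \<partial>lborel) =
      indicator (face i l u) (slice i (u $ i) y) * G (slice i (u $ i) y) -
      indicator (face i l u) (slice i (l $ i) y) * G (slice i (l $ i) y)"
      using AE_integrable_slice[OF F, of i]
    proof eventually_elim
      case (elim y)
      show ?case
      proof (cases "\<forall>j. j \<noteq> i \<longrightarrow> l $ j < y j \<and> y j < u $ j")
        case True
        have ind: "indicator (cbox l u) (slice i s y) = (indicator {l $ i..u $ i} s :: real)" for s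
          using True by (auto simp: indicator_def mem_cbox_slice less_imp_le)
        have "((\<lambda>s. D (slice i s y)) has_integral (G (slice i (u $ i) y) - G (slice i (l $ i) y)))
          {l $ i..u $ i}"
        proof (rule fundamental_theorem_of_calculus_interior[OF le])
          show "continuous_on {l $ i..u $ i} (\<lambda>s. G (slice i s y))"
            using cont[of "slice i (l $ i) y"] True by simp
          fix s assume "s \<in> {l $ i<..<u $ i}"
          then have "slice i s y \<in> box l u" using True by (auto simp: mem_box_slice)
          from deriv[OF this]
          show "((\<lambda>s. G (slice i s y)) has_vector_derivative D (slice i s y)) (at s)"
            by (simp add: has_real_derivative_iff_has_vector_derivative)
        qed
        moreover have "set_integrable lborel {l $ i..u $ i} (\<lambda>s. D (slice i s y))"
          using elim(2) by (simp add: set_integrable_def ind)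
        ultimately have "(LINT s:{l $ i..u $ i}|lborel. D (slice i s y)) =
            G (slice i (u $ i) y) - G (slice i (l $ i) y)"
          by (simp add: set_borel_integral_eq_integral(2) integral_unique)
        then show ?thesis using True
          by (simp add: ind set_lebesgue_integral_def)
      next
        case False
        then obtain j where j: "j \<noteq> i" "\<not> (l $ j < y j \<and> y j < u $ j)" by blast
        \<comment> \<open>For generic \<open>y\<close> outside the open face the whole line misses
          even the closed box, so both sides are 0.\<close>
        with elim(1) have "\<not> (l $ j \<le> y j \<and> y j \<le> u $ j)" by auto
        with j have "slice i s y \<notin> cbox l u" for s by (auto simp: mem_cbox_slice)
        moreover have "slice i s y \<notin> face i l u" for s using False by simp
        ultimately show ?thesis by simp
      qed
    qed
  qed measurable
  finally show ?thesis .
qed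

section \<open>Integrability of functions of a single coordinate over faces and boxes\<close>

lemma integrable_face_weight:
  fixes w :: "real \<Rightarrow> real" and l u :: "real ^ 'n"
  assumes w: "set_integrable lborel {l $ m..u $ m} w"
  shows "integrable (transverse i) (\<lambda>y. indicator (face i l u) (slice i a y) * w (slice i a y $ m))"
proof -
  let ?f = "\<lambda>j s. indicator {l $ j<..<u $ j} s * (if j = m then w s else 1) :: real"
  have f: "integrable lborel (?f j)" for j
  proof (cases "j = m")
    case True
    have "set_integrable lborel {l $ m<..<u $ m} w"
      by (rule set_integrable_subset[OF w]) auto
    with True show ?thesis by (simp add: set_integrable_def)
  next
    case False
    have "integrable lborel (indicator {l $ j<..<u $ j} :: real \<Rightarrow> real)"
      by (cases "l $ j \<le> u $ j") (simp_all add: integrable_indicator_iff)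
    with False show ?thesis by simp
  qed
  \<comment> \<open>The integrand factors over the coordinates. The weight sits in factor
    \<open>m\<close>, or is the constant \<open>w a\<close> if the face is orthogonal to direction
    \<open>m\<close>.\<close>
  have "integrable (transverse i) (\<lambda>y. (if m = i then w a else 1) * (\<Prod>j\<in>UNIV - {i}. ?f j (y j)))"
    by (intro integrable_mult_right lborel_product.product_integrable_prod f) simp
  moreover have "(if m = i then w a else 1) * (\<Prod>j\<in>UNIV - {i}. ?f j (y j)) =
      indicator (face i l u) (slice i a y) * w (slice i a y $ m)" for y
  proof (cases "slice i a y \<in> face i l u")
    case True
    then have "(\<Prod>j\<in>UNIV - {i}. ?f j (y j)) = (\<Prod>j\<in>UNIV - {i}. if j = m then w (y j) else 1)"
      by (intro prod.cong) auto
    also have "\<dots> = (if m = i then 1 else w (y m))"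
      by (subst prod.delta) auto
    finally show ?thesis using True by simp
  next
    case False
    then obtain j where "j \<noteq> i" "\<not> (l $ j < y j \<and> y j < u $ j)" by auto
    then have "(\<Prod>j\<in>UNIV - {i}. ?f j (y j)) = 0"
      by (intro prod_zero) (auto intro!: bexI[of _ j])
    with False show ?thesis by simp
  qed
  ultimately show ?thesis by simp
qed

lemma set_integrable_cbox_weight:
  fixes w :: "real \<Rightarrow> real" and l u :: "real ^ 'n"
  assumes w: "set_integrable lborel {l $ m..u $ m} w"
    and [measurable]: "w \<in> borel_measurable borel"
  shows "set_integrable lborel (cbox l u) (\<lambda>z. w (z $ m))"
proof -
  let ?A = "\<lambda>y. indicator (cbox l u) (slice m (l $ m) y) :: real"
  let ?B = "\<lambda>s. indicator {l $ m..u $ m} s * w s"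
  interpret pair_sigma_finite "transverse m" "lborel :: real measure"
    by (rule pair_sigma_finite_transverse)
  have B: "integrable lborel ?B" using w by (simp add: set_integrable_def)
  \<comment> \<open>\<open>face\<close> is open; enlarging the box by 1 on every side makes it cover
    the closed cross section.\<close>
  have "set_integrable lborel {(l - 1) $ m..(u + 1) $ m} (\<lambda>_. 1 :: real)"
    by (simp add: set_integrable_def integrable_indicator_iff emeasure_lborel_Icc_eq)
  from integrable_face_weight[OF this, of m "l $ m"]
  have "integrable (transverse m) ?A"
  proof (rule Bochner_Integration.integrable_bound)
    show "AE y in transverse m. norm (?A y) \<le>
        norm (indicator (face m (l - 1) (u + 1)) (slice m (l $ m) y) * 1 :: real)"
      by (rule AE_I2) (fastforce simp: indicator_def mem_cbox_slice)
  qed measurable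
  from integrable_prod_mult[OF this B]
  have "integrable (transverse m \<Otimes>\<^sub>M lborel)
      (\<lambda>(y, s). indicator (cbox l u) (slice m s y) *\<^sub>R w (slice m s y $ m))"
    by (rule Bochner_Integration.integrable_cong[THEN iffD1, OF refl, rotated])
       (auto simp: indicator_def mem_cbox_slice)
  then show ?thesis unfolding set_integrable_def
    by (subst lborel_eq_distr_slice[of m], subst integrable_distr_eq) (auto simp: case_prod_unfold)
qed

text \<open>The antiderivative arcsin is continuous up to the ends and the integrand is nonnegative,
  so its integral is the finite increment of arcsin.\<close>

lemma set_integrable_arcsin_derivative:
  "set_integrable lborel {-1..1} (\<lambda>s::real. 1 / sqrt (1 - s\<^sup>2))"
proof -
  have I: "((\<lambda>s::real. 1 / sqrt (1 - s\<^sup>2)) has_integral (arcsin 1 - arcsin (-1))) {-1..1}"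
  proof (rule fundamental_theorem_of_calculus_interior)
    show "continuous_on {- 1..1} arcsin" by (intro continuous_on_arcsin') 
    fix s :: real assume "s \<in> {-1<..<1}"
    then show "(arcsin has_vector_derivative 1 / sqrt (1 - s\<^sup>2)) (at s)"
      using DERIV_arcsin[of s]
      by (simp add: has_real_derivative_iff_has_vector_derivative inverse_eq_divide)
  qed simp
  have nn: "0 \<le> 1 / sqrt (1 - s\<^sup>2)" if "s \<in> {-1..1}" for s :: real
    using that by (auto simp: abs_square_le_1 abs_le_iff)
  have "(\<integral>\<^sup>+s. ennreal (1 / sqrt (1 - s\<^sup>2)) * indicator {-1..1} s \<partial>lborel) =
      ennreal (arcsin 1 - arcsin (-1))"
    by (rule nn_integral_has_integral_lebesgue'[OF nn I])
  moreover have "(\<integral>\<^sup>+s. ennreal (norm (indicator {-1..1} s *\<^sub>R (1 / sqrt (1 - s\<^sup>2)))) \<partial>lborel) =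
      (\<integral>\<^sup>+s. ennreal (1 / sqrt (1 - s\<^sup>2)) * indicator {-1..1} s \<partial>lborel)"
    by (intro nn_integral_cong) (use nn in \<open>auto simp: indicator_def\<close>)
  ultimately show ?thesis
    unfolding set_integrable_def integrable_iff_bounded by simp
qed

section \<open>Continuously differentiable functions with explicit partial derivatives;
  polynomials\<close>

definition C1_partials :: "(real ^ 'n \<Rightarrow> real) \<Rightarrow> ('n \<Rightarrow> real ^ 'n \<Rightarrow> real) \<Rightarrow> bool" where
  "C1_partials P D \<longleftrightarrow> (\<forall>i. continuous_on UNIV (D i)) \<and>
     (\<forall>z. (P has_derivative (\<lambda>v. \<Sum>i\<in>UNIV. v $ i * D i z)) (at z))"

lemma C1_partials_continuous: "C1_partials P D \<Longrightarrow> continuous_on S P"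
  unfolding C1_partials_def
  by (meson continuous_at_imp_continuous_on has_derivative_continuous)

lemma C1_partials_const: "C1_partials (\<lambda>_. c) (\<lambda>_ _. 0)"
  by (simp add: C1_partials_def)

lemma C1_partials_nth: "C1_partials (\<lambda>z. z $ j) (\<lambda>i _. if i = j then 1 else 0)"
proof -
  have "(\<lambda>v :: real ^ 'a. \<Sum>i\<in>UNIV. v $ i * (if i = j then 1 else 0)) = (\<lambda>v. v $ j)"
    by (simp add: if_distrib cong: if_cong)
  then show ?thesis
    by (simp add: C1_partials_def bounded_linear_imp_has_derivative bounded_linear_vec_nth)
qed

lemma C1_partials_add:
  assumes "C1_partials P D" "C1_partials Q E"
  shows "C1_partials (\<lambda>z. P z + Q z) (\<lambda>i z. D i z + E i z)"
  unfolding C1_partials_def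
proof (intro conjI allI)
  fix i show "continuous_on UNIV (\<lambda>z. D i z + E i z)"
    using assms by (intro continuous_intros) (auto simp: C1_partials_def)
next
  fix z
  have "(P has_derivative (\<lambda>v. \<Sum>i\<in>UNIV. v $ i * D i z)) (at z)"
    "(Q has_derivative (\<lambda>v. \<Sum>i\<in>UNIV. v $ i * E i z)) (at z)"
    using assms by (auto simp: C1_partials_def)
  from has_derivative_add[OF this]
  show "((\<lambda>z. P z + Q z) has_derivative (\<lambda>v. \<Sum>i\<in>UNIV. v $ i * (D i z + E i z))) (at z)"
    by (simp add: distrib_left sum.distrib)
qed

lemma C1_partials_mult:
  assumes "C1_partials P D" "C1_partials Q E"
  shows "C1_partials (\<lambda>z. P z * Q z) (\<lambda>i z. P z * E i z + D i z * Q z)"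
  unfolding C1_partials_def
proof (intro conjI allI)
  fix i show "continuous_on UNIV (\<lambda>z. P z * E i z + D i z * Q z)"
    using assms C1_partials_continuous[OF assms(1)] C1_partials_continuous[OF assms(2)]
    by (intro continuous_intros) (auto simp: C1_partials_def)
next
  fix z
  have "(P has_derivative (\<lambda>v. \<Sum>i\<in>UNIV. v $ i * D i z)) (at z)"
    "(Q has_derivative (\<lambda>v. \<Sum>i\<in>UNIV. v $ i * E i z)) (at z)"
    using assms by (auto simp: C1_partials_def)
  from has_derivative_mult[OF this]
  show "((\<lambda>z. P z * Q z) has_derivative
      (\<lambda>v. \<Sum>i\<in>UNIV. v $ i * (P z * E i z + D i z * Q z))) (at z)"
    by (rule has_derivative_eq_rhs)
       (simp add: distrib_left sum.distrib sum_distrib_left sum_distrib_right mult_ac)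
qed

lemma C1_partials_power: "C1_partials P D \<Longrightarrow> \<exists>E. C1_partials (\<lambda>z. P z ^ n) E"
  by (induction n) (auto intro: C1_partials_const C1_partials_mult)

lemma C1_partials_prod:
  assumes "finite A" "\<And>j. j \<in> A \<Longrightarrow> \<exists>D. C1_partials (P j) D"
  shows "\<exists>E. C1_partials (\<lambda>z. \<Prod>j\<in>A. P j z) E"
  using assms
proof (induction A)
  case (insert x F)
  then obtain D E where "C1_partials (P x) D" "C1_partials (\<lambda>z. \<Prod>j\<in>F. P j z) E" by blast
  from C1_partials_mult[OF this] insert.hyps show ?case by auto
qed (auto intro: C1_partials_const)

lemma C1_partials_sum:
  assumes "\<And>j. j \<in> A \<Longrightarrow> \<exists>D. C1_partials (P j) D"
  shows "\<exists>E. C1_partials (\<lambda>z. \<Sum>j\<in>A. P j z) E"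
  using assms
proof (induction A rule: infinite_finite_induct)
  case (insert x F)
  then obtain D E where "C1_partials (P x) D" "C1_partials (\<lambda>z. \<Sum>j\<in>F. P j z) E" by blast
  from C1_partials_add[OF this] insert.hyps show ?case by auto
qed (auto intro: C1_partials_const)

lemma poly_deg_le_C1:
  assumes "P \<in> poly_deg_le k"
  obtains D where "C1_partials P D"
proof -
  from assms obtain c :: "(5 \<Rightarrow> nat) \<Rightarrow> real" where
    P: "P = (\<lambda>z. \<Sum>e | (\<Sum>i\<in>UNIV. e i) \<le> k. c e * (\<Prod>i\<in>UNIV. z $ i ^ e i))"
    by (auto simp: poly_deg_le_def)
  have "\<exists>E. C1_partials (\<lambda>z. \<Prod>i\<in>UNIV. z $ i ^ e i) E" for e :: "5 \<Rightarrow> nat"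
    by (intro C1_partials_prod C1_partials_power[OF C1_partials_nth]) simp
  then have "\<exists>E. C1_partials (\<lambda>z. c e * (\<Prod>i\<in>UNIV. z $ i ^ e i)) E" for e
    using C1_partials_mult[OF C1_partials_const] by blast
  then have "\<exists>E. C1_partials P E" unfolding P by (rule C1_partials_sum)
  then show ?thesis using that by blast
qed

section \<open>The weighted transport field\<close>

lemma exhaust_5:
  fixes j :: 5
  shows "j = 1 \<or> j = 2 \<or> j = 3 \<or> j = 4 \<or> j = 5"
proof (induct j)
  case (of_int z)
  then have "z = 0 \<or> z = 1 \<or> z = 2 \<or> z = 3 \<or> z = 4" by fastforce
  then show ?case by auto
qed

lemma UNIV_5: "UNIV = {1, 2, 3, 4, 5 :: 5}"
  using exhaust_5 by auto

lemma forall_5: "(\<forall>j :: 5. Q j) \<longleftrightarrow> Q 1 \<and> Q 2 \<and> Q 3 \<and> Q 4 \<and> Q 5"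
proof -
  have "Q j" if "Q 1 \<and> Q 2 \<and> Q 3 \<and> Q 4 \<and> Q 5" for j
    using exhaust_5[of j] that by (elim disjE) simp_all
  then show ?thesis by blast
qed

lemma sum_5: "(\<Sum>j\<in>(UNIV :: 5 set). f j) = f 1 + f 2 + f 3 + f 4 + f 5"
  unfolding UNIV_5 by (simp add: add_ac)

lemma slice_has_derivative:
  fixes F :: "real ^ 'n \<Rightarrow> real"
  assumes "(F has_derivative F') (at z)"
  shows "((\<lambda>s. F (slice i s (($) z))) has_real_derivative F' (axis i 1)) (at (z $ i))"
proof -
  interpret F': bounded_linear F' using assms by (rule has_derivative_bounded_linear)
  have eq: "slice i s (($) z) = z + (s - z $ i) *\<^sub>R axis i 1" for s
    by (auto simp: vec_eq_iff axis_def)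
  have "((\<lambda>s. z + (s - z $ i) *\<^sub>R axis i 1) has_derivative (\<lambda>h. h *\<^sub>R axis i 1)) (at (z $ i))"
    by (auto intro!: derivative_eq_intros)
  then have "((\<lambda>s. slice i s (($) z)) has_derivative (\<lambda>h. h *\<^sub>R axis i 1)) (at (z $ i))"
    by (simp add: eq)
  moreover have "(F has_derivative F') (at (slice i (z $ i) (($) z)))" using assms by simp
  ultimately have "(F \<circ> (\<lambda>s. slice i s (($) z)) has_derivative F' \<circ> (\<lambda>h. h *\<^sub>R axis i 1)) (at (z $ i))"
    by (rule diff_chain_at)
  then show ?thesis
    by (simp add: has_field_derivative_def o_def F'.scaleR mult.commute[of _ "F' _"])
qed

lemma position_slice [simp]:
  "i \<noteq> 1 \<Longrightarrow> i \<noteq> 2 \<Longrightarrow> position (slice i s y) = (y 1, y 2)"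
  "position (slice 1 s y) = (s, y 2)"
  "position (slice 2 s y) = (y 1, s)"
  by (auto simp: position_def)

lemma mem_Omega_C:
  "z \<in> Omega_C M \<longleftrightarrow> x_min M \<le> z $ 1 \<and> z $ 1 \<le> x_max M \<and> y_min M \<le> z $ 2 \<and> z $ 2 \<le> y_max M \<and>
     0 \<le> z $ 3 \<and> z $ 3 \<le> omega_max M \<and> -1 \<le> z $ 4 \<and> z $ 4 \<le> 1 \<and> 0 \<le> z $ 5 \<and> z $ 5 \<le> 2 * pi"
  by (auto simp: Omega_C_def lo_def hi_def mem_box_cart forall_5 vector_5)

lemma lo_hi_simps [simp]:
  "lo M $ 1 = x_min M" "lo M $ 2 = y_min M" "lo M $ 3 = 0" "lo M $ 4 = -1" "lo M $ 5 = 0"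
  "hi M $ 1 = x_max M" "hi M $ 2 = y_max M" "hi M $ 3 = omega_max M" "hi M $ 4 = 1" "hi M $ 5 = 2 * pi"
  by (simp_all add: lo_def hi_def vector_5)

lemma interior_Omega_C: "interior (Omega_C M) = box (lo M) (hi M)"
  by (simp add: Omega_C_def)

lemma beta_nth:
  "beta M t z $ 1 = c_x M * z $ 3 * (1 + alpha_K M * z $ 3) * z $ 4"
  "beta M t z $ 2 = c_x M * z $ 3 * (1 + alpha_K M * z $ 3) * (sqrt (1 - (z $ 4)\<^sup>2) * cos (z $ 5))"
  "beta M t z $ 3 = - 2 * c_k M * z $ 3 * (1 + alpha_K M * z $ 3) *
     (z $ 4 * fst (Efield M t (position z)) +
      sqrt (1 - (z $ 4)\<^sup>2) * cos (z $ 5) * snd (Efield M t (position z)))"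
  "beta M t z $ 4 = - c_k M * sqrt (1 - (z $ 4)\<^sup>2) * (1 + 2 * alpha_K M * z $ 3) *
     (sqrt (1 - (z $ 4)\<^sup>2) * fst (Efield M t (position z)) -
      z $ 4 * cos (z $ 5) * snd (Efield M t (position z)))"
  "beta M t z $ 5 = c_k M * ((1 + 2 * alpha_K M * z $ 3) * snd (Efield M t (position z)) *
     sin (z $ 5) / sqrt (1 - (z $ 4)\<^sup>2))"
  by (simp_all add: beta_def Let_def vector_5)

lemma square_div_self: "x \<noteq> 0 \<Longrightarrow> x\<^sup>2 / x = (x :: real)"
  by (simp add: power2_eq_square)

text \<open>\<open>R\<close> stands for sqrt (1 - s^2), whose derivative is -s / R. The expression
  is the fourth component of \<open>beta\<close> as a function of \<mu> = s, with \<open>e\<close>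
  and \<open>g\<close> the components of the electric field, \<open>h\<close> = cos \<phi> and
  \<open>k\<close> = 1 + 2 alpha_K \<omega>.\<close>

lemma beta4_derivative:
  fixes R :: "real \<Rightarrow> real"
  assumes "(R has_real_derivative - (m / R m)) (at m)" "R m \<noteq> 0"
  shows "((\<lambda>s. - c * R s * k * (R s * e - s * h * g)) has_real_derivative
    c * k * (2 * m * e + h * g * (R m - m\<^sup>2 / R m))) (at m)"
  using assms(2) by (auto intro!: derivative_eq_intros assms(1) simp: field_simps power2_eq_square)

lemma reflect_nth:
  "reflect 1 z $ j = (if j = 4 then - (z $ 4) else z $ j)"
  "reflect 2 z $ j = (if j = 5 then if z $ 5 \<le> pi then pi - z $ 5 else 3 * pi - z $ 5 else z $ j)"
  by (simp_all add: reflect_def set_coord_def)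

text \<open>Everything at one frozen time. Expanded, \<open>flow\<close> reads (c_x q / KT - 2 c_k)
  \<omega> (1 + alpha_K \<omega>) (\<mu> E_x + r cos \<phi> E_y) = 0, with r = sqrt (1 - \<mu>^2):
  the relation between the scaling constants in the form in which it enters.\<close>

locale kane_field =
  fixes M :: kane_model and t :: real
  assumes constants: "admissible_constants M"
    and C1: "C1_potential M t"
    and periodic: "periodic_potential M t"
    and flow: "\<And>z. z \<in> interior (Omega_C M) \<Longrightarrow> beta_deriv M t (ham M t) z = 0"
begin

abbreviation Ex :: "phase_point \<Rightarrow> real" where "Ex z \<equiv> fst (Efield M t (position z))"
abbreviation Ey :: "phase_point \<Rightarrow> real" where "Ey z \<equiv> snd (Efield M t (position z))"
abbreviation r :: "phase_point \<Rightarrow> real" where "r z \<equiv> sqrt (1 - (z $ 4)\<^sup>2)"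
abbreviation eH :: "phase_point \<Rightarrow> real" where "eH z \<equiv> exp (ham M t z)"

lemma continuous_on_position: "continuous_on S position"
  unfolding position_def[abs_def] by (intro continuous_intros)

lemma position_Omega_C: "position ` Omega_C M \<subseteq> rect M"
  by (auto simp: position_def rect_def mem_Omega_C)

lemma continuous_on_Ex [continuous_intros]: "continuous_on (Omega_C M) Ex"
  and continuous_on_Ey [continuous_intros]: "continuous_on (Omega_C M) Ey"
proof -
  have "continuous_on (Omega_C M) (\<lambda>z. Efield M t (position z))"
    using C1 continuous_on_position position_Omega_C
    by (auto simp: C1_potential_def intro: continuous_on_compose2)
  then show "continuous_on (Omega_C M) Ex" "continuous_on (Omega_C M) Ey"
    by (auto intro: continuous_intros)
qed

lemma continuous_on_eH [continuous_intros]: "continuous_on (Omega_C M) eH"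
proof -
  have "continuous_on (rect M) (Phi M t)"
    using C1 by (auto simp: C1_potential_def differentiable_imp_continuous_on)
  then have "continuous_on (Omega_C M) (\<lambda>z. Phi M t (position z))"
    using continuous_on_position position_Omega_C by (auto intro: continuous_on_compose2)
  moreover have "KT M \<noteq> 0" using constants by (simp add: admissible_constants_def)
  ultimately show ?thesis unfolding ham_def by (intro continuous_intros) auto
qed

definition dham :: "5 \<Rightarrow> phase_point \<Rightarrow> real" where
  "dham i z = (if i = 1 then charge M / KT M * Ex z else if i = 2 then charge M / KT M * Ey z
     else if i = 3 then 1 else 0)"

text \<open>Entry \<open>i\<close> is the derivative of component \<open>i\<close> of
  \<open>beta\<close> in coordinate \<open>i\<close> alone. No derivative of the electric field
  arises: it varies only with the position, and components 1 and 2, whose entries are 0, do not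
  contain it.\<close>

definition dbeta :: "5 \<Rightarrow> phase_point \<Rightarrow> real" where
  "dbeta i z = (if i = 3 then - 2 * c_k M * (1 + 2 * alpha_K M * z $ 3) *
       (z $ 4 * Ex z + r z * cos (z $ 5) * Ey z)
     else if i = 4 then c_k M * (1 + 2 * alpha_K M * z $ 3) *
       (2 * z $ 4 * Ex z + cos (z $ 5) * Ey z * (r z - (z $ 4)\<^sup>2 / r z))
     else if i = 5 then c_k M * (1 + 2 * alpha_K M * z $ 3) * Ey z * cos (z $ 5) / r z
     else 0)"

text \<open>Extension by 0 gives a Borel function on the whole space, although \<open>Phi\<close> is
  arbitrary outside the rectangle.\<close>

definition wfield :: "5 \<Rightarrow> phase_point \<Rightarrow> real" where
  "wfield i z = (if z \<in> Omega_C M then beta M t z $ i * eH z else 0)"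

text \<open>The terms of the divergence of the field with components \<open>wfield i\<close>. The
  derivatives are available only in the interior, whose complement in the domain is a null
  set.\<close>

definition wdiv :: "5 \<Rightarrow> phase_point \<Rightarrow> real" where
  "wdiv i z = (if z \<in> interior (Omega_C M) then (dbeta i z + beta M t z $ i * dham i z) * eH z else 0)"

lemma r_pos: "z \<in> interior (Omega_C M) \<Longrightarrow> 0 < r z"
  by (auto simp: interior_Omega_C mem_box_cart forall_5 abs_square_less_1 abs_less_iff)

lemma ham_has_derivative:
  assumes z: "z \<in> interior (Omega_C M)"
  shows "(ham M t has_derivative (\<lambda>v. \<Sum>i\<in>UNIV. v $ i * dham i z)) (at z)"
proof -
  let ?D = "frechet_derivative (Phi M t) (at (position z) within rect M)"
  have pos: "position z \<in> interior (rect M)"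
    using z by (auto simp: interior_Omega_C mem_box_cart forall_5 position_def rect_def
      interior_Times)
  then have at: "at (position z) within rect M = at (position z)" by (rule at_within_interior)
  have "Phi M t differentiable (at (position z) within rect M)"
    using C1 pos interior_subset by (auto simp: C1_potential_def differentiable_on_def)
  then have D: "(Phi M t has_derivative ?D) (at (position z))"
    using at by (simp add: frechet_derivative_works)
  interpret D: bounded_linear ?D using D by (rule has_derivative_bounded_linear)
  have split: "?D (a, b) = - (a * Ex z + b * Ey z)" for a b
  proof -
    have "(a, b) = a *\<^sub>R (1, 0) + b *\<^sub>R (0, 1 :: real)" by simp
    then have "?D (a, b) = ?D (a *\<^sub>R (1, 0) + b *\<^sub>R (0, 1))" by simp
    also have "\<dots> = a * ?D (1, 0) + b * ?D (0, 1)" by (simp only: D.add D.scaleR real_scaleR_def)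
    finally show ?thesis by (simp add: Efield_def)
  qed
  have "(position has_derivative (\<lambda>v. (v $ 1, v $ 2))) (at z)"
    unfolding position_def[abs_def]
    by (intro has_derivative_Pair bounded_linear_imp_has_derivative bounded_linear_vec_nth)
  from diff_chain_at[OF this D]
  have "((\<lambda>z. Phi M t (position z)) has_derivative (\<lambda>v. ?D (v $ 1, v $ 2))) (at z)"
    by (simp add: o_def)
  then have "((\<lambda>z. z $ 3 - charge M / KT M * Phi M t (position z)) has_derivative
      (\<lambda>v. v $ 3 - charge M / KT M * ?D (v $ 1, v $ 2))) (at z)"
    by (intro has_derivative_diff has_derivative_mult_right bounded_linear_imp_has_derivative
        bounded_linear_vec_nth)
  moreover have "ham M t = (\<lambda>z. z $ 3 - charge M / KT M * Phi M t (position z))"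
    by (simp add: ham_def fun_eq_iff)
  moreover have "(\<lambda>v. v $ 3 - charge M / KT M * ?D (v $ 1, v $ 2)) = (\<lambda>v. \<Sum>i\<in>UNIV. v $ i * dham i z)"
    by (simp add: fun_eq_iff sum_5 dham_def split algebra_simps)
  ultimately show ?thesis by simp
qed

lemma sum_beta_dham: "z \<in> interior (Omega_C M) \<Longrightarrow> (\<Sum>i\<in>UNIV. beta M t z $ i * dham i z) = 0"
  using flow[of z] ham_has_derivative[of z]
  by (simp add: beta_deriv_def frechet_derivative_at[symmetric])

text \<open>The contributions of E_x to entries 3 and 4 cancel outright. Those of E_y leave the
  factor (1 - \<mu>^2) / r - r, which is 0 because r^2 = 1 - \<mu>^2 and r is positive in the
  interior.\<close>

lemma sum_dbeta: 
  assumes "z \<in> interior (Omega_C M)"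
  shows "(\<Sum>i\<in>UNIV. dbeta i z) = 0"
proof -
  let ?r = "r z" and ?c = "c_k M * (1 + 2 * alpha_K M * z $ 3)"
  have r: "0 < ?r" and sq: "?r\<^sup>2 = 1 - (z $ 4)\<^sup>2" using r_pos[OF assms] by simp_all
  have "1 / ?r - (z $ 4)\<^sup>2 / ?r = ?r\<^sup>2 / ?r" by (simp add: sq diff_divide_distrib)
  also have "\<dots> = ?r" using square_div_self[OF less_imp_neq[OF r, symmetric]] .
  finally have "1 / ?r - (z $ 4)\<^sup>2 / ?r = ?r" .
  moreover have "(\<Sum>i\<in>UNIV. dbeta i z) =
     ?c * cos (z $ 5) * Ey z * ((1 / ?r - (z $ 4)\<^sup>2 / ?r) - ?r)"
    by (simp add: sum_5 dbeta_def algebra_simps add_divide_distrib diff_divide_distrib)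
  ultimately show ?thesis by simp
qed

lemma sum_wdiv: "(\<Sum>i\<in>UNIV. wdiv i z) = 0"
  by (cases "z \<in> interior (Omega_C M)")
     (simp_all add: wdiv_def sum_distrib_right[symmetric] sum.distrib sum_beta_dham sum_dbeta)

lemma beta_slice_derivative:
  assumes z: "z \<in> interior (Omega_C M)"
  shows "((\<lambda>s. beta M t (slice i s (($) z)) $ i) has_real_derivative dbeta i z) (at (z $ i))"
proof -
  have r: "0 < r z" by (rule r_pos[OF z])
  then have rr: "0 < 1 - (z $ 4)\<^sup>2" by simp
  consider "i = 1" | "i = 2" | "i = 3" | "i = 4" | "i = 5" using exhaust_5 by blast
  then show ?thesis
  proof cases
    case 4
    have "((\<lambda>s. sqrt (1 - s\<^sup>2)) has_real_derivative - (z $ 4 / r z)) (at (z $ 4))"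
      using rr by (auto intro!: derivative_eq_intros simp: field_simps)
    from beta4_derivative[OF this] r show ?thesis using 4
      by (simp add: beta_nth dbeta_def position_def)
  next
    case 5
    have "((\<lambda>s. c * sin s) has_real_derivative c * cos m) (at m)" for c m :: real
      by (auto intro!: derivative_eq_intros)
    from this[of "c_k M * (1 + 2 * alpha_K M * z $ 3) * Ey z / r z" "z $ 5"] show ?thesis using 5
      by (simp add: beta_nth dbeta_def position_def mult_ac)
  qed (auto simp: beta_nth dbeta_def position_def algebra_simps intro!: derivative_eq_intros)
qed

lemma interior_slice_open:
  assumes "z \<in> interior (Omega_C M)"
  shows "\<forall>\<^sub>F s in nhds (z $ i). slice i s (($) z) \<in> interior (Omega_C M)"
proof -
  have "\<forall>\<^sub>F s in nhds (z $ i). s \<in> {lo M $ i<..<hi M $ i}"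
    using assms by (intro eventually_nhds_in_open) (auto simp: interior_Omega_C mem_box_cart)
  then show ?thesis
    by eventually_elim (use assms in \<open>auto simp: interior_Omega_C mem_box_cart\<close>)
qed

lemma wfield_slice_derivative:
  assumes z: "z \<in> interior (Omega_C M)"
  shows "((\<lambda>s. wfield i (slice i s (($) z))) has_real_derivative wdiv i z) (at (z $ i))"
proof -
  have "((\<lambda>s. ham M t (slice i s (($) z))) has_real_derivative dham i z) (at (z $ i))"
    using slice_has_derivative[OF ham_has_derivative[OF z], of i]
    by (simp add: axis_def if_distrib[where f = "\<lambda>x. x * _"] cong: if_cong)
  then have "((\<lambda>s. beta M t (slice i s (($) z)) $ i * eH (slice i s (($) z)))
      has_real_derivative wdiv i z) (at (z $ i))"
    using z by (auto intro!: derivative_eq_intros beta_slice_derivative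
      simp: wdiv_def algebra_simps)
  moreover have "\<forall>\<^sub>F s in nhds (z $ i). wfield i (slice i s (($) z)) =
      beta M t (slice i s (($) z)) $ i * eH (slice i s (($) z))"
    using interior_slice_open[OF z, of i]
    by eventually_elim (use interior_subset in \<open>auto simp: wfield_def\<close>)
  ultimately show ?thesis by (subst DERIV_cong_ev[OF refl _ refl]) auto
qed

text \<open>Only \<open>\<beta>\<^sub>5\<close> and the derivatives of \<open>\<beta>\<^sub>4\<close> and \<open>\<beta>\<^sub>5\<close> are singular at \<open>\<mu> = \<plusminus>1\<close>, and like \<open>1 / r\<close>, which is integrable.\<close>

definition weight :: "real \<Rightarrow> real" where "weight s = 1 + 1 / sqrt (1 - s\<^sup>2)"

text \<open>One representation serves two ends: continuity of A and B on the compact domain gives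
  both the bound by \<open>weight\<close> and Borel measurability. At the poles 1 / r is 1 / 0 = 0,
  in F as in \<open>weight\<close>, so the bound holds there as well.\<close>

definition singular_form :: "(phase_point \<Rightarrow> real) \<Rightarrow> bool" where
  "singular_form F \<longleftrightarrow> (\<exists>A B. continuous_on (Omega_C M) A \<and> continuous_on (Omega_C M) B \<and>
     (\<forall>z. F z = A z + B z / r z))"

lemma compact_Omega_C: "compact (Omega_C M)" by (simp add: Omega_C_def)

lemma bounded_on_Omega_C:
  fixes A :: "phase_point \<Rightarrow> real"
  assumes "continuous_on (Omega_C M) A"
  obtains C where "0 \<le> C" "\<And>z. z \<in> Omega_C M \<Longrightarrow> \<bar>A z\<bar> \<le> C"
proof -
  have "bounded (A ` Omega_C M)"
    by (intro compact_imp_bounded compact_continuous_image assms compact_Omega_C)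
  then obtain C where "\<forall>x\<in>A ` Omega_C M. norm x \<le> C" unfolding bounded_iff by blast
  then show ?thesis using that[of "max C 0"] by (auto simp: le_max_iff_disj)
qed

lemma weight_ge: "z \<in> Omega_C M \<Longrightarrow> 0 \<le> 1 / r z"
  by (auto simp: mem_Omega_C abs_square_le_1 abs_le_iff)

lemma singular_form_bound:
  assumes "singular_form F"
  obtains C where "0 \<le> C" "\<And>z. z \<in> Omega_C M \<Longrightarrow> \<bar>F z\<bar> \<le> C * weight (z $ 4)"
proof -
  obtain A B where AB: "continuous_on (Omega_C M) A" "continuous_on (Omega_C M) B"
    and F: "\<And>z. F z = A z + B z / r z"
    using assms by (auto simp: singular_form_def)
  obtain a where a: "0 \<le> a" "\<And>z. z \<in> Omega_C M \<Longrightarrow> \<bar>A z\<bar> \<le> a" using bounded_on_Omega_C[OF AB(1)] by blast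
  obtain b where b: "0 \<le> b" "\<And>z. z \<in> Omega_C M \<Longrightarrow> \<bar>B z\<bar> \<le> b" using bounded_on_Omega_C[OF AB(2)] by blast
  show ?thesis
  proof (rule that[of "a + b"])
    fix z assume z: "z \<in> Omega_C M"
    have "\<bar>F z\<bar> \<le> \<bar>A z\<bar> + \<bar>B z\<bar> * (1 / r z)"
      using abs_triangle_ineq[of "A z" "B z / r z"] weight_ge[OF z] by (simp add: F abs_mult)
    also have "\<dots> \<le> a + b * (1 / r z)"
      by (intro add_mono mult_right_mono a b z weight_ge)
    \<comment> \<open>The added nonnegative terms complete the product (a + b) (1 + 1 / r).\<close>
    also have "\<dots> \<le> a + b * (1 / r z) + (a * (1 / r z) + b)"
      using weight_ge[OF z] a b by simp
    also have "\<dots> = (a + b) * weight (z $ 4)" by (simp add: weight_def distrib_left add_divide_distrib)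
    finally show "\<bar>F z\<bar> \<le> (a + b) * weight (z $ 4)" .
  qed (use a b in simp)
qed

lemma singular_form_measurable:
  assumes "singular_form F" and S: "S \<in> sets borel" "S \<subseteq> Omega_C M"
  shows "(\<lambda>z. if z \<in> S then F z else 0) \<in> borel_measurable borel"
proof -
  obtain A B where AB: "continuous_on (Omega_C M) A" "continuous_on (Omega_C M) B"
    and F: "\<And>z. F z = A z + B z / r z"
    using assms by (auto simp: singular_form_def)
  have [measurable]: "(\<lambda>z. indicator S z *\<^sub>R A z) \<in> borel_measurable borel"
    "(\<lambda>z. indicator S z *\<^sub>R B z) \<in> borel_measurable borel"
    by (intro borel_measurable_continuous_on_indicator S continuous_on_subset[OF AB(1)]
        continuous_on_subset[OF AB(2)])+
  have "(\<lambda>z. indicator S z *\<^sub>R A z + indicator S z *\<^sub>R B z / r z) \<in> borel_measurable borel"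
    by measurable
  also have "(\<lambda>z. indicator S z *\<^sub>R A z + indicator S z *\<^sub>R B z / r z) = (\<lambda>z. if z \<in> S then F z else 0)"
    by (auto simp: F)
  finally show ?thesis .
qed

lemma continuous_on_beta: "i \<noteq> 5 \<Longrightarrow> continuous_on (Omega_C M) (\<lambda>z. beta M t z $ i)"
  using exhaust_5[of i] by (elim disjE) (simp_all add: beta_nth, (intro continuous_intros)+)

definition beta5_numerator :: "phase_point \<Rightarrow> real" where
  "beta5_numerator z = c_k M * (1 + 2 * alpha_K M * z $ 3) * Ey z * sin (z $ 5)"

lemma beta5_eq: "beta M t z $ 5 = beta5_numerator z / r z"
  by (simp add: beta_nth beta5_numerator_def)

lemma continuous_on_beta5_numerator: "continuous_on (Omega_C M) beta5_numerator"
  unfolding beta5_numerator_def[abs_def] by (intro continuous_intros)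

lemma singular_form_beta: "singular_form (\<lambda>z. beta M t z $ i * eH z)"
proof (cases "i = 5")
  case True
  then show ?thesis unfolding singular_form_def
    by (intro exI[of _ "\<lambda>_. 0"] exI[of _ "\<lambda>z. beta5_numerator z * eH z"])
       (auto simp: beta5_eq intro!: continuous_intros continuous_on_beta5_numerator)
next
  case False
  then show ?thesis unfolding singular_form_def
    by (intro exI[of _ "\<lambda>z. beta M t z $ i * eH z"] exI[of _ "\<lambda>_. 0"])
       (auto intro!: continuous_intros continuous_on_beta)
qed

lemma singular_form_dbeta: "singular_form (\<lambda>z. (dbeta i z + beta M t z $ i * dham i z) * eH z)"
proof -
  let ?c = "\<lambda>z::phase_point. c_k M * (1 + 2 * alpha_K M * z $ 3)"
  \<comment> \<open>Only entries 4 and 5 leave a part with 1 / r. For these \<open>dham\<close> is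
    0, so no term with the derivative of the Hamiltonian joins them.\<close>
  define A where "A z = (if i = 5 then 0 else if i = 4 then ?c z * (2 * z $ 4 * Ex z + cos (z $ 5) * Ey z * r z)
     else dbeta i z + beta M t z $ i * dham i z)" for z
  define B where "B z = (if i = 4 then - ?c z * (cos (z $ 5) * Ey z * (z $ 4)\<^sup>2)
     else if i = 5 then ?c z * Ey z * cos (z $ 5) else 0)" for z
  have dham: "continuous_on (Omega_C M) (dham i)"
    using constants unfolding dham_def[abs_def] admissible_constants_def by (cases "i = 1"; cases "i = 2"; cases "i = 3") (auto intro!: continuous_intros)
  have db: "continuous_on (Omega_C M) (dbeta i)" if "i \<noteq> 4" "i \<noteq> 5"
    unfolding dbeta_def[abs_def] using that by (cases "i = 3") (auto intro!: continuous_intros)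
  have "continuous_on (Omega_C M) A"
    unfolding A_def[abs_def] using dham db continuous_on_beta[of i]
    by (cases "i = 4"; cases "i = 5") (auto intro!: continuous_intros)
  moreover have "continuous_on (Omega_C M) B"
    unfolding B_def[abs_def] by (cases "i = 4"; cases "i = 5") (auto intro!: continuous_intros)
  moreover have "(dbeta i z + beta M t z $ i * dham i z) = A z + B z / r z" for z
    by (auto simp: A_def B_def dbeta_def dham_def algebra_simps add_divide_distrib diff_divide_distrib)
  ultimately show ?thesis unfolding singular_form_def
    by (intro exI[of _ "\<lambda>z. A z * eH z"] exI[of _ "\<lambda>z. B z * eH z"])
       (auto intro!: continuous_intros simp: algebra_simps)
qed

lemma wfield_measurable [measurable]: "wfield i \<in> borel_measurable borel"
  unfolding wfield_def[abs_def]
  by (rule singular_form_measurable[OF singular_form_beta]) (auto simp: Omega_C_def)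

lemma wdiv_measurable [measurable]: "wdiv i \<in> borel_measurable borel"
  unfolding wdiv_def[abs_def]
  by (rule singular_form_measurable[OF singular_form_dbeta]) (auto simp: interior_subset)

lemma wfield_bound:
  obtains C where "0 \<le> C" "\<And>z. z \<in> Omega_C M \<Longrightarrow> \<bar>wfield i z\<bar> \<le> C * weight (z $ 4)"
  using singular_form_bound[OF singular_form_beta[of i]] by (metis wfield_def)

lemma wdiv_bound:
  obtains C where "0 \<le> C" "\<And>z. z \<in> Omega_C M \<Longrightarrow> \<bar>wdiv i z\<bar> \<le> C * weight (z $ 4)"
proof -
  obtain C where C: "0 \<le> C"
    "\<And>z. z \<in> Omega_C M \<Longrightarrow> \<bar>(dbeta i z + beta M t z $ i * dham i z) * eH z\<bar> \<le> C * weight (z $ 4)"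
    using singular_form_bound[OF singular_form_dbeta[of i]] by metis
  show ?thesis
  proof (rule that[OF C(1)])
    fix z assume z: "z \<in> Omega_C M"
    have "0 \<le> weight (z $ 4)" using weight_ge[OF z] by (simp add: weight_def)
    then show "\<bar>wdiv i z\<bar> \<le> C * weight (z $ 4)"
      using C(1) C(2)[OF z] by (auto simp: wdiv_def)
  qed
qed

text \<open>Components 1 to 4 are continuous on the closed domain. For \<open>i\<close> = 5 the open
  face keeps \<mu> off the poles, and r is a positive constant along the line.\<close>

lemma wfield_slice_continuous:
  assumes z: "z \<in> face i (lo M) (hi M)"
  shows "continuous_on {lo M $ i..hi M $ i} (\<lambda>s. wfield i (slice i s (($) z)))"
proof -
  have cont: "continuous_on {lo M $ i..hi M $ i} (\<lambda>s. slice i s (($) z))"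
    unfolding slice_def
  proof (rule continuous_on_vec_lambda)
    show "continuous_on {lo M $ i..hi M $ i} (\<lambda>s. if j = i then s else z $ j)" for j
      by (cases "j = i") (auto intro: continuous_intros)
  qed
  have sub: "slice i s (($) z) \<in> Omega_C M" if "s \<in> {lo M $ i..hi M $ i}" for s
    using z that by (auto simp: Omega_C_def mem_cbox_slice face_def less_imp_le)
  have comp: "continuous_on {lo M $ i..hi M $ i} (\<lambda>s. A (slice i s (($) z)))"
    if "continuous_on (Omega_C M) A" for A :: "phase_point \<Rightarrow> real"
    using that cont sub by (auto intro: continuous_on_compose2)
  have "continuous_on {lo M $ i..hi M $ i} (\<lambda>s. beta M t (slice i s (($) z)) $ i * eH (slice i s (($) z)))"
  proof (cases "i = 5")
    case True
    have "-1 < z $ 4" "z $ 4 < 1" using z True by (auto simp: face_def dest: spec[of _ 4])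
    then have "r (slice i s (($) z)) \<noteq> 0" for s
      using True abs_square_less_1[of "z $ 4"] by (simp add: abs_less_iff)
    then have "continuous_on {lo M $ i..hi M $ i}
       (\<lambda>s. beta5_numerator (slice i s (($) z)) / r (slice i s (($) z)) * eH (slice i s (($) z)))"
      using True
      by (intro continuous_intros comp continuous_on_eH continuous_on_beta5_numerator) auto
    then show ?thesis using True by (simp add: beta5_eq)
  next
    case False
    then show ?thesis by (intro continuous_intros comp continuous_on_eH continuous_on_beta)
  qed
  then show ?thesis
    by (rule continuous_on_eq) (use sub in \<open>simp add: wfield_def\<close>)
qed

text \<open>The vanishing factors are \<omega>, sqrt (1 - \<mu>^2) and sin \<phi>; thus even the
  periodic azimuthal faces carry no flux. The face at the energy cut-off is absent because there the
  trace vanishes and not the field.\<close>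

lemma wfield_vanishes:
  "z $ 3 = lo M $ 3 \<Longrightarrow> wfield 3 z = 0"
  "z $ 4 = lo M $ 4 \<Longrightarrow> wfield 4 z = 0"
  "z $ 4 = hi M $ 4 \<Longrightarrow> wfield 4 z = 0"
  "z $ 5 = lo M $ 5 \<Longrightarrow> wfield 5 z = 0"
  "z $ 5 = hi M $ 5 \<Longrightarrow> wfield 5 z = 0"
  by (simp_all add: wfield_def beta_nth)

lemma wfield_sign:
  assumes "z \<in> Omega_C M"
  shows "0 < wfield i z \<longleftrightarrow> 0 < beta M t z $ i" "wfield i z < 0 \<longleftrightarrow> beta M t z $ i < 0"
  using assms by (simp_all add: wfield_def zero_less_mult_iff mult_less_0_iff)

lemma ham_periodic:
  assumes "periodic_dir M i" "i \<noteq> 5" "z \<in> Omega_C M"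
  shows "ham M t (slice i (lo M $ i) (($) z)) = ham M t (slice i (hi M $ i) (($) z))"
  using assms periodic
  by (auto simp: periodic_dir_def periodic_potential_def ham_def mem_Omega_C)

text \<open>The normal components 1 and 2 contain no electric field, so periodicity of
  \<open>Phi\<close> suffices for them. In the azimuth both sides are 0.\<close>

lemma wfield_periodic:
  assumes "periodic_dir M i" "z \<in> Omega_C M"
  shows "wfield i (slice i (lo M $ i) (($) z)) = wfield i (slice i (hi M $ i) (($) z))"
proof (cases "i = 5")
  case True then show ?thesis by (simp add: wfield_vanishes)
next
  case False
  then have i: "i = 1 \<or> i = 2" using assms by (auto simp: periodic_dir_def)
  then have "slice i (lo M $ i) (($) z) \<in> Omega_C M" "slice i (hi M $ i) (($) z) \<in> Omega_C M"
    using assms(2) by (auto simp: mem_Omega_C)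
  then show ?thesis using ham_periodic[OF assms(1) False assms(2)] i
    by (auto simp: wfield_def beta_nth)
qed

lemma reflect_Omega_C: "specular_dir M i \<Longrightarrow> z \<in> Omega_C M \<Longrightarrow> reflect i z \<in> Omega_C M"
  using pi_gt_zero by (auto simp: specular_dir_def mem_Omega_C reflect_nth)

text \<open>Position and energy are kept, hence so is the Hamiltonian. Component 1 is odd in \<mu>,
  component 2 is proportional to cos \<phi>, and both branches of the azimuthal reflection reverse
  the cosine.\<close>

lemma wfield_reflect:
  assumes "specular_dir M i" "z \<in> Omega_C M"
  shows "wfield i (reflect i z) = - wfield i z"
proof -
  have c3: "cos (3 * pi - x) = - cos x" for x
  proof -
    have "cos (3 * pi - x) = cos ((pi - x) + 2 * pi)" by (simp add: algebra_simps)
    then show ?thesis by (simp only: cos_periodic) simp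
  qed
  have "ham M t (reflect i z) = ham M t z"
    using assms(1) by (auto simp: specular_dir_def ham_def position_def reflect_nth)
  moreover have "beta M t (reflect i z) $ i = - (beta M t z $ i)"
    using assms(1) by (auto simp: specular_dir_def beta_nth reflect_nth c3)
  ultimately show ?thesis
    using reflect_Omega_C[OF assms] assms(2) by (simp add: wfield_def)
qed

end

section \<open>Traces along coordinate lines\<close>

locale kane_dg = kane_field +
  fixes cells :: "phase_point set set" and k :: nat and f :: "phase_point \<Rightarrow> real"
  assumes mesh: "cell_partition M cells" and f: "f \<in> dg_space M cells k"
begin

abbreviation lw :: "phase_point set \<Rightarrow> phase_point" where "lw \<equiv> interval_lowerbound"
abbreviation up :: "phase_point set \<Rightarrow> phase_point" where "up \<equiv> interval_upperbound"
abbreviation cface :: "5 \<Rightarrow> phase_point set \<Rightarrow> phase_point set" where "cface i K \<equiv> face i (lw K) (up K)"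

lemma division: "cells division_of Omega_C M"
  using mesh by (simp add: cell_partition_def)

lemmas finite_cells = division_ofD(1)[OF division] and Union_cells = division_ofD(6)[OF division]

lemma cell_subset: "K \<in> cells \<Longrightarrow> K \<subseteq> Omega_C M"
  using Union_cells by blast

lemma cell_disjoint: "K \<in> cells \<Longrightarrow> K' \<in> cells \<Longrightarrow> K \<noteq> K' \<Longrightarrow> interior K \<inter> interior K' = {}"
  by (rule division_ofD(5)[OF division])

lemma
  assumes "K \<in> cells"
  shows cell_eq: "K = cbox (lw K) (up K)"
    and interior_cell: "interior K = box (lw K) (up K)"
    and lw_less_up: "lw K $ j < up K $ j"
proof -
  from assms obtain a b where K: "K = cbox a b"
    using division_ofD(4)[OF division] by blast
  have "interior K \<noteq> {}" using assms mesh by (auto simp: cell_partition_def)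
  then have ne: "box a b \<noteq> {}" by (simp add: K)
  then have ab: "a $ j < b $ j" for j by (auto simp: interval_ne_empty_cart)
  then have "cbox a b \<noteq> {}" by (auto simp: interval_ne_empty_cart less_imp_le)
  then have *: "lw K = a" "up K = b" by (simp_all add: K)
  show "K = cbox (lw K) (up K)" using K * by simp
  show "interior K = box (lw K) (up K)" using K * by simp
  show "lw K $ j < up K $ j" using * ab by simp
qed

lemma cell_bounds:
  assumes "K \<in> cells"
  shows "lo M $ j \<le> lw K $ j" "up K $ j \<le> hi M $ j"
proof -
  have "lw K \<in> cbox (lw K) (up K)" "up K \<in> cbox (lw K) (up K)"
    using lw_less_up[OF assms] by (auto simp: mem_box_cart less_imp_le)
  then have "lw K \<in> Omega_C M" "up K \<in> Omega_C M"
    using cell_eq[OF assms] cell_subset[OF assms] by auto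
  then show "lo M $ j \<le> lw K $ j" "up K $ j \<le> hi M $ j"
    by (auto simp: Omega_C_def mem_box_cart)
qed

lemma cface_subset: "K \<in> cells \<Longrightarrow> cface i K \<subseteq> face i (lo M) (hi M)"
  unfolding face_def by (auto intro: le_less_trans[OF cell_bounds(1)] less_le_trans[OF _ cell_bounds(2)])

lemma interior_cell_subset: "K \<in> cells \<Longrightarrow> interior K \<subseteq> interior (Omega_C M)"
  using cell_subset by (rule interior_mono)

text \<open>The polynomial is defined on the whole space, so one-sided traces of \<open>f\<close> on
  the boundary of the cell become plain values of \<open>cpoly K\<close>.\<close>

definition cpoly :: "phase_point set \<Rightarrow> phase_point \<Rightarrow> real" where
  "cpoly K = (SOME P. P \<in> poly_deg_le k \<and> (\<forall>z\<in>interior K. f z = P z))"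

definition dpoly :: "phase_point set \<Rightarrow> 5 \<Rightarrow> phase_point \<Rightarrow> real" where
  "dpoly K = (SOME D. C1_partials (cpoly K) D)"

lemma
  assumes "K \<in> cells"
  shows f_interior: "z \<in> interior K \<Longrightarrow> f z = cpoly K z"
    and C1_cpoly: "C1_partials (cpoly K) (dpoly K)"
proof -
  have "\<exists>P. P \<in> poly_deg_le k \<and> (\<forall>z\<in>interior K. f z = P z)"
    using f assms by (auto simp: dg_space_def piecewise_poly_def)
  from someI_ex[OF this] have *: "cpoly K \<in> poly_deg_le k" "\<forall>z\<in>interior K. f z = cpoly K z"
    by (auto simp: cpoly_def)
  then show "z \<in> interior K \<Longrightarrow> f z = cpoly K z" by blast
  from poly_deg_le_C1[OF *(1)] have "\<exists>D. C1_partials (cpoly K) D" by metis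
  then show "C1_partials (cpoly K) (dpoly K)" unfolding dpoly_def by (rule someI_ex)
qed

lemma continuous_on_cpoly: "K \<in> cells \<Longrightarrow> continuous_on S (cpoly K)"
  using C1_cpoly C1_partials_continuous by blast

lemma continuous_on_dpoly: "K \<in> cells \<Longrightarrow> continuous_on S (dpoly K i)"
  using C1_cpoly[of K] by (auto simp: C1_partials_def intro: continuous_on_subset)

lemma f_outside: "z \<notin> (\<Union>K\<in>cells. interior K) \<Longrightarrow> f z = 0"
  using f by (auto simp: dg_space_def piecewise_poly_def)

text \<open>For small \<delta> the transverse coordinates stay strictly inside the cell, and the
  sign of \<open>b $ i\<close> moves coordinate \<open>i\<close> from the face into it. The limit
  therefore sees only the polynomial of \<open>K\<close>.\<close>

lemma limit_along_eq:
  assumes K: "K \<in> cells" and z: "z \<in> cface i K"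
    and b: "z $ i = up K $ i \<and> 0 < b $ i \<or> z $ i = lw K $ i \<and> b $ i < 0"
  shows "limit_along f z b = cpoly K z"
proof -
  have lim: "((\<lambda>\<delta>. z - \<delta> *\<^sub>R b) \<longlongrightarrow> z) (at_right 0)"
    by (auto intro!: tendsto_eq_intros)
  have limj: "((\<lambda>\<delta>. (z - \<delta> *\<^sub>R b) $ j) \<longlongrightarrow> z $ j) (at_right 0)" for j
    by (intro tendsto_vec_nth lim)
  have pos: "\<forall>\<^sub>F \<delta> in at_right (0::real). 0 < \<delta>" by (rule eventually_at_right_less)
  have "\<forall>\<^sub>F \<delta> in at_right 0. lw K $ j < (z - \<delta> *\<^sub>R b) $ j \<and> (z - \<delta> *\<^sub>R b) $ j < up K $ j" for j
  proof (cases "j = i")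
    case False
    then have "lw K $ j < z $ j" "z $ j < up K $ j" using z by (auto simp: face_def)
    then show ?thesis
      using order_tendstoD[OF limj[of j]] by (intro eventually_conj) auto
  next
    case True
    from b show ?thesis
    proof
      assume *: "z $ i = up K $ i \<and> 0 < b $ i"
      then have "lw K $ j < z $ j" using lw_less_up[OF K] True by simp
      from order_tendstoD(1)[OF limj this] pos show ?thesis
        by eventually_elim (use * True in simp)
    next
      assume *: "z $ i = lw K $ i \<and> b $ i < 0"
      then have "z $ j < up K $ j" using lw_less_up[OF K] True by simp
      from order_tendstoD(2)[OF limj this] pos show ?thesis
        by eventually_elim (use * True in \<open>simp add: mult_pos_neg\<close>)
    qed
  qed
  then have "\<forall>\<^sub>F \<delta> in at_right 0. \<forall>j. lw K $ j < (z - \<delta> *\<^sub>R b) $ j \<and> (z - \<delta> *\<^sub>R b) $ j < up K $ j"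
    by (rule eventually_all_finite)
  then have ev: "\<forall>\<^sub>F \<delta> in at_right 0. cpoly K (z - \<delta> *\<^sub>R b) = f (z - \<delta> *\<^sub>R b)"
    by eventually_elim (use f_interior[OF K] in \<open>simp add: interior_cell[OF K] mem_box_cart\<close>)
  have "((\<lambda>\<delta>. cpoly K (z - \<delta> *\<^sub>R b)) \<longlongrightarrow> cpoly K z) (at_right 0)"
    by (rule continuous_on_tendsto_compose[OF continuous_on_cpoly[OF K, of UNIV] lim]) auto
  then have "((\<lambda>\<delta>. f (z - \<delta> *\<^sub>R b)) \<longlongrightarrow> cpoly K z) (at_right 0)"
    by (rule Lim_transform_eventually[OF _ ev])
  then show ?thesis unfolding limit_along_def by (intro tendsto_Lim) auto
qed

lemma trace_in_eq:
  assumes K: "K \<in> cells" and z: "z \<in> K"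
  shows "trace_in K f z = cpoly K z"
proof -
  have ne: "box (lw K) (up K) \<noteq> {}"
    using lw_less_up[OF K] by (auto simp: interval_ne_empty_cart)
  have "z \<in> closure (interior K)"
    using z cell_eq[OF K] closure_box[OF ne] by (simp add: interior_cell[OF K])
  then have "z islimpt interior K"
    using interior_limit_point[of z "interior K"] by (auto simp: closure_def)
  then have nt: "\<not> trivial_limit (at z within interior K)" by (simp add: trivial_limit_within)
  have "(cpoly K \<longlongrightarrow> cpoly K z) (at z within interior K)"
  proof -
    have "continuous_on UNIV (cpoly K)" by (rule continuous_on_cpoly[OF K])
    then have "isCont (cpoly K) z" by (simp add: continuous_on_eq_continuous_at)
    then show ?thesis unfolding isCont_def by (rule tendsto_within_subset) simp
  qed
  moreover have "\<forall>\<^sub>F x in at z within interior K. cpoly K x = f x"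
    using f_interior[OF K] by (auto simp: eventually_at_filter)
  ultimately have "(f \<longlongrightarrow> cpoly K z) (at z within interior K)"
    by (rule Lim_transform_eventually)
  then show ?thesis unfolding trace_in_def by (rule tendsto_Lim[OF nt])
qed

lemma cpoly_cutoff:
  assumes "K \<in> cells" "z \<in> K" "z $ 3 = hi M $ 3"
  shows "cpoly K z = 0"
  using f assms trace_in_eq[OF assms(1,2)] by (auto simp: dg_space_def vanishes_at_cutoff_def)

definition ends :: "5 \<Rightarrow> real set" where
  "ends j = (\<lambda>K. lw K $ j) ` cells \<union> (\<lambda>K. up K $ j) ` cells"

text \<open>Images of the cell ends are included so that \<open>reflect\<close> maps the remaining points to generic points.\<close>

definition exceptional :: "5 \<Rightarrow> real set" where
  "exceptional j = ends j \<union> uminus ` ends j \<union> (\<lambda>s. pi - s) ` ends j \<union> (\<lambda>s. 3 * pi - s) ` ends j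
     \<union> {lo M $ j, hi M $ j, pi}"

lemma finite_exceptional: "finite (exceptional j)"
  by (simp add: exceptional_def ends_def finite_cells)

definition generic :: "5 \<Rightarrow> phase_point \<Rightarrow> bool" where
  "generic i z \<longleftrightarrow> (\<forall>j. j \<noteq> i \<longrightarrow> z $ j \<notin> ends j)"

lemma generic_slice: "generic i (slice i s (($) z)) = generic i z"
  by (simp add: generic_def)

lemma cface_slice: "slice i s (($) z) \<in> face i l u \<longleftrightarrow> z \<in> face i l u"
  by (auto simp: face_def)

lemma generic_exceptional:
  assumes "\<And>j. j \<noteq> i \<Longrightarrow> z $ j \<notin> exceptional j"
  shows "generic i z"
  using assms by (auto simp: generic_def exceptional_def)

lemma generic_reflect:
  assumes "specular_dir M i" and ex: "\<And>j. j \<noteq> i \<Longrightarrow> z $ j \<notin> exceptional j"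
  shows "generic i (reflect i z)"
  unfolding generic_def
proof (intro allI impI notI)
  fix j assume j: "j \<noteq> i" "reflect i z $ j \<in> ends j"
  then have *: "z $ j \<notin> exceptional j" using ex by blast
  have "z $ j = - (- (z $ j))" "z $ j = pi - (pi - z $ j)" "z $ j = 3 * pi - (3 * pi - z $ j)" by simp_all
  with * have "z $ j \<notin> ends j" "- (z $ j) \<notin> ends j" "pi - z $ j \<notin> ends j" "3 * pi - z $ j \<notin> ends j"
    unfolding exceptional_def by blast+
  with j(2) assms(1) show False by (auto simp: specular_dir_def reflect_nth split: if_splits)
qed

lemma reflect_face:
  assumes "specular_dir M i" "z \<in> face i (lo M) (hi M)" "\<And>j. j \<noteq> i \<Longrightarrow> z $ j \<notin> exceptional j"
  shows "reflect i z \<in> face i (lo M) (hi M)"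
proof -
  have z: "lo M $ j < z $ j \<and> z $ j < hi M $ j" if "j \<noteq> i" for j
    using assms(2) that by (simp add: face_def)
  have "i = 1 \<or> i = 2" using assms(1) by (auto simp: specular_dir_def)
  \<comment> \<open>The reflection sends \<phi> = pi to 0, the boundary of the angular range. This
    is a reason for having \<open>pi\<close> in \<open>exceptional\<close>.\<close>
  moreover have "z $ 5 < pi" if "i = 2" "z $ 5 \<le> pi"
    using assms(3)[of 5] that by (simp add: exceptional_def less_le)
  ultimately show ?thesis
    using z[of 4] z[of 5] z by (auto simp: face_def reflect_nth)
qed

section \<open>Cells met by a line parallel to a coordinate axis\<close>

lemma cells_on_line_disjoint:
  assumes "K \<in> cells" "K' \<in> cells" "K \<noteq> K'" "z \<in> cface i K" "z \<in> cface i K'"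
  shows "up K $ i \<le> lw K' $ i \<or> up K' $ i \<le> lw K $ i"
proof (rule ccontr)
  assume "\<not> ?thesis"
  then have "max (lw K $ i) (lw K' $ i) < min (up K $ i) (up K' $ i)"
    using lw_less_up[of K] lw_less_up[of K'] assms by auto
  then obtain s where s: "max (lw K $ i) (lw K' $ i) < s" "s < min (up K $ i) (up K' $ i)"
    using dense by blast
  then have "slice i s (($) z) \<in> interior K \<inter> interior K'"
    using assms by (auto simp: interior_cell mem_box_slice face_def)
  then show False using cell_disjoint[OF assms(1-3)] by blast
qed

lemma cell_on_line:
  assumes z: "z \<in> face i (lo M) (hi M)" and gen: "generic i z"
    and s: "lo M $ i \<le> s" "s \<le> hi M $ i"
  obtains K where "K \<in> cells" "z \<in> cface i K" "lw K $ i \<le> s" "s \<le> up K $ i"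
proof -
  have "slice i s (($) z) \<in> Omega_C M"
    using z s by (auto simp: Omega_C_def mem_cbox_slice face_def less_imp_le)
  then obtain K where K: "K \<in> cells" "slice i s (($) z) \<in> K" using Union_cells by blast
  then have "slice i s (($) z) \<in> cbox (lw K) (up K)" using cell_eq by blast
  then have le: "lw K $ i \<le> s" "s \<le> up K $ i" "\<And>j. j \<noteq> i \<Longrightarrow> lw K $ j \<le> z $ j \<and> z $ j \<le> up K $ j"
    by (auto simp: mem_cbox_slice)
  moreover have "z $ j \<noteq> lw K $ j \<and> z $ j \<noteq> up K $ j" if "j \<noteq> i" for j
    using gen that K(1) by (auto simp: generic_def ends_def)
  ultimately have "z \<in> cface i K" by (force simp: face_def less_le)
  with K le show ?thesis using that by blast
qed

lemma finite_ends: "finite (ends j)"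
  by (simp add: ends_def finite_cells)

lemma cell_right_of:
  assumes z: "z \<in> face i (lo M) (hi M)" and gen: "generic i z"
    and s: "lo M $ i \<le> s" "s < hi M $ i"
  obtains K where "K \<in> cells" "z \<in> cface i K" "lw K $ i \<le> s" "s < up K $ i"
proof -
  \<comment> \<open>\<open>m\<close> is the next cell end above \<open>s\<close>, or the end of the
    domain. No cell begins strictly between \<open>s\<close> and \<open>m\<close>, so the cell found
    at a height \<open>s'\<close> in this gap begins at or below \<open>s\<close> and ends above
    it.\<close>
  define m where "m = Min (insert (hi M $ i) {b \<in> ends i. s < b})"
  have fin: "finite (insert (hi M $ i) {b \<in> ends i. s < b})" using finite_ends by simp
  have "s < m" unfolding m_def using fin s by (subst Min_gr_iff) auto
  then obtain s' where s': "s < s'" "s' < m" using dense by blast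
  have m: "m \<le> hi M $ i" "\<And>b. b \<in> ends i \<Longrightarrow> s < b \<Longrightarrow> m \<le> b"
    unfolding m_def using fin by (auto intro: Min_le)
  obtain K where K: "K \<in> cells" "z \<in> cface i K" "lw K $ i \<le> s'" "s' \<le> up K $ i"
    using cell_on_line[OF z gen, of s'] s s' m by force
  have "lw K $ i \<in> ends i" using K by (auto simp: ends_def)
  then have "lw K $ i \<le> s" using m(2)[of "lw K $ i"] K(3) s' by linarith
  with K s' show ?thesis using that by force
qed

lemma cell_left_of:
  assumes z: "z \<in> face i (lo M) (hi M)" and gen: "generic i z"
    and s: "lo M $ i < s" "s \<le> hi M $ i"
  obtains K where "K \<in> cells" "z \<in> cface i K" "lw K $ i < s" "s \<le> up K $ i"
proof -
  define m where "m = Max (insert (lo M $ i) {b \<in> ends i. b < s})"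
  have fin: "finite (insert (lo M $ i) {b \<in> ends i. b < s})" using finite_ends by simp
  have "m < s" unfolding m_def using fin s by (subst Max_less_iff) auto
  then obtain s' where s': "m < s'" "s' < s" using dense by blast
  have m: "lo M $ i \<le> m" "\<And>b. b \<in> ends i \<Longrightarrow> b < s \<Longrightarrow> b \<le> m"
    unfolding m_def using fin by (auto intro: Max_ge)
  obtain K where K: "K \<in> cells" "z \<in> cface i K" "lw K $ i \<le> s'" "s' \<le> up K $ i"
    using cell_on_line[OF z gen, of s'] s s' m by force
  have "up K $ i \<in> ends i" using K by (auto simp: ends_def)
  then have "s \<le> up K $ i" using m(2)[of "up K $ i"] K(4) s' by linarith
  with K s' show ?thesis using that by force
qed

text \<open>The cell met by the line just below \<open>lw K $ i\<close> reaches at least up to that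
  height, and disjointness from \<open>K\<close> keeps it from going further.\<close>

lemma cell_below:
  assumes K: "K \<in> cells" "z \<in> cface i K" and gen: "generic i z" and s: "lw K $ i \<noteq> lo M $ i"
  obtains K' where "K' \<in> cells" "z \<in> cface i K'" "up K' $ i = lw K $ i"
proof -
  have z: "z \<in> face i (lo M) (hi M)" using cface_subset K by blast
  have "lo M $ i < lw K $ i" "lw K $ i \<le> hi M $ i"
    using cell_bounds[OF K(1), of i] lw_less_up[OF K(1), of i] s by auto
  from cell_left_of[OF z gen this] obtain K' where
    K': "K' \<in> cells" "z \<in> cface i K'" "lw K' $ i < lw K $ i" "lw K $ i \<le> up K' $ i" by blast
  with cells_on_line_disjoint[OF K(1) K'(1) _ K(2) K'(2)] lw_less_up[OF K(1), of i]
  have "up K' $ i = lw K $ i" by force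
  with K' show ?thesis using that by blast
qed

lemma cell_above:
  assumes K: "K \<in> cells" "z \<in> cface i K" and gen: "generic i z" and s: "up K $ i \<noteq> hi M $ i"
  obtains K' where "K' \<in> cells" "z \<in> cface i K'" "lw K' $ i = up K $ i"
proof -
  have z: "z \<in> face i (lo M) (hi M)" using cface_subset K by blast
  have "lo M $ i \<le> up K $ i" "up K $ i < hi M $ i"
    using cell_bounds[OF K(1), of i] lw_less_up[OF K(1), of i] s by auto
  from cell_right_of[OF z gen this] obtain K' where
    K': "K' \<in> cells" "z \<in> cface i K'" "lw K' $ i \<le> up K $ i" "up K $ i < up K' $ i" by blast
  with cells_on_line_disjoint[OF K(1) K'(1) _ K(2) K'(2)] lw_less_up[OF K(1), of i]
  have "lw K' $ i = up K $ i" by force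
  with K' show ?thesis using that by blast
qed

lemma lo_less_hi: "lo M $ i < hi M $ i"
  using constants exhaust_5[of i] by (auto simp: admissible_constants_def)

lemma cell_at_lo:
  assumes z: "z \<in> face i (lo M) (hi M)" and gen: "generic i z"
  obtains K where "K \<in> cells" "z \<in> cface i K" "lw K $ i = lo M $ i"
  using cell_right_of[OF z gen order_refl lo_less_hi] cell_bounds by (metis order_antisym)

lemma cell_at_hi:
  assumes z: "z \<in> face i (lo M) (hi M)" and gen: "generic i z"
  obtains K where "K \<in> cells" "z \<in> cface i K" "up K $ i = hi M $ i"
  using cell_left_of[OF z gen lo_less_hi order_refl] cell_bounds by (metis order_antisym)

text \<open>One-sided traces of \<open>f\<close>. Away from the edges of the cells at most one summand is nonzero.\<close>

definition fminus :: "5 \<Rightarrow> phase_point \<Rightarrow> real" where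
  "fminus i z = (\<Sum>K\<in>cells. if z \<in> cface i K \<and> z $ i = up K $ i then cpoly K z else 0)"

definition fplus :: "5 \<Rightarrow> phase_point \<Rightarrow> real" where
  "fplus i z = (\<Sum>K\<in>cells. if z \<in> cface i K \<and> z $ i = lw K $ i then cpoly K z else 0)"

lemma fminus_eq:
  assumes K: "K \<in> cells" "z \<in> cface i K" "z $ i = up K $ i"
  shows "fminus i z = cpoly K z"
proof -
  have "K' = K" if "K' \<in> cells" "z \<in> cface i K'" "z $ i = up K' $ i" for K'
    using cells_on_line_disjoint[OF K(1) that(1) _ K(2) that(2)] K(3) that(3)
      lw_less_up[OF K(1), of i] lw_less_up[OF that(1), of i] by force
  then have "fminus i z = (\<Sum>K'\<in>cells. if K' = K then cpoly K z else 0)"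
    unfolding fminus_def using K by (intro sum.cong) auto
  then show ?thesis using K finite_cells by simp
qed

lemma fplus_eq:
  assumes K: "K \<in> cells" "z \<in> cface i K" "z $ i = lw K $ i"
  shows "fplus i z = cpoly K z"
proof -
  have "K' = K" if "K' \<in> cells" "z \<in> cface i K'" "z $ i = lw K' $ i" for K'
    using cells_on_line_disjoint[OF K(1) that(1) _ K(2) that(2)] K(3) that(3)
      lw_less_up[OF K(1), of i] lw_less_up[OF that(1), of i] by force
  then have "fplus i z = (\<Sum>K'\<in>cells. if K' = K then cpoly K z else 0)"
    unfolding fplus_def using K by (intro sum.cong) auto
  then show ?thesis using K finite_cells by simp
qed

text \<open>The upwind value as an explicit Borel function of the traces, in place of limits along
  \<open>beta\<close>; \<open>wfield\<close> supplies the sign of the normal component. Where it is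
  0 the last branch returns \<open>fplus\<close>, an arbitrary choice that is always multiplied by
  0.\<close>

definition fhat :: "5 \<Rightarrow> phase_point \<Rightarrow> real" where
  "fhat i z =
    (if z $ i = lo M $ i \<and> 0 < wfield i z then
       (if periodic_dir M i then fminus i (slice i (hi M $ i) (($) z))
        else if specular_dir M i then fplus i (reflect i z) else 0)
     else if z $ i = hi M $ i \<and> wfield i z < 0 then
       (if periodic_dir M i then fplus i (slice i (lo M $ i) (($) z))
        else if specular_dir M i then fminus i (reflect i z) else 0)
     else if 0 < wfield i z then fminus i z else fplus i z)"

lemma cface_end_in_cell:
  assumes "K \<in> cells" "z \<in> cface i K" "z $ i = lw K $ i \<or> z $ i = up K $ i"
  shows "z \<in> K"
proof -
  have "lw K $ j \<le> z $ j \<and> z $ j \<le> up K $ j" for j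
    using assms lw_less_up[OF assms(1), of j] by (cases "j = i") (auto simp: face_def less_imp_le)
  then show ?thesis by (subst cell_eq[OF assms(1)]) (simp add: mem_box_cart)
qed

lemma opposite_eq:
  "z $ i = lo M $ i \<Longrightarrow> opposite M i z = slice i (hi M $ i) (($) z)"
  "z $ i = hi M $ i \<Longrightarrow> opposite M i z = slice i (lo M $ i) (($) z)"
  using lo_less_hi[of i] by (auto simp: opposite_def set_coord_def vec_eq_iff)

lemma reflect_same: "specular_dir M i \<Longrightarrow> reflect i z $ i = z $ i"
  by (auto simp: specular_dir_def reflect_nth)

lemma limit_along_up:
  assumes "K \<in> cells" "z \<in> cface i K" "z $ i = up K $ i" "0 < b $ i"
  shows "limit_along f z b = fminus i z"
  using limit_along_eq[OF assms(1,2)] fminus_eq[OF assms(1,2)] assms(3,4) by simp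

lemma limit_along_lw:
  assumes "K \<in> cells" "z \<in> cface i K" "z $ i = lw K $ i" "b $ i < 0"
  shows "limit_along f z b = fplus i z"
  using limit_along_eq[OF assms(1,2)] fplus_eq[OF assms(1,2)] assms(3,4) by simp

text \<open>Each branch finds the cell on the upwind side of \<open>z\<close>, or of its opposite or
  reflected image, and stepping back along \<open>beta\<close> enters that cell. Where the normal
  component is 0 the limit runs along the face and need not be a trace, whence the condition on
  \<open>wfield\<close>.\<close>

lemma upwind_eq:
  assumes K: "K \<in> cells" "z \<in> cface i K" "z $ i = lw K $ i \<or> z $ i = up K $ i"
    and ex: "\<And>j. j \<noteq> i \<Longrightarrow> z $ j \<notin> exceptional j"
    and W: "wfield i z \<noteq> 0"
  shows "upwind M t f i z = fhat i z"
proof -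
  have zF: "z \<in> face i (lo M) (hi M)" using cface_subset K by blast
  have gen: "generic i z" using ex by (rule generic_exceptional)
  have zO: "z \<in> Omega_C M" using cface_end_in_cell[OF K] cell_subset K(1) by blast
  note sign = wfield_sign[OF zO, of i]
  have refl: "reflect i z \<in> face i (lo M) (hi M)" "generic i (reflect i z)" "reflect i z \<in> Omega_C M"
    "wfield i (reflect i z) = - wfield i z" "reflect i z $ i = z $ i"
    if "specular_dir M i"
    using reflect_face[OF that zF ex] generic_reflect[OF that ex] reflect_Omega_C[OF that zO]
      wfield_reflect[OF that zO] reflect_same[OF that] by auto
  consider (pos_lo) "0 < wfield i z" "z $ i = lo M $ i" | (neg_hi) "wfield i z < 0" "z $ i = hi M $ i"
    | (pos) "0 < wfield i z" "z $ i \<noteq> lo M $ i" | (neg) "wfield i z < 0" "z $ i \<noteq> hi M $ i"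
    using W by linarith
  then show ?thesis
  proof cases
    case pos_lo
    then have inflow: "boundary_inflow M t i z" using sign by (simp add: boundary_inflow_def)
    consider "periodic_dir M i" | "\<not> periodic_dir M i" "specular_dir M i"
      | "\<not> periodic_dir M i" "\<not> specular_dir M i" by blast
    then show ?thesis
    proof cases
      case 1
      let ?z = "slice i (hi M $ i) (($) z)"
      have *: "?z \<in> face i (lo M) (hi M)" "generic i ?z" using zF gen by (simp_all only: cface_slice generic_slice)
      then obtain K' where K': "K' \<in> cells" "?z \<in> cface i K'" "up K' $ i = hi M $ i" by (rule cell_at_hi)
      then have "limit_along f ?z (beta M t z) = fminus i ?z"
        using limit_along_up[OF K'(1,2)] pos_lo sign by simp
      then show ?thesis using 1 inflow pos_lo
        by (simp add: upwind_def exterior_value_def opposite_eq fhat_def)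
    next
      case 2
      note R = refl[OF 2(2)]
      obtain K' where "K' \<in> cells" "reflect i z \<in> cface i K'" "lw K' $ i = lo M $ i"
        using cell_at_lo[OF R(1,2)] by blast
      then have "limit_along f (reflect i z) (beta M t (reflect i z)) = fplus i (reflect i z)"
        using limit_along_lw pos_lo R(4,5) wfield_sign[OF R(3), of i] by simp
      then show ?thesis using 2 inflow pos_lo
        by (simp add: upwind_def exterior_value_def fhat_def)
    next
      case 3
      then show ?thesis using inflow pos_lo by (simp add: upwind_def exterior_value_def fhat_def)
    qed
  next
    case neg_hi
    then have inflow: "boundary_inflow M t i z" using sign by (simp add: boundary_inflow_def)
    have nlo: "\<not> (z $ i = lo M $ i \<and> 0 < wfield i z)" using neg_hi by simp
    consider "periodic_dir M i" | "\<not> periodic_dir M i" "specular_dir M i"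
      | "\<not> periodic_dir M i" "\<not> specular_dir M i" by blast
    then show ?thesis
    proof cases
      case 1
      let ?z = "slice i (lo M $ i) (($) z)"
      have *: "?z \<in> face i (lo M) (hi M)" "generic i ?z" using zF gen by (simp_all only: cface_slice generic_slice)
      then obtain K' where K': "K' \<in> cells" "?z \<in> cface i K'" "lw K' $ i = lo M $ i" by (rule cell_at_lo)
      then have "limit_along f ?z (beta M t z) = fplus i ?z"
        using limit_along_lw[OF K'(1,2)] neg_hi sign by simp
      then show ?thesis using 1 inflow neg_hi nlo
        by (simp add: upwind_def exterior_value_def opposite_eq fhat_def)
    next
      case 2
      note R = refl[OF 2(2)]
      obtain K' where "K' \<in> cells" "reflect i z \<in> cface i K'" "up K' $ i = hi M $ i"
        using cell_at_hi[OF R(1,2)] by blast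
      then have "limit_along f (reflect i z) (beta M t (reflect i z)) = fminus i (reflect i z)"
        using limit_along_up neg_hi R(4,5) wfield_sign[OF R(3), of i] by simp
      then show ?thesis using 2 inflow neg_hi nlo
        by (simp add: upwind_def exterior_value_def fhat_def)
    next
      case 3
      then show ?thesis using inflow neg_hi nlo by (simp add: upwind_def exterior_value_def fhat_def)
    qed
  next
    case pos
    then have ninflow: "\<not> boundary_inflow M t i z" using sign by (auto simp: boundary_inflow_def)
    obtain K' where "K' \<in> cells" "z \<in> cface i K'" "up K' $ i = z $ i"
      using K cell_below[OF K(1,2) gen] pos by metis
    then have "limit_along f z (beta M t z) = fminus i z"
      using limit_along_up pos sign by simp
    then show ?thesis using ninflow pos by (simp add: upwind_def fhat_def)
  next
    case neg
    then have ninflow: "\<not> boundary_inflow M t i z" using sign by (auto simp: boundary_inflow_def)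
    obtain K' where "K' \<in> cells" "z \<in> cface i K'" "lw K' $ i = z $ i"
      using K cell_above[OF K(1,2) gen] neg by metis
    then have "limit_along f z (beta M t z) = fplus i z"
      using limit_along_lw neg sign by simp
    then show ?thesis using ninflow neg by (simp add: upwind_def fhat_def)
  qed
qed

text \<open>Net contribution, counted in direction +\<open>i\<close>, of a face with interior trace
  \<open>g\<close>: the upwind flux minus the boundary term with \<open>g\<close> squared over 2
  that the volume integral produces.\<close>

definition phi :: "(phase_point \<Rightarrow> real) \<Rightarrow> 5 \<Rightarrow> phase_point \<Rightarrow> real" where
  "phi g i z = (fhat i z * g z - (g z)\<^sup>2 / 2) * wfield i z"

lemma phi_jump:
  assumes "z $ i \<noteq> lo M $ i" "z $ i \<noteq> hi M $ i"
  shows "phi (fplus i) i z \<le> phi (fminus i) i z"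
proof -
  have eq: "phi (fminus i) i z - phi (fplus i) i z = (fminus i z - fplus i z)\<^sup>2 / 2 * \<bar>wfield i z\<bar>"
    using assms by (auto simp: phi_def fhat_def power2_eq_square algebra_simps abs_if)
  have "0 \<le> (fminus i z - fplus i z)\<^sup>2 / 2 * \<bar>wfield i z\<bar>" by simp
  then show ?thesis unfolding eq[symmetric] by simp
qed

text \<open>Summation by parts along the line: apart from the two ends of the domain, the heights
  where cells end are exactly those where cells begin (\<open>UL\<close>), and at each of them
  \<open>phi_jump\<close> gives the sign.\<close>

lemma line_sum_ge:
  assumes z: "z \<in> face i (lo M) (hi M)" and gen: "generic i z"
  shows "phi (fminus i) i (slice i (hi M $ i) (($) z)) - phi (fplus i) i (slice i (lo M $ i) (($) z)) \<le>
    (\<Sum>K | K \<in> cells \<and> z \<in> cface i K. phi (cpoly K) i (slice i (up K $ i) (($) z))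
        - phi (cpoly K) i (slice i (lw K $ i) (($) z)))"
proof -
  define C where "C = {K \<in> cells. z \<in> cface i K}"
  define \<alpha> where "\<alpha> s = phi (fminus i) i (slice i s (($) z))" for s
  define \<gamma> where "\<gamma> s = phi (fplus i) i (slice i s (($) z))" for s
  have fin: "finite C" using finite_cells by (simp add: C_def)
  have up: "phi (cpoly K) i (slice i (up K $ i) (($) z)) = \<alpha> (up K $ i)" if "K \<in> C" for K
  proof -
    have "K \<in> cells" "slice i (up K $ i) (($) z) \<in> cface i K"
      using that by (simp_all only: C_def mem_Collect_eq cface_slice)
    from fminus_eq[OF this] show ?thesis by (simp add: \<alpha>_def phi_def)
  qed
  have lw: "phi (cpoly K) i (slice i (lw K $ i) (($) z)) = \<gamma> (lw K $ i)" if "K \<in> C" for K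
  proof -
    have "K \<in> cells" "slice i (lw K $ i) (($) z) \<in> cface i K"
      using that by (simp_all only: C_def mem_Collect_eq cface_slice)
    from fplus_eq[OF this] show ?thesis by (simp add: \<gamma>_def phi_def)
  qed
  have disj: "up K $ i \<le> lw K' $ i \<or> up K' $ i \<le> lw K $ i" if "K \<in> C" "K' \<in> C" "K \<noteq> K'" for K K'
    using that cells_on_line_disjoint by (auto simp: C_def)
  have less: "lw K $ i < up K $ i" if "K \<in> C" for K using that lw_less_up by (auto simp: C_def)
  have eq: "K = K'" if "K \<in> C" "K' \<in> C" "up K $ i = up K' $ i \<or> lw K $ i = lw K' $ i" for K K'
  proof (rule ccontr)
    assume "K \<noteq> K'"
    from disj[OF that(1,2) this] less[OF that(1)] less[OF that(2)] that(3) show False by linarith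
  qed
  have inj: "inj_on (\<lambda>K. up K $ i) C" "inj_on (\<lambda>K. lw K $ i) C"
    by (intro inj_onI eq; simp)+
  define U where "U = (\<lambda>K. up K $ i) ` C"
  define L where "L = (\<lambda>K. lw K $ i) ` C"
  obtain Kh where "Kh \<in> C" "up Kh $ i = hi M $ i" using cell_at_hi[OF z gen] by (auto simp: C_def)
  then have hiU: "hi M $ i \<in> U" unfolding U_def by (metis imageI)
  obtain Kl where "Kl \<in> C" "lw Kl $ i = lo M $ i" using cell_at_lo[OF z gen] by (auto simp: C_def)
  then have loL: "lo M $ i \<in> L" unfolding L_def by (metis imageI)
  have nhi: "up K $ i \<noteq> lo M $ i" "lw K $ i \<noteq> hi M $ i" if "K \<in> C" for K
    using less[OF that] cell_bounds[of K i] that by (auto simp: C_def)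
  have UL: "U - {hi M $ i} = L - {lo M $ i}"
  proof (intro set_eqI iffI)
    fix s assume "s \<in> U - {hi M $ i}"
    then obtain K where K: "K \<in> cells" "z \<in> cface i K" "s = up K $ i" "up K $ i \<noteq> hi M $ i"
      by (auto simp: U_def C_def)
    from cell_above[OF K(1,2) gen K(4)] obtain K' where "K' \<in> C" "lw K' $ i = s"
      using K by (auto simp: C_def)
    then have "s \<in> L" unfolding L_def by (metis imageI)
    then show "s \<in> L - {lo M $ i}" using K nhi(1)[of K] by (auto simp: C_def)
  next
    fix s assume "s \<in> L - {lo M $ i}"
    then obtain K where K: "K \<in> cells" "z \<in> cface i K" "s = lw K $ i" "lw K $ i \<noteq> lo M $ i"
      by (auto simp: L_def C_def)
    from cell_below[OF K(1,2) gen K(4)] obtain K' where "K' \<in> C" "up K' $ i = s"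
      using K by (auto simp: C_def)
    then have "s \<in> U" unfolding U_def by (metis imageI)
    then show "s \<in> U - {hi M $ i}" using K nhi(2)[of K] by (auto simp: C_def)
  qed
  have finUL: "finite U" "finite L" using fin by (simp_all add: U_def L_def)
  have "(\<Sum>K\<in>C. phi (cpoly K) i (slice i (up K $ i) (($) z)) - phi (cpoly K) i (slice i (lw K $ i) (($) z)))
    = (\<Sum>K\<in>C. \<alpha> (up K $ i)) - (\<Sum>K\<in>C. \<gamma> (lw K $ i))"
    by (simp add: sum_subtractf up lw)
  also have "\<dots> = sum \<alpha> U - sum \<gamma> L"
    by (simp add: U_def L_def sum.reindex inj)
  also have "\<dots> = (\<alpha> (hi M $ i) + sum \<alpha> (U - {hi M $ i})) - (\<gamma> (lo M $ i) + sum \<gamma> (L - {lo M $ i}))"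
    by (simp only: sum.remove[OF finUL(1) hiU, of \<alpha>] sum.remove[OF finUL(2) loL, of \<gamma>])
  also have "\<dots> = \<alpha> (hi M $ i) - \<gamma> (lo M $ i) + (\<Sum>s\<in>L - {lo M $ i}. \<alpha> s - \<gamma> s)"
    by (simp add: UL sum_subtractf)
  also have "\<dots> \<ge> \<alpha> (hi M $ i) - \<gamma> (lo M $ i)"
  proof -
    have "0 \<le> \<alpha> s - \<gamma> s" if "s \<in> L - {lo M $ i}" for s
    proof -
      from that have "s \<noteq> lo M $ i" "s \<noteq> hi M $ i" using UL by auto
      then show ?thesis using phi_jump[of "slice i s (($) z)" i] by (simp add: \<alpha>_def \<gamma>_def)
    qed
    then have "0 \<le> (\<Sum>s\<in>L - {lo M $ i}. \<alpha> s - \<gamma> s)" by (rule sum_nonneg)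
    then show ?thesis by simp
  qed
  finally show ?thesis by (simp add: C_def \<alpha>_def \<gamma>_def)
qed

end

section \<open>Integrability of the surface terms\<close>

lemma distr_transverse_coordinate:
  fixes i m :: "'n::finite"
  assumes T: "distr lborel borel T = (lborel :: real measure)"
    and [measurable]: "T \<in> borel_measurable borel" and m: "m \<noteq> i"
  shows "distr (transverse i) (transverse i) (\<lambda>y. y(m := T (y m))) = transverse i"
    and "(\<lambda>y. y(m := T (y m))) \<in> transverse i \<rightarrow>\<^sub>M transverse i"
proof -
  have comp: "(\<lambda>y. y m) \<in> transverse i \<rightarrow>\<^sub>M borel"
    using measurable_component_singleton[of m "UNIV - {i}" "\<lambda>_. lborel :: real measure"] m by simp
  have Tm: "(\<lambda>y. T (y m)) \<in> transverse i \<rightarrow>\<^sub>M lborel"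
    using measurable_compose[OF comp assms(2)] by simp
  show meas: "(\<lambda>y. y(m := T (y m))) \<in> transverse i \<rightarrow>\<^sub>M transverse i"
    by (rule measurable_fun_upd[OF _ measurable_ident_sets[OF refl] Tm]) (use m in auto)
  show "distr (transverse i) (transverse i) (\<lambda>y. y(m := T (y m))) = transverse i"
  \<comment> \<open>A product measure is determined by its values on products of sets. Only the
    factor at \<open>m\<close> changes, into a preimage of the same measure.\<close>
  proof (rule lborel_product.PiM_eqI)
    fix A :: "'n \<Rightarrow> real set" assume A: "\<And>j. j \<in> UNIV - {i} \<Longrightarrow> A j \<in> sets lborel"
    define B where "B j = (if j = m then T -` A m else A j)" for j
    have Am: "A m \<in> sets borel" using A[of m] m by simp
    then have TA: "T -` A m \<in> sets borel" using measurable_sets[OF assms(2) Am] by simp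
    have B: "B j \<in> sets lborel" if "j \<in> UNIV - {i}" for j using A[OF that] TA by (simp add: B_def)
    have "(\<lambda>y. y(m := T (y m))) -` Pi\<^sub>E (UNIV - {i}) A \<inter> space (transverse i) = Pi\<^sub>E (UNIV - {i}) B"
    proof (rule set_eqI)
      fix y :: "'n \<Rightarrow> real"
      have ball: "(\<forall>j\<in>UNIV - {i}. Q j) \<longleftrightarrow> (\<forall>j. j \<noteq> i \<longrightarrow> Q j)" for Q :: "'n \<Rightarrow> bool" by blast
      have 1: "(\<forall>j. j \<noteq> i \<longrightarrow> (y(m := T (y m))) j \<in> A j) \<longleftrightarrow> (\<forall>j. j \<noteq> i \<longrightarrow> y j \<in> B j)"
        by (intro all_cong1) (auto simp: B_def)
      have 2: "y(m := T (y m)) \<in> extensional (UNIV - {i}) \<longleftrightarrow> y \<in> extensional (UNIV - {i})"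
        using m by (auto simp: extensional_def)
      have P1: "y(m := T (y m)) \<in> Pi\<^sub>E (UNIV - {i}) A \<longleftrightarrow>
          (\<forall>j. j \<noteq> i \<longrightarrow> (y(m := T (y m))) j \<in> A j) \<and> y(m := T (y m)) \<in> extensional (UNIV - {i})"
        by (simp only: PiE_iff ball)
      have P2: "y \<in> Pi\<^sub>E (UNIV - {i}) B \<longleftrightarrow> (\<forall>j. j \<noteq> i \<longrightarrow> y j \<in> B j) \<and> y \<in> extensional (UNIV - {i})"
        by (simp only: PiE_iff ball)
      have P3: "y \<in> space (transverse i) \<longleftrightarrow> y \<in> extensional (UNIV - {i})"
        by (simp add: space_PiM PiE_iff)
      show "y \<in> (\<lambda>y. y(m := T (y m))) -` Pi\<^sub>E (UNIV - {i}) A \<inter> space (transverse i) \<longleftrightarrow>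
          y \<in> Pi\<^sub>E (UNIV - {i}) B"
        by (simp only: Int_iff vimage_eq P1 P2 P3 1 2 conj_assoc conj_absorb)
    qed
    moreover have "Pi\<^sub>E (UNIV - {i}) A \<in> sets (transverse i)" using A by (intro sets_PiM_I_finite) auto
    ultimately have "emeasure (distr (transverse i) (transverse i) (\<lambda>y. y(m := T (y m)))) (Pi\<^sub>E (UNIV - {i}) A)
        = emeasure (transverse i) (Pi\<^sub>E (UNIV - {i}) B)"
      by (simp add: emeasure_distr[OF meas])
    also have "\<dots> = (\<Prod>j\<in>UNIV - {i}. emeasure lborel (B j))"
      using B by (intro lborel_product.emeasure_PiM) auto
    also have "\<dots> = (\<Prod>j\<in>UNIV - {i}. emeasure lborel (A j))"
    proof (rule prod.cong[OF refl])
      have "emeasure lborel (A m) = emeasure (distr lborel borel T) (A m)" by (simp add: T)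
      also have "\<dots> = emeasure lborel (T -` A m)" using Am by (subst emeasure_distr) auto
      finally show "emeasure lborel (B j) = emeasure lborel (A j)" for j by (simp add: B_def)
    qed
    finally show "emeasure (distr (transverse i) (transverse i) (\<lambda>y. y(m := T (y m)))) (Pi\<^sub>E (UNIV - {i}) A) =
      (\<Prod>j\<in>UNIV - {i}. emeasure lborel (A j))" .
  qed auto
qed

text \<open>The azimuthal part of the second reflection, continued by the identity outside the
  angular range so that it acts on the whole line and can preserve Lebesgue measure there.\<close>

definition azimuth_flip :: "real \<Rightarrow> real" where
  "azimuth_flip s = (if s < 0 \<or> 2 * pi < s then s else if s \<le> pi then pi - s else 3 * pi - s)"

lemma azimuth_flip_measurable [measurable]: "azimuth_flip \<in> borel_measurable borel"
  unfolding azimuth_flip_def[abs_def] by measurable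

lemma distr_azimuth_flip: "distr lborel borel azimuth_flip = lborel"
proof (rule measure_eqI)
  fix A :: "real set" assume "A \<in> sets (distr lborel borel azimuth_flip)"
  then have A[measurable]: "A \<in> sets borel" by simp
  have refl: "(\<integral>\<^sup>+s. g (c - s) \<partial>lborel) = (\<integral>\<^sup>+s. g s \<partial>lborel)"
    if "g \<in> borel_measurable borel" for g and c :: real
    using nn_integral_real_affine[OF that, of "-1" c] by (simp add: diff_conv_add_uminus del: add_uminus_conv_diff)
  let ?I = "\<lambda>s. indicator A s :: ennreal"
  have "emeasure (distr lborel borel azimuth_flip) A = (\<integral>\<^sup>+s. ?I (azimuth_flip s) \<partial>lborel)"
    by (subst nn_integral_distr[symmetric, of azimuth_flip lborel borel]) auto
  \<comment> \<open>The line in three pieces, the last two expressed through the image point: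
    \<open>3 * pi - s\<close> in the half-open interval from \<open>pi\<close> to
    \<open>2 * pi\<close> means that \<open>s\<close> is above \<open>pi\<close> and at most
    \<open>2 * pi\<close>, the second branch of the reflection.\<close>
  also have "\<dots> = (\<integral>\<^sup>+s. ?I s * indicator (- {0..2 * pi}) s +
      (?I (pi - s) * indicator {0..pi} (pi - s) + ?I (3 * pi - s) * indicator {pi..<2 * pi} (3 * pi - s)) \<partial>lborel)"
    by (intro nn_integral_cong) (auto simp: azimuth_flip_def indicator_def)
  also have "\<dots> = (\<integral>\<^sup>+s. ?I s * indicator (- {0..2 * pi}) s \<partial>lborel) +
      ((\<integral>\<^sup>+s. ?I (pi - s) * indicator {0..pi} (pi - s) \<partial>lborel) +
       (\<integral>\<^sup>+s. ?I (3 * pi - s) * indicator {pi..<2 * pi} (3 * pi - s) \<partial>lborel))"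
    by (subst nn_integral_add, measurable, subst nn_integral_add, measurable)
  also have "\<dots> = (\<integral>\<^sup>+s. ?I s * indicator (- {0..2 * pi}) s \<partial>lborel) +
      ((\<integral>\<^sup>+s. ?I s * indicator {0..pi} s \<partial>lborel) + (\<integral>\<^sup>+s. ?I s * indicator {pi..<2 * pi} s \<partial>lborel))"
    using refl[of "\<lambda>s. ?I s * indicator {0..pi} s" pi] refl[of "\<lambda>s. ?I s * indicator {pi..<2 * pi} s" "3 * pi"]
    by simp
  also have "\<dots> = (\<integral>\<^sup>+s. ?I s * indicator (- {0..2 * pi}) s +
      (?I s * indicator {0..pi} s + ?I s * indicator {pi..<2 * pi} s) \<partial>lborel)"
    by (subst nn_integral_add, measurable, subst nn_integral_add, measurable)
  also have "\<dots> = (\<integral>\<^sup>+s. ?I s \<partial>lborel)"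
  proof (rule nn_integral_cong_AE)
    \<comment> \<open>The point \<open>pi\<close> is counted twice and \<open>2 * pi\<close> not at
      all, so the integrands agree only almost everywhere.\<close>
    show "AE s in lborel. ?I s * indicator (- {0..2 * pi}) s +
      (?I s * indicator {0..pi} s + ?I s * indicator {pi..<2 * pi} s) = ?I s"
      using AE_lborel_singleton[of pi] AE_lborel_singleton[of "2 * pi"]
      by eventually_elim (auto simp: indicator_def)
  qed
  finally show "emeasure (distr lborel borel azimuth_flip) A = emeasure lborel A" by simp
qed simp

lemma reflect_slice:
  "reflect 1 (slice 1 a y) = slice 1 a (y(4 := - y 4))"
  "0 \<le> y 5 \<Longrightarrow> y 5 \<le> 2 * pi \<Longrightarrow> reflect 2 (slice 2 a y) = slice 2 a (y(5 := azimuth_flip (y 5)))"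
  by (auto simp: vec_eq_iff reflect_nth azimuth_flip_def)

lemma borel_measurable_slice_vec [measurable (raw)]:
  assumes "g \<in> borel_measurable M"
  shows "(\<lambda>x. slice i a (($) (g x))) \<in> borel_measurable M"
  unfolding slice_def
proof (rule borel_measurable_vec_lambda)
  have "(\<lambda>x. g x $ j) \<in> borel_measurable M" for j
    by (rule measurable_compose[OF assms borel_measurable_vec_nth'])
  then show "(\<lambda>x. if j = i then a else g x $ j) \<in> borel_measurable M" for j
    by (cases "j = i") auto
qed

lemma borel_measurable_reflect [measurable]: "reflect i \<in> borel_measurable borel"
proof -
  have "(\<lambda>z::phase_point. \<chi> j. if j = 4 then - (z $ 4) else z $ j) \<in> borel_measurable borel"
  proof (rule borel_measurable_vec_lambda)
    show "(\<lambda>z::phase_point. if j = 4 then - (z $ 4) else z $ j) \<in> borel_measurable borel" for j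
      by (cases "j = 4") measurable
  qed
  moreover have "(\<lambda>z::phase_point. \<chi> j. if j = 5 then if z $ 5 \<le> pi then pi - z $ 5 else 3 * pi - z $ 5
      else z $ j) \<in> borel_measurable borel"
  proof (rule borel_measurable_vec_lambda)
    show "(\<lambda>z::phase_point. if j = 5 then if z $ 5 \<le> pi then pi - z $ 5 else 3 * pi - z $ 5
      else z $ j) \<in> borel_measurable borel" for j
      by (cases "j = 5") measurable
  qed
  ultimately show ?thesis
    unfolding reflect_def[abs_def] set_coord_def by (cases "i = 1") simp_all
qed

context kane_dg
begin

lemma fminus_measurable [measurable]: "fminus i \<in> borel_measurable borel"
  and fplus_measurable [measurable]: "fplus i \<in> borel_measurable borel"
proof -
  have [measurable]: "cpoly K \<in> borel_measurable borel" if "K \<in> cells" for K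
    using continuous_on_cpoly[OF that] by (rule borel_measurable_continuous_onI)
  show "fminus i \<in> borel_measurable borel" "fplus i \<in> borel_measurable borel"
    unfolding fminus_def[abs_def] fplus_def[abs_def]
    by (intro borel_measurable_sum measurable_If; measurable)+
qed

lemma fhat_measurable [measurable]: "fhat i \<in> borel_measurable borel"
  unfolding fhat_def[abs_def] by measurable

lemma fhat_bounded:
  obtains C where "0 \<le> C" "\<And>i z. \<bar>fhat i z\<bar> \<le> C" "\<And>i z. \<bar>fminus i z\<bar> \<le> C" "\<And>i z. \<bar>fplus i z\<bar> \<le> C"
proof -
  have "\<exists>c. 0 \<le> c \<and> (\<forall>z\<in>Omega_C M. \<bar>cpoly K z\<bar> \<le> c)" if "K \<in> cells" for K
    using bounded_on_Omega_C[OF continuous_on_cpoly[OF that]] by metis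
  then obtain c where c: "\<And>K. K \<in> cells \<Longrightarrow> 0 \<le> c K \<and> (\<forall>z\<in>Omega_C M. \<bar>cpoly K z\<bar> \<le> c K)" by metis
  have in_O: "z \<in> Omega_C M" if "K \<in> cells" "z \<in> cface i K" "z $ i = lw K $ i \<or> z $ i = up K $ i" for K i z
    using cface_end_in_cell[OF that] cell_subset[OF that(1)] by blast
  have minus: "\<bar>fminus i z\<bar> \<le> sum c cells" and plus: "\<bar>fplus i z\<bar> \<le> sum c cells" for i z
    unfolding fminus_def fplus_def
    by (rule order_trans[OF sum_abs], rule sum_mono, use c in_O[of _ z i] in auto)+
  have "0 \<le> sum c cells" using c by (auto intro: sum_nonneg)
  moreover from this have "\<bar>fhat i z\<bar> \<le> sum c cells" for i z
    by (auto simp: fhat_def minus plus)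
  ultimately show ?thesis using minus plus that by blast
qed

text \<open>A class that contains the field and its divergence terms, is closed under sums and under
  products with bounded Borel functions, and yields integrability over boxes as well as over their
  faces.\<close>

definition controlled :: "(phase_point \<Rightarrow> real) \<Rightarrow> bool" where
  "controlled G \<longleftrightarrow> G \<in> borel_measurable borel \<and> (\<exists>C. \<forall>z\<in>Omega_C M. \<bar>G z\<bar> \<le> C * weight (z $ 4))"

lemma controlled_wfield: "controlled (wfield i)"
  by (rule wfield_bound[of i]) (unfold controlled_def, blast intro: wfield_measurable)

lemma controlled_wdiv: "controlled (wdiv i)"
  by (rule wdiv_bound[of i]) (unfold controlled_def, blast intro: wdiv_measurable)

lemma controlled_mult:
  assumes "controlled G" and [measurable]: "g \<in> borel_measurable borel" and g: "\<And>z. z \<in> Omega_C M \<Longrightarrow> \<bar>g z\<bar> \<le> c"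
  shows "controlled (\<lambda>z. g z * G z)"
proof -
  have [measurable]: "G \<in> borel_measurable borel" using assms(1) by (simp add: controlled_def)
  obtain C where C: "\<And>z. z \<in> Omega_C M \<Longrightarrow> \<bar>G z\<bar> \<le> C * weight (z $ 4)"
    using assms(1) by (auto simp: controlled_def)
  have "\<bar>g z * G z\<bar> \<le> c * C * weight (z $ 4)" if "z \<in> Omega_C M" for z
    using mult_mono[OF g[OF that] C[OF that]] g[OF that] by (simp add: abs_mult mult.assoc)
  then show ?thesis unfolding controlled_def by (intro conjI exI[of _ "c * C"]) auto
qed

lemma controlled_add:
  assumes "controlled F" "controlled G"
  shows "controlled (\<lambda>z. F z + G z)"
proof -
  have [measurable]: "F \<in> borel_measurable borel" "G \<in> borel_measurable borel"
    using assms by (simp_all add: controlled_def)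
  obtain C where C: "\<And>z. z \<in> Omega_C M \<Longrightarrow> \<bar>F z\<bar> \<le> C * weight (z $ 4)"
    using assms(1) by (auto simp: controlled_def)
  obtain D where D: "\<And>z. z \<in> Omega_C M \<Longrightarrow> \<bar>G z\<bar> \<le> D * weight (z $ 4)"
    using assms(2) by (auto simp: controlled_def)
  have "\<bar>F z + G z\<bar> \<le> (C + D) * weight (z $ 4)" if "z \<in> Omega_C M" for z
    using C[OF that] D[OF that] by (simp add: distrib_right)
  then show ?thesis unfolding controlled_def by (intro conjI exI[of _ "C + D"]) auto
qed

lemma weight_measurable [measurable]: "weight \<in> borel_measurable borel"
  unfolding weight_def[abs_def] by measurable

lemma set_integrable_weight: "-1 \<le> a \<Longrightarrow> b \<le> 1 \<Longrightarrow> set_integrable lborel {a..b} weight"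
  unfolding weight_def[abs_def]
  by (rule set_integrable_subset[where A = "{-1..1}"], rule set_integral_add(1)[OF _ set_integrable_arcsin_derivative])
     (auto simp: set_integrable_def integrable_indicator_iff emeasure_lborel_Icc_eq)

lemma integrable_controlled_face:
  assumes G: "controlled G" and lu: "\<And>j. lo M $ j \<le> l $ j" "\<And>j. u $ j \<le> hi M $ j"
    and a: "lo M $ i \<le> a" "a \<le> hi M $ i"
  shows "integrable (transverse i) (\<lambda>y. indicator (face i l u) (slice i a y) * G (slice i a y))"
proof -
  have [measurable]: "G \<in> borel_measurable borel" using G by (simp add: controlled_def)
  obtain C where C: "\<And>z. z \<in> Omega_C M \<Longrightarrow> \<bar>G z\<bar> \<le> C * weight (z $ 4)"
    using G by (auto simp: controlled_def)
  have "set_integrable lborel {l $ 4..u $ 4} weight"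
    using lu[of 4] by (intro set_integrable_weight) auto
  from integrable_mult_right[OF integrable_face_weight[OF this, of i a], of C]
  show ?thesis
  proof (rule Bochner_Integration.integrable_bound)
    show "AE y in transverse i. norm (indicator (face i l u) (slice i a y) * G (slice i a y))
        \<le> norm (C * (indicator (face i l u) (slice i a y) * weight (slice i a y $ 4)))"
    proof (rule AE_I2)
      fix y
      show "norm (indicator (face i l u) (slice i a y) * G (slice i a y))
        \<le> norm (C * (indicator (face i l u) (slice i a y) * weight (slice i a y $ 4)))"
      proof (cases "slice i a y \<in> face i l u")
        case True
        then have y: "l $ j < y j" "y j < u $ j" if "j \<noteq> i" for j using that by auto
        have "lo M $ j \<le> slice i a y $ j \<and> slice i a y $ j \<le> hi M $ j" for j
          using y[of j] lu(1)[of j] lu(2)[of j] a by (cases "j = i") auto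
        then have "slice i a y \<in> Omega_C M" by (simp add: Omega_C_def mem_box_cart del: slice_nth)
        from C[OF this] show ?thesis using True
          by (simp del: slice_nth add: order_trans[OF _ abs_ge_self])
      qed (simp del: slice_nth slice_in_face)
    qed
  qed measurable
qed

lemma set_integrable_controlled:
  assumes G: "controlled G" and lu: "\<And>j. lo M $ j \<le> l $ j" "\<And>j. u $ j \<le> hi M $ j"
  shows "set_integrable lborel (cbox l u) G"
proof -
  have [measurable]: "G \<in> borel_measurable borel" using G by (simp add: controlled_def)
  obtain C where C: "\<And>z. z \<in> Omega_C M \<Longrightarrow> \<bar>G z\<bar> \<le> C * weight (z $ 4)"
    using G by (auto simp: controlled_def)
  have "set_integrable lborel {l $ 4..u $ 4} weight"
    using lu[of 4] by (intro set_integrable_weight) auto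
  from set_integrable_cbox_weight[OF this weight_measurable]
  have "set_integrable lborel (cbox l u) (\<lambda>z. C * weight (z $ 4))" by simp
  then show ?thesis
  proof (rule set_integrable_bound)
    show "set_borel_measurable lborel (cbox l u) G" unfolding set_borel_measurable_def by measurable
    show "AE z in lborel. z \<in> cbox l u \<longrightarrow> norm (G z) \<le> norm (C * weight (z $ 4))"
    proof (intro AE_I2 impI)
      fix z assume "z \<in> cbox l u"
      then have "z \<in> Omega_C M" by (auto simp: Omega_C_def mem_box_cart intro: order_trans[OF lu(1)] order_trans[OF _ lu(2)])
      from C[OF this] show "norm (G z) \<le> norm (C * weight (z $ 4))"
        by (simp add: order_trans[OF _ abs_ge_self])
    qed
  qed
qed

end

section \<open>Sign of the transport terms\<close>

context kane_dg
begin

lemma generic_AE: "AE y in transverse i. \<forall>j. j \<noteq> i \<longrightarrow> y j \<notin> exceptional j"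
  by (rule AE_transverse_generic) (rule finite_exceptional)

text \<open>Averaging over the measure-preserving reflection of the momentum.\<close>

lemma specular_integral_nonneg:
  fixes H :: "phase_point \<Rightarrow> real"
  assumes i: "specular_dir M i" and [measurable]: "H \<in> borel_measurable borel"
    and int: "integrable (transverse i) (\<lambda>y. H (slice i a y))"
    and sym: "\<And>z. z $ i = a \<Longrightarrow> z \<in> face i (lo M) (hi M) \<Longrightarrow> (\<And>j. j \<noteq> i \<Longrightarrow> z $ j \<notin> exceptional j) \<Longrightarrow>
      0 \<le> H z + H (reflect i z)"
    and out: "\<And>z. z \<notin> face i (lo M) (hi M) \<Longrightarrow> H z = 0"
  shows "0 \<le> (\<integral>y. H (slice i a y) \<partial>transverse i)"
proof -
  define m :: 5 where "m = (if i = 1 then 4 else 5)"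
  define T where "T = (if i = 1 then uminus else azimuth_flip)"
  define \<sigma> where "\<sigma> y = y(m := T (y m))" for y :: "5 \<Rightarrow> real"
  have i12: "i = 1 \<or> i = 2" using i by (auto simp: specular_dir_def)
  have m: "m \<noteq> i" using i12 by (auto simp: m_def)
  have T: "distr lborel borel T = lborel"
    using lborel_distr_uminus distr_azimuth_flip by (simp add: T_def)
  have [measurable]: "T \<in> borel_measurable borel" by (simp add: T_def)
  have dist: "distr (transverse i) (transverse i) \<sigma> = transverse i"
    and \<sigma>_meas[measurable]: "\<sigma> \<in> transverse i \<rightarrow>\<^sub>M transverse i"
    unfolding \<sigma>_def[abs_def] by (rule distr_transverse_coordinate[OF T _ m]; measurable)+
  have \<sigma>_in: "reflect i (slice i a y) = slice i a (\<sigma> y)" if "slice i a y \<in> face i (lo M) (hi M)" for y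
    using i12
  proof
    assume "i = 1" then show ?thesis using reflect_slice(1)[of a y] by (simp add: \<sigma>_def T_def m_def)
  next
    assume i: "i = 2"
    have "\<forall>j. j \<noteq> i \<longrightarrow> lo M $ j < y j \<and> y j < hi M $ j" using that by simp
    then have "lo M $ 5 < y 5 \<and> y 5 < hi M $ 5" using i by (auto dest: spec[of _ 5])
    with i show ?thesis using reflect_slice(2)[of y a] by (simp add: \<sigma>_def T_def m_def)
  qed
  \<comment> \<open>Off the face \<sigma> need not be the reflection, since
    \<open>azimuth_flip\<close> is the identity beyond the angular range. It is enough that \<sigma>
    does not lead into the face, as \<open>H\<close> vanishes elsewhere.\<close>
  have \<sigma>_out: "slice i a (\<sigma> y) \<notin> face i (lo M) (hi M)"
    if nin: "slice i a y \<notin> face i (lo M) (hi M)" and ex: "\<forall>j. j \<noteq> i \<longrightarrow> y j \<notin> exceptional j" for y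
  proof -
    obtain j where j: "j \<noteq> i" "\<not> (lo M $ j < y j \<and> y j < hi M $ j)" using nin unfolding slice_in_face by blast
    have "y j \<noteq> lo M $ j \<and> y j \<noteq> hi M $ j" using ex j(1) by (auto simp: exceptional_def)
    then have "\<not> (lo M $ j < \<sigma> y j \<and> \<sigma> y j < hi M $ j)"
      using j i12 by (auto simp: \<sigma>_def T_def m_def azimuth_flip_def)
    with j(1) show ?thesis by auto
  qed
  have int': "integrable (transverse i) (\<lambda>y. H (slice i a (\<sigma> y)))"
  proof -
    have "integrable (distr (transverse i) (transverse i) \<sigma>) (\<lambda>y. H (slice i a y))"
      by (simp only: dist int)
    from integrable_distr[OF \<sigma>_meas this] show ?thesis .
  qed
  have "(\<integral>y. H (slice i a y) \<partial>distr (transverse i) (transverse i) \<sigma>) =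
      (\<integral>y. H (slice i a (\<sigma> y)) \<partial>transverse i)"
    by (rule integral_distr) measurable
  then have "(\<integral>y. H (slice i a y) \<partial>transverse i) = (\<integral>y. H (slice i a (\<sigma> y)) \<partial>transverse i)"
    by (simp only: dist)
  then have "2 * (\<integral>y. H (slice i a y) \<partial>transverse i) =
      (\<integral>y. H (slice i a y) + H (slice i a (\<sigma> y)) \<partial>transverse i)"
    using int int' by simp
  also have "\<dots> \<ge> 0"
  proof (rule integral_nonneg_AE)
    show "AE y in transverse i. 0 \<le> H (slice i a y) + H (slice i a (\<sigma> y))"
      using generic_AE
    proof eventually_elim
      case (elim y)
      show ?case
      proof (cases "slice i a y \<in> face i (lo M) (hi M)")
        case True
        have "0 \<le> H (slice i a y) + H (reflect i (slice i a y))"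
          by (rule sym[OF _ True]) (use elim in auto)
        then show ?thesis by (simp only: \<sigma>_in[OF True])
      next
        case False
        then show ?thesis using out[OF False] out[OF \<sigma>_out[OF False elim]] by simp
      qed
    qed
  qed
  finally show ?thesis by simp
qed

lemma face_Omega_C:
  assumes "z \<in> face i (lo M) (hi M)" "lo M $ i \<le> z $ i" "z $ i \<le> hi M $ i"
  shows "z \<in> Omega_C M"
proof -
  have "lo M $ j \<le> z $ j \<and> z $ j \<le> hi M $ j" for j
    using assms by (cases "j = i") (auto simp: face_def less_imp_le)
  then show ?thesis by (simp add: Omega_C_def mem_box_cart)
qed

text \<open>If the field is nonzero, one of \<open>z\<close> and its reflection is an inflow point
  and the other an outflow point, and the upwind value at both is the trace at the outflow point.
  The terms add up to half the squared difference of the two traces times the modulus of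
  \<open>wfield\<close>. The minus signs come from the outward normal at the lower side.\<close>

lemma specular_lo_sym:
  assumes i: "specular_dir M i" and z: "z $ i = lo M $ i" "z \<in> face i (lo M) (hi M)"
    and ex: "\<And>j. j \<noteq> i \<Longrightarrow> z $ j \<notin> exceptional j"
  shows "0 \<le> - phi (fplus i) i z - phi (fplus i) i (reflect i z)"
proof -
  have zO: "z \<in> Omega_C M" using face_Omega_C[OF z(2)] z(1) lo_less_hi[of i] by simp
  have i12: "i = 1 \<or> i = 2" using i by (auto simp: specular_dir_def)
  have np: "\<not> periodic_dir M i" using i by (auto simp: specular_dir_def periodic_dir_def)
  \<comment> \<open>The azimuthal reflection is an involution except at the end
    \<open>2 * pi\<close>, which goes to \<open>pi\<close> and then to 0.\<close>
  have "z $ 5 \<noteq> hi M $ 5 \<and> z $ 5 \<noteq> pi" if "i = 2" using ex[of 5] that by (auto simp: exceptional_def)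
  moreover have "0 \<le> z $ 5 \<and> z $ 5 \<le> 2 * pi" using zO by (simp add: mem_Omega_C)
  ultimately have RR: "reflect i (reflect i z) = z" using i12
    by (auto simp: vec_eq_iff reflect_nth)
  have W: "wfield i (reflect i z) = - wfield i z" by (rule wfield_reflect[OF i zO])
  have Ri: "reflect i z $ i = lo M $ i" using reflect_same[OF i] z(1) by simp
  have eq: "- phi (fplus i) i z - phi (fplus i) i (reflect i z) =
      (fplus i z - fplus i (reflect i z))\<^sup>2 / 2 * \<bar>wfield i z\<bar>"
    using np i z(1) Ri lo_less_hi[of i] RR W
    by (cases "0 < wfield i z"; cases "wfield i z < 0")
       (auto simp: phi_def fhat_def power2_eq_square field_simps)
  show ?thesis unfolding eq by simp
qed

lemma specular_hi_sym:
  assumes i: "specular_dir M i" and z: "z $ i = hi M $ i" "z \<in> face i (lo M) (hi M)"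
    and ex: "\<And>j. j \<noteq> i \<Longrightarrow> z $ j \<notin> exceptional j"
  shows "0 \<le> phi (fminus i) i z + phi (fminus i) i (reflect i z)"
proof -
  have zO: "z \<in> Omega_C M" using face_Omega_C[OF z(2)] z(1) lo_less_hi[of i] by simp
  have i12: "i = 1 \<or> i = 2" using i by (auto simp: specular_dir_def)
  have np: "\<not> periodic_dir M i" using i by (auto simp: specular_dir_def periodic_dir_def)
  have "z $ 5 \<noteq> hi M $ 5 \<and> z $ 5 \<noteq> pi" if "i = 2" using ex[of 5] that by (auto simp: exceptional_def)
  moreover have "0 \<le> z $ 5 \<and> z $ 5 \<le> 2 * pi" using zO by (simp add: mem_Omega_C)
  ultimately have RR: "reflect i (reflect i z) = z" using i12
    by (auto simp: vec_eq_iff reflect_nth)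
  have W: "wfield i (reflect i z) = - wfield i z" by (rule wfield_reflect[OF i zO])
  have Ri: "reflect i z $ i = hi M $ i" using reflect_same[OF i] z(1) by simp
  have eq: "phi (fminus i) i z + phi (fminus i) i (reflect i z) =
      (fminus i z - fminus i (reflect i z))\<^sup>2 / 2 * \<bar>wfield i z\<bar>"
    using np i z(1) Ri lo_less_hi[of i] RR W
    by (cases "0 < wfield i z"; cases "wfield i z < 0")
       (auto simp: phi_def fhat_def power2_eq_square field_simps)
  show ?thesis unfolding eq by simp
qed

text \<open>A pair of periodic sides acts like an interior interface, as the field has the same
  value on both. In the energy the trace vanishes at the upper end and the field at the lower one;
  in \<mu> the field vanishes at both.\<close>

lemma boundary_nonneg:
  assumes ns: "\<not> specular_dir M i" and z: "z \<in> face i (lo M) (hi M)" and gen: "generic i z"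
  shows "0 \<le> phi (fminus i) i (slice i (hi M $ i) (($) z)) - phi (fplus i) i (slice i (lo M $ i) (($) z))"
proof -
  let ?h = "slice i (hi M $ i) (($) z)" and ?l = "slice i (lo M $ i) (($) z)"
  consider (periodic) "periodic_dir M i" | (energy) "i = 3" | (angle) "i = 4"
    using exhaust_5[of i] ns position_bc.exhaust[of "bc_x M"] position_bc.exhaust[of "bc_y M"]
    by (auto simp: periodic_dir_def specular_dir_def)
  then show ?thesis
  proof cases
    case periodic
    have "?l \<in> Omega_C M"
      by (rule face_Omega_C) (use z lo_less_hi[of i] in \<open>auto simp: cface_slice less_imp_le face_def\<close>)
    from wfield_periodic[OF periodic this] have W: "wfield i ?h = wfield i ?l" by simp
    have eq: "phi (fminus i) i ?h - phi (fplus i) i ?l = (fminus i ?h - fplus i ?l)\<^sup>2 / 2 * \<bar>wfield i ?l\<bar>"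
      using W periodic lo_less_hi[of i]
      by (cases "0 < wfield i ?l"; cases "wfield i ?l < 0")
         (auto simp: phi_def fhat_def power2_eq_square field_simps)
    show ?thesis unfolding eq by simp
  next
    case energy
    have hF: "?h \<in> face i (lo M) (hi M)" "generic i ?h" using z gen by (simp_all only: cface_slice generic_slice)
    then obtain K where K: "K \<in> cells" "?h \<in> cface i K" "up K $ i = hi M $ i" by (rule cell_at_hi)
    then have "?h $ i = up K $ i" by simp
    then have "fminus i ?h = cpoly K ?h" "?h \<in> K"
      using fminus_eq[OF K(1,2)] cface_end_in_cell[OF K(1,2)] by auto
    then have "fminus i ?h = 0" using cpoly_cutoff[OF K(1)] energy by simp
    moreover have "wfield i ?l = 0" using energy by (simp add: wfield_vanishes)
    ultimately show ?thesis by (simp add: phi_def)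
  next
    case angle
    then show ?thesis by (simp add: phi_def wfield_vanishes)
  qed
qed

section \<open>Face terms summed over cells and directions\<close>

lemma cpoly_measurable: "K \<in> cells \<Longrightarrow> cpoly K \<in> borel_measurable borel"
  using continuous_on_cpoly by (rule borel_measurable_continuous_onI)

lemma dpoly_measurable: "K \<in> cells \<Longrightarrow> dpoly K i \<in> borel_measurable borel"
  using continuous_on_dpoly by (rule borel_measurable_continuous_onI)

lemma controlled_cpoly_mult: "K \<in> cells \<Longrightarrow> controlled G \<Longrightarrow> controlled (\<lambda>z. cpoly K z * G z)"
  using bounded_on_Omega_C[OF continuous_on_cpoly] controlled_mult cpoly_measurable by metis

lemma controlled_dpoly_mult: "K \<in> cells \<Longrightarrow> controlled G \<Longrightarrow> controlled (\<lambda>z. dpoly K i z * G z)"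
  using bounded_on_Omega_C[OF continuous_on_dpoly] controlled_mult dpoly_measurable by metis

lemma controlled_fhat_mult: "controlled G \<Longrightarrow> controlled (\<lambda>z. fhat i z * G z)"
  using fhat_bounded controlled_mult fhat_measurable by metis

lemma controlled_fminus_mult: "controlled G \<Longrightarrow> controlled (\<lambda>z. fminus i z * G z)"
  using fhat_bounded controlled_mult fminus_measurable by metis

lemma controlled_fplus_mult: "controlled G \<Longrightarrow> controlled (\<lambda>z. fplus i z * G z)"
  using fhat_bounded controlled_mult fplus_measurable by metis

lemma controlled_cmult: "controlled G \<Longrightarrow> controlled (\<lambda>z. c * G z)"
  by (rule controlled_mult[where c = "\<bar>c\<bar>"]) auto

lemma controlled_phi:
  assumes g: "\<And>G. controlled G \<Longrightarrow> controlled (\<lambda>z. g z * G z)"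
  shows "controlled (phi g i)"
proof -
  have "controlled (\<lambda>z. fhat i z * (g z * wfield i z) + (- 1 / 2) * (g z * (g z * wfield i z)))"
    by (intro controlled_add controlled_fhat_mult controlled_cmult g controlled_wfield)
  also have "(\<lambda>z. fhat i z * (g z * wfield i z) + (- 1 / 2) * (g z * (g z * wfield i z))) = phi g i"
    by (auto simp: phi_def power2_eq_square algebra_simps)
  finally show ?thesis .
qed

lemmas controlled_phi_cpoly = controlled_phi[OF controlled_cpoly_mult]
  and controlled_phi_fminus = controlled_phi[OF controlled_fminus_mult]
  and controlled_phi_fplus = controlled_phi[OF controlled_fplus_mult]

definition face_term :: "5 \<Rightarrow> (phase_point \<Rightarrow> real) \<Rightarrow> phase_point set \<Rightarrow> (5 \<Rightarrow> real) \<Rightarrow> real" where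
  "face_term i G K y = indicator (cface i K) (slice i (up K $ i) y) * G (slice i (up K $ i) y) -
     indicator (cface i K) (slice i (lw K $ i) y) * G (slice i (lw K $ i) y)"

lemma integrable_face_parts:
  assumes K: "K \<in> cells" and G: "controlled G"
  shows "integrable (transverse i) (\<lambda>y. indicator (cface i K) (slice i (up K $ i) y) * G (slice i (up K $ i) y))"
    and "integrable (transverse i) (\<lambda>y. indicator (cface i K) (slice i (lw K $ i) y) * G (slice i (lw K $ i) y))"
    and "integrable (transverse i) (face_term i G K)"
proof -
  have b: "lo M $ i \<le> up K $ i" "lw K $ i \<le> hi M $ i"
    using cell_bounds[OF K, of i] lw_less_up[OF K, of i] by auto
  show 1: "integrable (transverse i) (\<lambda>y. indicator (cface i K) (slice i (up K $ i) y) * G (slice i (up K $ i) y))"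
    by (rule integrable_controlled_face[OF G cell_bounds(1)[OF K] cell_bounds(2)[OF K] b(1) cell_bounds(2)[OF K]])
  show 2: "integrable (transverse i) (\<lambda>y. indicator (cface i K) (slice i (lw K $ i) y) * G (slice i (lw K $ i) y))"
    by (rule integrable_controlled_face[OF G cell_bounds(1)[OF K] cell_bounds(2)[OF K] cell_bounds(1)[OF K] b(2)])
  show "integrable (transverse i) (face_term i G K)"
    unfolding face_term_def[abs_def] by (rule Bochner_Integration.integrable_diff[OF 1 2])
qed

lemma sum_face_term_ge:
  assumes ex: "\<forall>j. j \<noteq> i \<longrightarrow> y j \<notin> exceptional j"
  shows "indicator (face i (lo M) (hi M)) (slice i (hi M $ i) y) * phi (fminus i) i (slice i (hi M $ i) y) -
    indicator (face i (lo M) (hi M)) (slice i (lo M $ i) y) * phi (fplus i) i (slice i (lo M $ i) y)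
    \<le> (\<Sum>K\<in>cells. face_term i (phi (cpoly K) i) K y)"
proof -
  \<comment> \<open>The entry 0 is a placeholder: only the line through \<open>z\<close> in
    direction \<open>i\<close> matters.\<close>
  define z where "z = slice i 0 y"
  have s: "slice i a y = slice i a (($) z)" for a by (simp add: z_def)
  have gen: "generic i z" by (rule generic_exceptional) (use ex in \<open>auto simp: z_def\<close>)
  have ft: "face_term i (phi (cpoly K) i) K y = (if z \<in> cface i K then
     phi (cpoly K) i (slice i (up K $ i) (($) z)) - phi (cpoly K) i (slice i (lw K $ i) (($) z)) else 0)" for K
    unfolding face_term_def s by (simp only: indicator_def cface_slice) simp
  have "(\<Sum>K\<in>cells. face_term i (phi (cpoly K) i) K y) = (\<Sum>K | K \<in> cells \<and> z \<in> cface i K.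
     phi (cpoly K) i (slice i (up K $ i) (($) z)) - phi (cpoly K) i (slice i (lw K $ i) (($) z)))"
    unfolding ft by (rule sum.inter_filter[OF finite_cells, symmetric])
  moreover have "(\<Sum>K\<in>cells. face_term i (phi (cpoly K) i) K y) = 0" if "z \<notin> face i (lo M) (hi M)"
    unfolding ft using cface_subset that by (intro sum.neutral) auto
  ultimately show ?thesis
    unfolding s using line_sum_ge[OF _ gen]
    by (cases "z \<in> face i (lo M) (hi M)") (simp_all only: indicator_def cface_slice, simp_all)
qed

text \<open>Without specular reflection the sign holds on almost every line, its two ends being
  paired. With it, each end has to be compared with an end of the reflected line, so the two sides
  are integrated separately and each is nonnegative by symmetry.\<close>

lemma flux_direction_nonneg: "0 \<le> (\<Sum>K\<in>cells. \<integral>y. face_term i (phi (cpoly K) i) K y \<partial>transverse i)"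
proof -
  have "(\<Sum>K\<in>cells. \<integral>y. face_term i (phi (cpoly K) i) K y \<partial>transverse i) =
      (\<integral>y. (\<Sum>K\<in>cells. face_term i (phi (cpoly K) i) K y) \<partial>transverse i)"
    by (rule Bochner_Integration.integral_sum[symmetric]) (intro integrable_face_parts controlled_phi_cpoly)
  also have "\<dots> \<ge> 0"
  proof (cases "specular_dir M i")
    case False
    show ?thesis
    proof (rule integral_nonneg_AE)
      show "AE y in transverse i. 0 \<le> (\<Sum>K\<in>cells. face_term i (phi (cpoly K) i) K y)"
        using generic_AE
      proof eventually_elim
        case (elim y)
        have z: "slice i 0 y \<in> face i (lo M) (hi M) \<Longrightarrow> 0 \<le> phi (fminus i) i (slice i (hi M $ i) y)
             - phi (fplus i) i (slice i (lo M $ i) y)"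
          using boundary_nonneg[OF False, of "slice i 0 y"] elim
            generic_exceptional[of i "slice i 0 y"] by simp
        then have "0 \<le> indicator (face i (lo M) (hi M)) (slice i (hi M $ i) y) * phi (fminus i) i (slice i (hi M $ i) y) -
          indicator (face i (lo M) (hi M)) (slice i (lo M $ i) y) * phi (fplus i) i (slice i (lo M $ i) y)"
          by (simp add: indicator_def)
        with sum_face_term_ge[OF elim] show ?case by linarith
      qed
    qed
  next
    case True
    let ?H = "\<lambda>z. indicator (face i (lo M) (hi M)) z * phi (fminus i) i z"
    let ?L = "\<lambda>z. - (indicator (face i (lo M) (hi M)) z * phi (fplus i) i z)"
    have le: "lo M $ i \<le> hi M $ i" using lo_less_hi by (rule less_imp_le)
    have iH: "integrable (transverse i) (\<lambda>y. ?H (slice i (hi M $ i) y))"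
      by (rule integrable_controlled_face[OF controlled_phi_fminus order_refl order_refl le order_refl])
    have iL: "integrable (transverse i) (\<lambda>y. ?L (slice i (lo M $ i) y))"
      by (intro integrable_minus
          integrable_controlled_face[OF controlled_phi_fplus order_refl order_refl order_refl le])
    have [measurable]: "phi (fminus i) i \<in> borel_measurable borel" "phi (fplus i) i \<in> borel_measurable borel"
      using controlled_phi_fminus controlled_phi_fplus by (simp_all add: controlled_def)
    have H: "0 \<le> (\<integral>y. ?H (slice i (hi M $ i) y) \<partial>transverse i)"
    proof (rule specular_integral_nonneg[OF True _ iH])
      show "?H \<in> borel_measurable borel" by measurable
      fix z assume *: "z $ i = hi M $ i" "z \<in> face i (lo M) (hi M)" "\<And>j. j \<noteq> i \<Longrightarrow> z $ j \<notin> exceptional j"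
      show "0 \<le> ?H z + ?H (reflect i z)"
        using specular_hi_sym[OF True *] reflect_face[OF True *(2,3)] *(2) by simp
    qed simp
    have L: "0 \<le> (\<integral>y. ?L (slice i (lo M $ i) y) \<partial>transverse i)"
    proof (rule specular_integral_nonneg[OF True _ iL])
      show "?L \<in> borel_measurable borel" by measurable
      fix z assume *: "z $ i = lo M $ i" "z \<in> face i (lo M) (hi M)" "\<And>j. j \<noteq> i \<Longrightarrow> z $ j \<notin> exceptional j"
      show "0 \<le> ?L z + ?L (reflect i z)"
        using specular_lo_sym[OF True *] reflect_face[OF True *(2,3)] *(2) by simp
    qed simp
    have "0 \<le> (\<integral>y. ?H (slice i (hi M $ i) y) \<partial>transverse i) + (\<integral>y. ?L (slice i (lo M $ i) y) \<partial>transverse i)"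
      using H L by linarith
    also have "\<dots> = (\<integral>y. ?H (slice i (hi M $ i) y) + ?L (slice i (lo M $ i) y) \<partial>transverse i)"
      by (rule Bochner_Integration.integral_add[symmetric, OF iH iL])
    also have "\<dots> \<le> (\<integral>y. (\<Sum>K\<in>cells. face_term i (phi (cpoly K) i) K y) \<partial>transverse i)"
    proof (rule integral_mono_AE)
      show "integrable (transverse i) (\<lambda>y. ?H (slice i (hi M $ i) y) + ?L (slice i (lo M $ i) y))"
        by (rule Bochner_Integration.integrable_add[OF iH iL])
      show "integrable (transverse i) (\<lambda>y. \<Sum>K\<in>cells. face_term i (phi (cpoly K) i) K y)"
        by (intro Bochner_Integration.integrable_sum integrable_face_parts controlled_phi_cpoly)
      show "AE y in transverse i. ?H (slice i (hi M $ i) y) + ?L (slice i (lo M $ i) y) \<le>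
          (\<Sum>K\<in>cells. face_term i (phi (cpoly K) i) K y)"
        using generic_AE
      proof eventually_elim
        case (elim y)
        from sum_face_term_ge[OF elim] show ?case by linarith
      qed
    qed
    finally show ?thesis .
  qed
  finally show ?thesis .
qed

text \<open>\<open>D i\<close> is the derivative of \<open>G i\<close> in coordinate
  \<open>i\<close>. Summed over \<open>i\<close>, its terms with \<open>wdiv\<close> cancel by
  \<open>sum_wdiv\<close>, and exactly the integrand of the volume term remains.\<close>

lemma volume_term:
  assumes K: "K \<in> cells"
  shows "set_integrable lborel K (\<lambda>z. \<Sum>i\<in>UNIV. wfield i z * cpoly K z * dpoly K i z)"
    and "(LINT z:K|lborel. \<Sum>i\<in>UNIV. wfield i z * cpoly K z * dpoly K i z) =
      (\<Sum>i\<in>UNIV. \<integral>y. face_term i (\<lambda>z. wfield i z * (cpoly K z)\<^sup>2 / 2) K y \<partial>transverse i)"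
proof -
  define D where "D i z = wdiv i z * (cpoly K z)\<^sup>2 / 2 + wfield i z * cpoly K z * dpoly K i z" for i z
  define G where "G i z = wfield i z * (cpoly K z)\<^sup>2 / 2" for i z
  have "controlled (\<lambda>z. (1 / 2) * (cpoly K z * (cpoly K z * wdiv i z)) + dpoly K i z * (cpoly K z * wfield i z))" for i
    by (intro controlled_add controlled_cmult controlled_cpoly_mult[OF K] controlled_dpoly_mult[OF K]
        controlled_wfield controlled_wdiv)
  also have "(\<lambda>z. (1 / 2) * (cpoly K z * (cpoly K z * wdiv i z)) + dpoly K i z * (cpoly K z * wfield i z)) = D i" for i
    by (auto simp: D_def power2_eq_square)
  finally have D: "controlled (D i)" for i .
  have int: "set_integrable lborel (cbox (lw K) (up K)) (D i)" for i
    by (rule set_integrable_controlled[OF D cell_bounds(1)[OF K] cell_bounds(2)[OF K]])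
  note cpoly_measurable[OF K, measurable]
  have FTC: "(LINT z:cbox (lw K) (up K)|lborel. D i z) = (\<integral>y. face_term i (G i) K y \<partial>transverse i)" for i
    unfolding face_term_def
  proof (rule integral_partial_derivative[OF less_imp_le[OF lw_less_up[OF K]] int])
    show "G i \<in> borel_measurable borel" unfolding G_def[abs_def] by measurable
    fix z
    have P: "((\<lambda>s. cpoly K (slice i s (($) z))) has_real_derivative dpoly K i z) (at (z $ i))"
    proof -
      have "(cpoly K has_derivative (\<lambda>v. \<Sum>i\<in>UNIV. v $ i * dpoly K i z)) (at z)"
        using C1_cpoly[OF K] by (simp add: C1_partials_def)
      from slice_has_derivative[OF this, of i] show ?thesis
        by (simp add: axis_def if_distrib[where f = "\<lambda>x. x * _"] cong: if_cong)
    qed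
    assume "z \<in> box (lw K) (up K)"
    then have "z \<in> interior (Omega_C M)"
      using interior_cell[OF K] interior_cell_subset[OF K] by blast
    from wfield_slice_derivative[OF this, of i] P
    show "((\<lambda>s. G i (slice i s (($) z))) has_real_derivative D i z) (at (z $ i))"
      unfolding G_def D_def by (auto intro!: derivative_eq_intros simp: power2_eq_square field_simps)
  next
    fix z assume "z \<in> cface i K"
    then have "z \<in> face i (lo M) (hi M)" using cface_subset[OF K] by blast
    then have W: "continuous_on {lw K $ i..up K $ i} (\<lambda>s. wfield i (slice i s (($) z)))"
      using cell_bounds[OF K, of i] by (intro continuous_on_subset[OF wfield_slice_continuous]) auto
    have "continuous_on {lw K $ i..up K $ i} (\<lambda>s. slice i s (($) z))"
      unfolding slice_def
    proof (rule continuous_on_vec_lambda)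
      show "continuous_on {lw K $ i..up K $ i} (\<lambda>s. if j = i then s else z $ j)" for j
        by (cases "j = i") (auto intro: continuous_intros)
    qed
    then have "continuous_on {lw K $ i..up K $ i} (\<lambda>s. cpoly K (slice i s (($) z)))"
      by (rule continuous_on_compose2[OF continuous_on_cpoly[OF K, of UNIV]]) auto
    then show "continuous_on {lw K $ i..up K $ i} (\<lambda>s. G i (slice i s (($) z)))"
      unfolding G_def by (intro continuous_intros W) auto
  qed
  have sum: "(\<Sum>i\<in>UNIV. wfield i z * cpoly K z * dpoly K i z) = (\<Sum>i\<in>UNIV. D i z)" for z
    using sum_wdiv[of z]
    by (simp add: D_def sum.distrib sum_divide_distrib[symmetric] sum_distrib_right[symmetric])
  show "set_integrable lborel K (\<lambda>z. \<Sum>i\<in>UNIV. wfield i z * cpoly K z * dpoly K i z)"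
    using int unfolding sum set_integrable_def scaleR_sum_right cell_eq[OF K, symmetric]
    by (intro Bochner_Integration.integrable_sum)
  have "(LINT z:K|lborel. \<Sum>i\<in>UNIV. D i z) = (\<Sum>i\<in>UNIV. LINT z:cbox (lw K) (up K)|lborel. D i z)"
    using int unfolding set_lebesgue_integral_def set_integrable_def scaleR_sum_right
      cell_eq[OF K, symmetric] by (intro Bochner_Integration.integral_sum)
  then show "(LINT z:K|lborel. \<Sum>i\<in>UNIV. wfield i z * cpoly K z * dpoly K i z) =
      (\<Sum>i\<in>UNIV. \<integral>y. face_term i (\<lambda>z. wfield i z * (cpoly K z)\<^sup>2 / 2) K y \<partial>transverse i)"
    unfolding sum by (simp add: FTC G_def[abs_def])
qed

text \<open>In the product rule the derivative of \<open>eH\<close> along \<open>beta\<close> drops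
  out by \<open>sum_beta_dham\<close>; what remains is \<open>eH\<close> times the derivative of the
  polynomial.\<close>

lemma beta_deriv_eq:
  assumes K: "K \<in> cells" and z: "z \<in> interior K"
  shows "f z * beta_deriv M t (\<lambda>z. f z * eH z) z = (\<Sum>i\<in>UNIV. wfield i z * cpoly K z * dpoly K i z)"
proof -
  have zi: "z \<in> interior (Omega_C M)" using interior_cell_subset[OF K] z by blast
  have P: "(cpoly K has_derivative (\<lambda>v. \<Sum>i\<in>UNIV. v $ i * dpoly K i z)) (at z)"
    using C1_cpoly[OF K] by (simp add: C1_partials_def)
  have E: "(eH has_derivative (\<lambda>v. eH z * (\<Sum>i\<in>UNIV. v $ i * dham i z))) (at z)"
    using ham_has_derivative[OF zi] by (auto intro!: derivative_eq_intros simp: mult.commute)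
  have "((\<lambda>z. f z * eH z) has_derivative (\<lambda>v. cpoly K z * (eH z * (\<Sum>i\<in>UNIV. v $ i * dham i z)) +
      (\<Sum>i\<in>UNIV. v $ i * dpoly K i z) * eH z)) (at z)"
    by (rule has_derivative_transform_within_open[OF has_derivative_mult[OF P E] open_interior z])
       (simp add: f_interior[OF K])
  from fun_cong[OF frechet_derivative_at[OF this], of "beta M t z", symmetric]
  have "beta_deriv M t (\<lambda>z. f z * eH z) z = (\<Sum>i\<in>UNIV. beta M t z $ i * dpoly K i z) * eH z"
    using sum_beta_dham[OF zi] by (simp add: beta_deriv_def)
  then show ?thesis
    using zi interior_subset[of "Omega_C M"] f_interior[OF K z]
    by (auto simp: wfield_def sum_distrib_left sum_distrib_right mult_ac)
qed

lemma outward_flux_eq: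
  assumes K: "K \<in> cells"
  shows "outward_flux K (\<lambda>i z. upwind M t f i z * beta M t z $ i * trace_in K f z * eH z) =
    (\<Sum>i\<in>UNIV. \<integral>y. face_term i (\<lambda>z. fhat i z * cpoly K z * wfield i z) K y \<partial>transverse i)"
proof -
  define F where "F i z = upwind M t f i z * beta M t z $ i * trace_in K f z * eH z" for i z
  define G where "G i z = fhat i z * cpoly K z * wfield i z" for i z
  note cpoly_measurable[OF K, measurable]
  have ctr: "controlled (G i)" for i
    using controlled_fhat_mult[OF controlled_cpoly_mult[OF K controlled_wfield]]
    by (simp add: G_def[abs_def] mult.assoc)
  then have [measurable]: "G i \<in> borel_measurable borel" for i by (simp add: controlled_def)
  have side: "(LINT z:K|hyperplane_measure i a. F i z) =
      (\<integral>y. indicator (cface i K) (slice i a y) * G i (slice i a y) \<partial>transverse i)"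
    if a: "a = lw K $ i \<or> a = up K $ i" for i a
    unfolding set_lebesgue_integral_def
  proof (rule integral_hyperplane[where E = exceptional and G = "\<lambda>z. indicator (cface i K) z * G i z"])
    fix z assume z: "z $ i = a" and ex: "\<And>j. j \<noteq> i \<Longrightarrow> z $ j \<notin> exceptional j"
    show "indicator K z *\<^sub>R F i z = indicator (cface i K) z * G i z"
    proof (cases "z \<in> cface i K")
      case True
      have at_end: "z $ i = lw K $ i \<or> z $ i = up K $ i" using a z by auto
      have zK: "z \<in> K" by (rule cface_end_in_cell[OF K True at_end])
      then have zO: "z \<in> Omega_C M" using cell_subset[OF K] by blast
      have "F i z = G i z"
      \<comment> \<open>Where the normal field vanishes the upwind value is not determined, but it
        is multiplied by 0.\<close>
      proof (cases "wfield i z = 0")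
        case True
        then have "beta M t z $ i = 0" using zO by (simp add: wfield_def)
        with True show ?thesis by (simp add: F_def G_def)
      next
        case False
        then show ?thesis
          using upwind_eq[OF K True at_end ex False] trace_in_eq[OF K zK] zO
          by (simp add: F_def G_def wfield_def)
      qed
      with zK True show ?thesis by simp
    next
      case False
      \<comment> \<open>The transverse coordinates avoid all cell ends, so a point of the closed
        cell would lie over the open face.\<close>
      have "z \<notin> K"
      proof
        assume "z \<in> K"
        then have "z \<in> cbox (lw K) (up K)" using cell_eq[OF K] by simp
        then have "lw K $ j < z $ j \<and> z $ j < up K $ j" if "j \<noteq> i" for j
        proof -
          have "z $ j \<noteq> lw K $ j \<and> z $ j \<noteq> up K $ j"
            using ex[OF that] K by (auto simp: exceptional_def ends_def)
          moreover have "lw K $ j \<le> z $ j \<and> z $ j \<le> up K $ j"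
            using \<open>z \<in> cbox (lw K) (up K)\<close> by (simp add: mem_box_cart)
          ultimately show ?thesis by (simp add: less_le)
        qed
        then have "z \<in> cface i K" by (simp add: face_def)
        with False show False by blast
      qed
      with False show ?thesis by simp
    qed
  qed (use finite_exceptional in measurable)
  have "outward_flux K F = (\<Sum>i\<in>UNIV. \<integral>y. face_term i (G i) K y \<partial>transverse i)"
    unfolding outward_flux_def face_term_def
    by (rule sum.cong[OF refl])
       (simp only: side[OF disjI1[OF refl]] side[OF disjI2[OF refl]]
          Bochner_Integration.integral_diff[OF integrable_face_parts(1,2)[OF K ctr]])
  then show ?thesis by (simp add: F_def[abs_def] G_def[abs_def])
qed

lemma transport_nonneg:
  "0 \<le> (\<Sum>K\<in>cells. outward_flux K (\<lambda>i z. upwind M t f i z * beta M t z $ i * trace_in K f z * eH z)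
      - (LINT z:K|lborel. \<Sum>i\<in>UNIV. wfield i z * cpoly K z * dpoly K i z))"
proof -
  have "outward_flux K (\<lambda>i z. upwind M t f i z * beta M t z $ i * trace_in K f z * eH z)
      - (LINT z:K|lborel. \<Sum>i\<in>UNIV. wfield i z * cpoly K z * dpoly K i z) =
    (\<Sum>i\<in>UNIV. \<integral>y. face_term i (phi (cpoly K) i) K y \<partial>transverse i)" if K: "K \<in> cells" for K
  proof -
    have c1: "controlled (\<lambda>z. fhat i z * cpoly K z * wfield i z)" for i
      using controlled_fhat_mult[OF controlled_cpoly_mult[OF K controlled_wfield]] by (simp add: mult.assoc)
    have c2: "controlled (\<lambda>z. wfield i z * (cpoly K z)\<^sup>2 / 2)" for i
      using controlled_cmult[OF controlled_cpoly_mult[OF K controlled_cpoly_mult[OF K controlled_wfield]], of "1 / 2"]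
      by (simp add: power2_eq_square mult_ac)
    have "(\<integral>y. face_term i (\<lambda>z. fhat i z * cpoly K z * wfield i z) K y \<partial>transverse i) -
        (\<integral>y. face_term i (\<lambda>z. wfield i z * (cpoly K z)\<^sup>2 / 2) K y \<partial>transverse i) =
      (\<integral>y. face_term i (phi (cpoly K) i) K y \<partial>transverse i)" for i
    proof -
      have "face_term i (phi (cpoly K) i) K y = face_term i (\<lambda>z. fhat i z * cpoly K z * wfield i z) K y
          - face_term i (\<lambda>z. wfield i z * (cpoly K z)\<^sup>2 / 2) K y" for y
        by (simp add: face_term_def phi_def algebra_simps)
      then show ?thesis
        using Bochner_Integration.integral_diff[OF integrable_face_parts(3)[OF K c1] integrable_face_parts(3)[OF K c2]]
        by simp
    qed
    then show ?thesis
      by (simp add: outward_flux_eq[OF K] volume_term(2)[OF K] flip: sum_subtractf)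
  qed
  then have "(\<Sum>K\<in>cells. outward_flux K (\<lambda>i z. upwind M t f i z * beta M t z $ i * trace_in K f z * eH z)
      - (LINT z:K|lborel. \<Sum>i\<in>UNIV. wfield i z * cpoly K z * dpoly K i z)) =
    (\<Sum>K\<in>cells. \<Sum>i\<in>UNIV. \<integral>y. face_term i (phi (cpoly K) i) K y \<partial>transverse i)"
    by (rule sum.cong[OF refl])
  \<comment> \<open>Exchanging the sums brings together, for a fixed direction, all cells on a
    common line. The terms of a single cell have no sign.\<close>
  also have "\<dots> = (\<Sum>i\<in>UNIV. \<Sum>K\<in>cells. \<integral>y. face_term i (phi (cpoly K) i) K y \<partial>transverse i)"
    by (rule sum.swap)
  also have "\<dots> \<ge> 0" by (intro sum_nonneg flux_direction_nonneg)
  finally show ?thesis .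
qed

end

section \<open>Dissipation by collisions\<close>

text \<open>True for indicators by assumption, and carried over to nonnegative Borel functions by
  linearity and monotone convergence. The measures \<open>\<kappa> p\<close> may be
  infinite.\<close>

lemma borel_measurable_nn_integral_kernel:
  fixes \<kappa> :: "'a \<Rightarrow> 'b::topological_space measure" and u :: "'b \<Rightarrow> ennreal"
  assumes \<kappa>: "\<And>p. sets (\<kappa> p) = sets borel" "\<And>A. A \<in> sets borel \<Longrightarrow> (\<lambda>p. emeasure (\<kappa> p) A) \<in> borel_measurable N"
    and u: "u \<in> borel_measurable borel"
  shows "(\<lambda>p. \<integral>\<^sup>+x. u x \<partial>\<kappa> p) \<in> borel_measurable N"
  using u
proof (induction u)
  case (cong f g)
  have "(\<integral>\<^sup>+x. f x \<partial>\<kappa> p) = (\<integral>\<^sup>+x. g x \<partial>\<kappa> p)" for p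
    using cong by (intro nn_integral_cong) auto
  with cong show ?case by simp
next
  case (set A)
  with \<kappa> show ?case by simp
next
  case (mult u c)
  then have "(\<integral>\<^sup>+x. c * u x \<partial>\<kappa> p) = c * (\<integral>\<^sup>+x. u x \<partial>\<kappa> p)" for p
    by (intro nn_integral_cmult) (simp add: measurable_cong_sets[OF \<kappa>(1) refl])
  with mult show ?case by simp
next
  case (add u v)
  then have "(\<integral>\<^sup>+x. v x + u x \<partial>\<kappa> p) = (\<integral>\<^sup>+x. v x \<partial>\<kappa> p) + (\<integral>\<^sup>+x. u x \<partial>\<kappa> p)" for p
    by (intro nn_integral_add) (simp_all add: measurable_cong_sets[OF \<kappa>(1) refl])
  with add show ?case by simp
next
  case (seq U)
  then have "(\<integral>\<^sup>+x. (SUP i. U i) x \<partial>\<kappa> p) = (SUP i. \<integral>\<^sup>+x. U i x \<partial>\<kappa> p)" for p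
    unfolding SUP_apply
    by (intro nn_integral_monotone_convergence_SUP) (simp_all add: measurable_cong_sets[OF \<kappa>(1) refl])
  with seq show ?case by simp
qed

lemma borel_measurable_lebesgue_integral_kernel:
  fixes \<kappa> :: "'a \<Rightarrow> 'b::topological_space measure" and F :: "'b \<Rightarrow> real"
  assumes \<kappa>: "\<And>p. sets (\<kappa> p) = sets borel" "\<And>A. A \<in> sets borel \<Longrightarrow> (\<lambda>p. emeasure (\<kappa> p) A) \<in> borel_measurable N"
    and [measurable]: "F \<in> borel_measurable borel"
  shows "(\<lambda>p. \<integral>x. F x \<partial>\<kappa> p) \<in> borel_measurable N"
proof -
  have [measurable]: "(\<lambda>p. \<integral>\<^sup>+x. ennreal (F x) \<partial>\<kappa> p) \<in> borel_measurable N"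
    "(\<lambda>p. \<integral>\<^sup>+x. ennreal (- F x) \<partial>\<kappa> p) \<in> borel_measurable N"
    "(\<lambda>p. \<integral>\<^sup>+x. ennreal (norm (F x)) \<partial>\<kappa> p) \<in> borel_measurable N"
    using borel_measurable_nn_integral_kernel[OF \<kappa>, of "\<lambda>x. ennreal (F x)"]
      borel_measurable_nn_integral_kernel[OF \<kappa>, of "\<lambda>x. ennreal (- F x)"]
      borel_measurable_nn_integral_kernel[OF \<kappa>, of "\<lambda>x. ennreal (norm (F x))"] by simp_all
  have "F \<in> borel_measurable (\<kappa> p)" for p by (simp add: measurable_cong_sets[OF \<kappa>(1) refl])
  \<comment> \<open>If the absolute value has infinite integral, the Bochner integral is 0 by
    convention. The condition is measurable in \<open>p\<close>, so the case distinction is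
    measurable too.\<close>
  then have eq: "(\<integral>x. F x \<partial>\<kappa> p) = (if (\<integral>\<^sup>+x. ennreal (norm (F x)) \<partial>\<kappa> p) < \<infinity> then
      enn2real (\<integral>\<^sup>+x. ennreal (F x) \<partial>\<kappa> p) - enn2real (\<integral>\<^sup>+x. ennreal (- F x) \<partial>\<kappa> p) else 0)" for p
    using real_lebesgue_integral_def[of "\<kappa> p" F] not_integrable_integral_eq[of "\<kappa> p" F]
    by (auto simp: integrable_iff_bounded)
  show ?thesis unfolding eq by measurable
qed

section \<open>Phase space as the product of positions and momenta\<close>

lemma prod_5: "(\<Prod>j\<in>(UNIV :: 5 set). f j) = f 1 * f 2 * f 3 * f 4 * f 5"
  unfolding UNIV_5 by (simp add: mult_ac)

lemma phase_nth:
  "phase x p $ 1 = fst x" "phase x p $ 2 = snd x" "phase x p $ 3 = fst p"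
  "phase x p $ 4 = fst (snd p)" "phase x p $ 5 = snd (snd p)"
  by (simp_all add: phase_def vector_5)

lemma position_phase [simp]: "position (phase x p) = x"
  and momentum_of_phase [simp]: "momentum_of (phase x p) = p"
  and phase_position_momentum [simp]: "phase (position z) (momentum_of z) = z"
  by (simp_all add: position_def momentum_of_def vec_eq_iff forall_5 phase_nth)

lemma borel_measurable_fst_compose [measurable (raw)]:
  fixes g :: "'a \<Rightarrow> 'b::second_countable_topology \<times> 'c::second_countable_topology"
  assumes "g \<in> borel_measurable M"
  shows "(\<lambda>w. fst (g w)) \<in> borel_measurable M"
  by (rule measurable_compose[OF assms borel_measurable_continuous_onI]) (intro continuous_intros)

lemma borel_measurable_snd_compose [measurable (raw)]:
  fixes g :: "'a \<Rightarrow> 'b::second_countable_topology \<times> 'c::second_countable_topology"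
  assumes "g \<in> borel_measurable M"
  shows "(\<lambda>w. snd (g w)) \<in> borel_measurable M"
  by (rule measurable_compose[OF assms borel_measurable_continuous_onI]) (intro continuous_intros)

lemma borel_measurable_phase [measurable (raw)]:
  assumes [measurable]: "g \<in> borel_measurable M" "h \<in> borel_measurable M"
  shows "(\<lambda>w. phase (g w) (h w)) \<in> borel_measurable M"
proof -
  have "(\<lambda>w. phase (g w) (h w) $ j) \<in> borel_measurable M" for j
    using exhaust_5[of j]
    by (elim disjE; simp only: phase_nth; intro borel_measurable_fst_compose borel_measurable_snd_compose assms)
  then have "(\<lambda>w. \<chi> j. phase (g w) (h w) $ j) \<in> borel_measurable M"
    by (rule borel_measurable_vec_lambda)
  then show ?thesis by simp
qed

lemma borel_measurable_position [measurable]: "position \<in> borel_measurable borel"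
  and borel_measurable_momentum_of [measurable]: "momentum_of \<in> borel_measurable borel"
  unfolding position_def[abs_def] momentum_of_def[abs_def] by measurable

lemma emeasure_lborel_Times:
  fixes A :: "'a::euclidean_space set" and B :: "'b::euclidean_space set"
  assumes "A \<in> sets borel" "B \<in> sets borel"
  shows "emeasure lborel (A \<times> B) = emeasure lborel A * emeasure lborel B"
  using assms by (subst lborel_prod[symmetric], subst lborel.emeasure_pair_measure_Times) auto

lemma lborel_eq_distr_phase:
  "(lborel :: phase_point measure) = distr (lborel \<Otimes>\<^sub>M lborel) borel (\<lambda>(x, p). phase x p)"
proof (rule lborel_eqI)
  fix l u :: phase_point assume le: "\<And>b. b \<in> Basis \<Longrightarrow> l \<bullet> b \<le> u \<bullet> b"
  have le': "l $ j \<le> u $ j" for j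
    using le[of "axis j 1"] by (simp add: inner_axis)
  let ?I = "\<lambda>j. {l $ j<..<u $ j}"
  have "(\<lambda>(x, p). phase x p) -` box l u \<inter> space (lborel \<Otimes>\<^sub>M lborel) =
      (?I 1 \<times> ?I 2) \<times> (?I 3 \<times> (?I 4 \<times> ?I 5))"
    by (auto simp: mem_box_cart forall_5 phase_nth space_pair_measure)
  then have "emeasure (distr (lborel \<Otimes>\<^sub>M lborel) borel (\<lambda>(x, p). phase x p)) (box l u) =
      emeasure (lborel \<Otimes>\<^sub>M lborel) ((?I 1 \<times> ?I 2) \<times> (?I 3 \<times> (?I 4 \<times> ?I 5)))"
    by (subst emeasure_distr) auto
  also have "\<dots> = (ennreal (u $ 1 - l $ 1) * ennreal (u $ 2 - l $ 2)) *
      (ennreal (u $ 3 - l $ 3) * (ennreal (u $ 4 - l $ 4) * ennreal (u $ 5 - l $ 5)))"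
    by (simp add: lborel_prod emeasure_lborel_Times borel_Times le' del: open_greaterThanLessThan)
  also have "\<dots> = (\<Prod>j\<in>UNIV. ennreal (u $ j - l $ j))" by (simp only: prod_5 mult.assoc)
  also have "\<dots> = ennreal (\<Prod>b\<in>Basis. (u - l) \<bullet> b)"
    by (simp add: prod_Basis_cart inner_axis prod_ennreal le')
  finally show "emeasure (distr (lborel \<Otimes>\<^sub>M lborel) borel (\<lambda>(x, p). phase x p)) (box l u) =
    ennreal (\<Prod>b\<in>Basis. (u - l) \<bullet> b)" .
qed simp

context kane_dg
begin

text \<open>An identity at every point and not just almost everywhere, because the chosen
  representative vanishes off the cell interiors, which are disjoint.\<close>

lemma f_sum: "f z = (\<Sum>K\<in>cells. indicator (interior K) z * cpoly K z)"
proof (cases "z \<in> (\<Union>K\<in>cells. interior K)")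
  case True
  then obtain K where K: "K \<in> cells" "z \<in> interior K" by blast
  have "(\<Sum>K\<in>cells. indicator (interior K) z * cpoly K z) = (\<Sum>K'\<in>cells. if K' = K then cpoly K z else 0)"
  proof (rule sum.cong[OF refl])
    fix K' assume K': "K' \<in> cells"
    show "indicator (interior K') z * cpoly K' z = (if K' = K then cpoly K z else 0)"
      using K K' cell_disjoint[OF K(1) K'] by (cases "K' = K") (auto simp: indicator_def)
  qed
  then show ?thesis using K finite_cells f_interior[OF K] by simp
next
  case False
  then show ?thesis using f_outside[OF False] by (auto intro!: sum.neutral[symmetric])
qed

lemma f_measurable [measurable]: "f \<in> borel_measurable borel"
proof -
  have "(\<lambda>z. \<Sum>K\<in>cells. indicator (interior K) z * cpoly K z) \<in> borel_measurable borel"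
  proof (rule borel_measurable_sum)
    fix K assume "K \<in> cells"
    note cpoly_measurable[OF this, measurable]
    show "(\<lambda>z. indicator (interior K) z * cpoly K z) \<in> borel_measurable borel" by measurable
  qed
  then show ?thesis by (simp add: f_sum[abs_def, symmetric])
qed

lemma f_zero: "z \<notin> Omega_C M \<Longrightarrow> f z = 0"
  using f_outside cell_subset interior_subset by blast

lemma f_bounded: obtains C where "0 \<le> C" "\<And>z. \<bar>f z\<bar> \<le> C"
proof -
  have "\<exists>c. 0 \<le> c \<and> (\<forall>z\<in>Omega_C M. \<bar>cpoly K z\<bar> \<le> c)" if "K \<in> cells" for K
    using bounded_on_Omega_C[OF continuous_on_cpoly[OF that]] by metis
  then obtain c where c: "\<And>K. K \<in> cells \<Longrightarrow> 0 \<le> c K \<and> (\<forall>z\<in>Omega_C M. \<bar>cpoly K z\<bar> \<le> c K)" by metis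
  have "\<bar>\<Sum>K\<in>cells. indicator (interior K) z * cpoly K z\<bar> \<le> sum c cells" for z
  proof (rule order_trans[OF sum_abs], rule sum_mono)
    fix K assume K: "K \<in> cells"
    show "\<bar>indicator (interior K) z * cpoly K z\<bar> \<le> c K"
      using c[OF K] interior_cell_subset[OF K] interior_subset[of "Omega_C M"]
      by (auto simp: indicator_def)
  qed
  then have "\<bar>f z\<bar> \<le> sum c cells" for z by (subst f_sum)
  moreover have "0 \<le> sum c cells" using c by (auto intro: sum_nonneg)
  ultimately show ?thesis using that by blast
qed

lemma jac_nonneg: "z \<in> Omega_C M \<Longrightarrow> 0 \<le> jac M (z $ 3)"
proof -
  assume z: "z \<in> Omega_C M"
  then have w: "0 \<le> z $ 3" "z $ 3 \<le> omega_max M" by (auto simp: mem_Omega_C)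
  then have "0 < 1 + 2 * alpha_K M * z $ 3" using constants by (simp add: admissible_constants_def)
  \<comment> \<open>With a = alpha_K and w the energy, 1 + a w is the mean of 1 and 1 + 2 a
    w.\<close>
  then have "0 \<le> 1 + alpha_K M * z $ 3" by simp
  with w \<open>0 < 1 + 2 * alpha_K M * z $ 3\<close> show ?thesis by (simp add: jac_def)
qed

lemma jac_measurable [measurable]: "jac M \<in> borel_measurable borel"
  unfolding jac_def[abs_def] by measurable

end

locale kane_dg_collision = kane_dg +
  assumes kernel: "scattering_kernel M" and dissipation: "dissipative M"
begin

section \<open>Measurability and finiteness of the collision integrals\<close>

lemma kernel_sets: "sets (S_to M p) = sets borel" "sets (S_from M p) = sets borel"
  and kernel_measurable: "A \<in> sets borel \<Longrightarrow> (\<lambda>p. emeasure (S_to M p) A) \<in> borel_measurable borel"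
    "A \<in> sets borel \<Longrightarrow> (\<lambda>p. emeasure (S_from M p) A) \<in> borel_measurable borel"
  using kernel unfolding scattering_kernel_def by blast+

lemma collision_measurable:
  assumes [measurable]: "F \<in> borel_measurable borel"
  shows "collision M F \<in> borel_measurable borel"
proof -
  have [measurable]: "(\<lambda>p. \<integral>p'. F p' \<partial>S_to M p) \<in> borel_measurable borel"
    "(\<lambda>p. \<integral>p'. (1 :: real) \<partial>S_from M p) \<in> borel_measurable borel"
    by (rule borel_measurable_lebesgue_integral_kernel[OF kernel_sets(1) kernel_measurable(1)]
        borel_measurable_lebesgue_integral_kernel[OF kernel_sets(2) kernel_measurable(2)]; simp)+
  show ?thesis unfolding collision_def[abs_def] by measurable
qed

lemma sets_dp [measurable_cong]: "sets (dp M) = sets borel"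
  by (simp add: dp_def)

lemma momentum_domain_borel [measurable]: "momentum_domain M \<in> sets borel"
  by (simp add: momentum_domain_def borel_Times)

lemma finite_rates:
  "(\<integral>\<^sup>+p. emeasure (S_to M p) UNIV \<partial>dp M) < \<infinity>" "(\<integral>\<^sup>+p. emeasure (S_from M p) UNIV \<partial>dp M) < \<infinity>"
proof -
  show 1: "(\<integral>\<^sup>+p. emeasure (S_from M p) UNIV \<partial>dp M) < \<infinity>"
    using kernel by (simp add: scattering_kernel_def)
  have disintegration: "\<forall>A\<in>sets borel. \<forall>B\<in>sets borel.
      (\<integral>\<^sup>+p\<in>B. emeasure (S_to M p) A \<partial>dp M) = (\<integral>\<^sup>+p\<in>A. emeasure (S_from M p) B \<partial>dp M)"
    using kernel unfolding scattering_kernel_def by (elim conjE)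
  \<comment> \<open>Total gain and total loss are both the mass of the one measure that
    \<open>S_to\<close> and \<open>S_from\<close> disintegrate.\<close>
  have "(\<integral>\<^sup>+p\<in>UNIV. emeasure (S_to M p) UNIV \<partial>dp M) = (\<integral>\<^sup>+p\<in>UNIV. emeasure (S_from M p) UNIV \<partial>dp M)"
    using disintegration[rule_format, of UNIV UNIV] by simp
  with 1 show "(\<integral>\<^sup>+p. emeasure (S_to M p) UNIV \<partial>dp M) < \<infinity>" by simp
qed

definition good :: "momentum \<Rightarrow> bool" where
  "good p \<longleftrightarrow> emeasure (S_to M p) UNIV < \<infinity> \<and> emeasure (S_from M p) UNIV < \<infinity>"

lemma good_measurable [measurable]: "Measurable.pred borel good"
proof -
  have [measurable]: "(\<lambda>p. emeasure (S_to M p) UNIV) \<in> borel_measurable borel"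
    "(\<lambda>p. emeasure (S_from M p) UNIV) \<in> borel_measurable borel"
    using kernel_measurable by simp_all
  show ?thesis unfolding good_def[abs_def] by measurable
qed

text \<open>Finite total rates make the rates finite almost everywhere for \<open>dp M\<close>. This
  says something about Lebesgue measure only where the density is positive, which explains the
  premise.\<close>

lemma AE_good: "AE p in lborel. p \<in> momentum_domain M \<and> 0 < jac M (fst p) \<longrightarrow> good p"
proof -
  have [measurable]: "(\<lambda>p. emeasure (S_to M p) UNIV) \<in> borel_measurable (dp M)"
    "(\<lambda>p. emeasure (S_from M p) UNIV) \<in> borel_measurable (dp M)"
    using kernel_measurable by (simp_all add: measurable_cong_sets[OF sets_dp refl])
  have "AE p in dp M. emeasure (S_to M p) UNIV \<noteq> \<infinity>"
    by (rule nn_integral_PInf_AE) (use finite_rates in auto)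
  moreover have "AE p in dp M. emeasure (S_from M p) UNIV \<noteq> \<infinity>"
    by (rule nn_integral_PInf_AE) (use finite_rates in auto)
  ultimately have "AE p in dp M. good p" by eventually_elim (simp add: good_def less_top)
  then have "AE p in lborel. 0 < indicator (momentum_domain M) p * ennreal (jac M (fst p)) \<longrightarrow> good p"
    unfolding dp_def by (subst (asm) AE_density) auto
  then show ?thesis by eventually_elim (auto simp: indicator_def)
qed

definition rate :: "momentum \<Rightarrow> real" where
  "rate p = measure (S_to M p) UNIV + measure (S_from M p) UNIV"

lemma rate_measurable [measurable]: "rate \<in> borel_measurable borel"
proof -
  have [measurable]: "(\<lambda>p. emeasure (S_to M p) UNIV) \<in> borel_measurable borel"
    "(\<lambda>p. emeasure (S_from M p) UNIV) \<in> borel_measurable borel"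
    using kernel_measurable by simp_all
  show ?thesis unfolding rate_def[abs_def] measure_def by measurable
qed

lemma integrable_rate: "integrable lborel (\<lambda>p. indicator (momentum_domain M) p * jac M (fst p) * rate p)"
proof -
  have jac: "0 \<le> jac M (fst p)" if "p \<in> momentum_domain M" for p
    using jac_nonneg[of "phase (x_min M, y_min M) p"] that constants
    by (auto simp: mem_Omega_C phase_nth momentum_domain_def admissible_constants_def)
  have [measurable]: "(\<lambda>p. emeasure (S_to M p) UNIV) \<in> borel_measurable borel"
    "(\<lambda>p. emeasure (S_from M p) UNIV) \<in> borel_measurable borel"
    using kernel_measurable by simp_all
  have "(\<integral>\<^sup>+p. ennreal (norm (indicator (momentum_domain M) p * jac M (fst p) * rate p)) \<partial>lborel)
    \<le> (\<integral>\<^sup>+p. indicator (momentum_domain M) p * ennreal (jac M (fst p)) *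
        (emeasure (S_to M p) UNIV + emeasure (S_from M p) UNIV) \<partial>lborel)"
  proof (rule nn_integral_mono)
    fix p
    \<comment> \<open>\<open>rate\<close> uses the real-valued \<open>measure\<close>, in which
      infinite mass counts as 0; the bound covers this case.\<close>
    have "ennreal (enn2real e) \<le> e" for e by (cases e rule: ennreal_cases) auto
    then have "ennreal (rate p) \<le> emeasure (S_to M p) UNIV + emeasure (S_from M p) UNIV"
      unfolding rate_def by (subst ennreal_plus) (auto simp: measure_def intro!: add_mono)
    then show "ennreal (norm (indicator (momentum_domain M) p * jac M (fst p) * rate p)) \<le>
       indicator (momentum_domain M) p * ennreal (jac M (fst p)) *
        (emeasure (S_to M p) UNIV + emeasure (S_from M p) UNIV)"
      using jac[of p] by (auto simp: indicator_def abs_mult rate_def ennreal_mult intro!: mult_left_mono)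
  qed
  also have "\<dots> = (\<integral>\<^sup>+p. emeasure (S_to M p) UNIV + emeasure (S_from M p) UNIV \<partial>dp M)"
    unfolding dp_def by (subst nn_integral_density) auto
  also have "\<dots> = (\<integral>\<^sup>+p. emeasure (S_to M p) UNIV \<partial>dp M) + (\<integral>\<^sup>+p. emeasure (S_from M p) UNIV \<partial>dp M)"
    by (rule nn_integral_add) (simp_all add: measurable_cong_sets[OF sets_dp refl])
  also have "\<dots> < \<infinity>" using finite_rates by simp
  finally show ?thesis unfolding integrable_iff_bounded by simp
qed

text \<open>
  Joint measurability of the gain term in position and momentum comes from kernels into
  \<open>subprob_algebra\<close>, hence the scaling; it is restricted to the momenta with finite rates, which are
  almost all.
\<close>

definition normalized_kernel :: "momentum \<Rightarrow> momentum measure" where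
  "normalized_kernel p = (if good p then density (S_to M p) (\<lambda>_. ennreal (1 / (1 + measure (S_to M p) UNIV)))
     else null_measure borel)"

lemma emeasure_normalized_kernel:
  "A \<in> sets borel \<Longrightarrow> emeasure (normalized_kernel p) A = (if good p then
     ennreal (1 / (1 + measure (S_to M p) UNIV)) * emeasure (S_to M p) A else 0)"
  by (simp add: normalized_kernel_def emeasure_density_const kernel_sets)

lemma normalized_kernel_measurable [measurable]:
  "normalized_kernel \<in> borel \<rightarrow>\<^sub>M subprob_algebra borel"
proof (rule measurable_subprob_algebra)
  fix p
  show sets: "sets (normalized_kernel p) = sets borel"
    by (simp add: normalized_kernel_def kernel_sets)
  then have space: "space (normalized_kernel p) = UNIV" using sets_eq_imp_space_eq by fastforce
  show "subprob_space (normalized_kernel p)"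
  proof (rule subprob_spaceI)
    show "emeasure (normalized_kernel p) (space (normalized_kernel p)) \<le> 1"
    proof (cases "good p")
      case True
      then have "emeasure (S_to M p) UNIV = ennreal (measure (S_to M p) UNIV)"
        by (intro emeasure_eq_ennreal_measure) (auto simp: good_def)
      \<comment> \<open>The factor 1 / (1 + m) brings the mass below 1 and, unlike 1 / m, can be
        undone for m = 0 as well.\<close>
      moreover have "m / (1 + m) \<le> 1" if "0 \<le> m" for m :: real using that by simp
      note this[OF measure_nonneg, of "S_to M p" UNIV]
      ultimately show ?thesis using True
        by (simp add: space emeasure_normalized_kernel ennreal_mult[symmetric] ennreal_le_1)
    qed (simp add: space emeasure_normalized_kernel)
  qed (simp add: space)
next
  fix A :: "momentum set" assume A: "A \<in> sets borel"
  have [measurable]: "(\<lambda>p. emeasure (S_to M p) A) \<in> borel_measurable borel"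
    "(\<lambda>p. emeasure (S_to M p) UNIV) \<in> borel_measurable borel"
    using kernel_measurable A by simp_all
  show "(\<lambda>p. emeasure (normalized_kernel p) A) \<in> borel_measurable borel"
    unfolding emeasure_normalized_kernel[OF A] measure_def by measurable
qed

text \<open>Positive and negative parts are integrated against the normalized kernel, which gives
  measurability in position and momentum jointly. Multiplication by 1 plus the total mass, itself
  measurable, undoes the scaling.\<close>

lemma gain_measurable:
  fixes h :: "phase_point \<Rightarrow> real"
  assumes [measurable]: "h \<in> borel_measurable borel" and h: "\<And>z. \<bar>h z\<bar> \<le> C"
  shows "(\<lambda>z. if good (momentum_of z) then \<integral>p'. h (phase (position z) p') \<partial>S_to M (momentum_of z) else 0)
    \<in> borel_measurable borel"
proof -
  have [measurable]: "(\<lambda>p. emeasure (S_to M p) UNIV) \<in> borel_measurable borel"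
    using kernel_measurable by simp
  have nn: "(\<lambda>z. \<integral>\<^sup>+p'. ennreal (g (phase (position z) p')) \<partial>normalized_kernel (momentum_of z)) \<in> borel_measurable borel"
    if [measurable]: "g \<in> borel_measurable borel" for g :: "phase_point \<Rightarrow> real"
    by (rule nn_integral_measurable_subprob_algebra2[where N = borel]) measurable
  have eq: "(\<integral>p'. h (phase (position z) p') \<partial>S_to M (momentum_of z)) =
     (1 + enn2real (emeasure (S_to M (momentum_of z)) UNIV)) *
      (enn2real (\<integral>\<^sup>+p'. ennreal (h (phase (position z) p')) \<partial>normalized_kernel (momentum_of z)) -
       enn2real (\<integral>\<^sup>+p'. ennreal (- h (phase (position z) p')) \<partial>normalized_kernel (momentum_of z)))"
    if good: "good (momentum_of z)" for z
  proof -
    let ?S = "S_to M (momentum_of z)" and ?m = "measure (S_to M (momentum_of z)) UNIV"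
    have meas: "g \<in> borel_measurable ?S" if "g \<in> borel_measurable borel" for g :: "momentum \<Rightarrow> 'b::topological_space"
      using that by (simp add: measurable_cong_sets[OF kernel_sets(1) refl])
    have "finite_measure ?S"
    proof (rule finite_measureI)
      have "space ?S = UNIV" using sets_eq_imp_space_eq[OF kernel_sets(1)] by simp
      then show "emeasure ?S (space ?S) \<noteq> \<infinity>" using good by (simp add: good_def less_top)
    qed
    then have int: "integrable ?S (\<lambda>p'. h (phase (position z) p'))"
      by (rule finite_measure.integrable_const_bound[where B = C]) (auto simp: h intro!: meas)
    have "0 \<le> ?m" by simp
    then have pos: "0 < 1 + ?m" by linarith
    have nk: "enn2real (\<integral>\<^sup>+p'. ennreal (g p') \<partial>normalized_kernel (momentum_of z)) =
        1 / (1 + ?m) * enn2real (\<integral>\<^sup>+p'. ennreal (g p') \<partial>?S)" if "g \<in> borel_measurable borel" for g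
    proof -
      have "(\<integral>\<^sup>+p'. ennreal (g p') \<partial>normalized_kernel (momentum_of z)) =
          ennreal (1 / (1 + ?m)) * (\<integral>\<^sup>+p'. ennreal (g p') \<partial>?S)"
        using good that unfolding normalized_kernel_def
        by (simp add: nn_integral_density nn_integral_cmult meas)
      then show ?thesis using pos by (simp add: enn2real_mult)
    qed
    have scale: "m * (1 / m * b - 1 / m * c) = b - c" if "0 < m" for m b c :: real
      using that by (simp add: right_diff_distrib)
    have h_meas: "(\<lambda>p'. h (phase (position z) p')) \<in> borel_measurable borel"
      "(\<lambda>p'. - h (phase (position z) p')) \<in> borel_measurable borel" by measurable
    show ?thesis
      unfolding measure_def[symmetric] nk[OF h_meas(1)] nk[OF h_meas(2)] scale[OF pos]
      by (rule real_lebesgue_integral_def[OF int])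
  qed
  have "(\<lambda>z. if good (momentum_of z) then (1 + enn2real (emeasure (S_to M (momentum_of z)) UNIV)) *
      (enn2real (\<integral>\<^sup>+p'. ennreal (h (phase (position z) p')) \<partial>normalized_kernel (momentum_of z)) -
       enn2real (\<integral>\<^sup>+p'. ennreal (- h (phase (position z) p')) \<partial>normalized_kernel (momentum_of z))) else 0)
    \<in> borel_measurable borel"
    using nn[of h] nn[of "\<lambda>z. - h z"] by measurable
  then show ?thesis by (simp add: eq cong: if_cong)
qed

section \<open>Sign of the collision term\<close>

definition dissipated :: "phase_point \<Rightarrow> real" where
  "dissipated z = Qcoll M f z * f z * eH z * jac M (z $ 3)"

text \<open>At fixed position the weight is the exponential of the energy times a positive constant,
  which can be moved out of the momentum integral.\<close>

lemma dissipated_phase: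
  "dissipated (phase x p) = exp (- (charge M * Phi M t x / KT M)) *
     (jac M (fst p) * (collision M (\<lambda>p. f (phase x p)) p * (f (phase x p) * exp (fst p))))"
proof -
  have "eH (phase x p) = exp (fst p) * exp (- (charge M * Phi M t x / KT M))"
    by (simp add: ham_def phase_nth flip: exp_add)
  then show ?thesis by (simp add: dissipated_def Qcoll_def phase_nth)
qed

lemma f_phase_zero: "p \<notin> momentum_domain M \<Longrightarrow> f (phase x p) = 0"
  by (rule f_zero) (auto simp: mem_Omega_C phase_nth momentum_domain_def mem_Times_iff)

text \<open>With g = F e^\<omega> both differences in the dissipative identity equal g' - g, so its
  integrand is (g' - g)^2 times a positive factor. Boundedness of g, which the identity demands,
  comes from the vanishing of F outside the momentum domain.\<close>

lemma dissipated_momentum_integral: "(\<integral>p. dissipated (phase x p) \<partial>lborel) \<le> 0"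
proof -
  define F where "F p = f (phase x p)" for p
  define g where "g p = F p * exp (fst p)" for p
  obtain C where C: "0 \<le> C" "\<And>z. \<bar>f z\<bar> \<le> C" using f_bounded by blast
  have [measurable]: "F \<in> borel_measurable borel" unfolding F_def[abs_def] by measurable
  have [measurable]: "g \<in> borel_measurable borel" unfolding g_def[abs_def] by measurable
  have "bounded (range F)" using C by (auto simp: F_def intro!: boundedI[of _ C])
  moreover have "bounded (range g)"
  proof (rule boundedI[of _ "C * exp (omega_max M)"], clarify)
    fix p
    show "norm (g p) \<le> C * exp (omega_max M)"
    proof (cases "p \<in> momentum_domain M")
      case True
      then have "exp (fst p) \<le> exp (omega_max M)" by (auto simp: momentum_domain_def)
      then show ?thesis using C by (simp add: g_def F_def abs_mult mult_mono)
    next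
      case False
      then show ?thesis using C by (simp add: g_def F_def f_phase_zero)
    qed
  qed
  ultimately have "(\<integral>p. collision M F p * g p \<partial>dp M) =
        - (1 / 2) * (\<integral>p. (\<integral>p'. exp (- fst p') *
              (F p' / exp (- fst p') - F p / exp (- fst p)) * (g p' - g p) \<partial>S_to M p) \<partial>dp M)"
    using dissipation unfolding dissipative_def by auto
  also have "\<dots> \<le> 0"
  proof -
    have "exp (- fst p') * (F p' / exp (- fst p') - F p / exp (- fst p)) * (g p' - g p) =
        exp (- fst p') * (g p' - g p)\<^sup>2" for p p'
      by (simp add: g_def exp_minus power2_eq_square divide_inverse)
    then have "0 \<le> exp (- fst p') * (F p' / exp (- fst p') - F p / exp (- fst p)) * (g p' - g p)" for p p'
      by (simp only: mult_nonneg_nonneg exp_ge_zero zero_le_power2)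
    then have "0 \<le> (\<integral>p. (\<integral>p'. exp (- fst p') *
              (F p' / exp (- fst p') - F p / exp (- fst p)) * (g p' - g p) \<partial>S_to M p) \<partial>dp M)"
      by (intro Bochner_Integration.integral_nonneg)
    then show ?thesis by simp
  qed
  finally have neg: "(\<integral>p. collision M F p * g p \<partial>dp M) \<le> 0" .
  note collision_measurable[of F, measurable]
  have jac: "0 \<le> jac M (fst p)" if "p \<in> momentum_domain M" for p
    using jac_nonneg[of "phase (x_min M, y_min M) p"] that constants
    by (auto simp: mem_Omega_C phase_nth momentum_domain_def admissible_constants_def)
  have "dp M = density lborel (\<lambda>p. ennreal (indicator (momentum_domain M) p * jac M (fst p)))"
    unfolding dp_def by (intro density_cong) (auto simp: indicator_def)
  then have "(\<integral>p. collision M F p * g p \<partial>dp M) =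
      (\<integral>p. (indicator (momentum_domain M) p * jac M (fst p)) *\<^sub>R (collision M F p * g p) \<partial>lborel)"
    by (simp only:) (rule integral_density; use jac in \<open>auto simp: indicator_def\<close>)
  also have "\<dots> = (\<integral>p. jac M (fst p) * (collision M F p * g p) \<partial>lborel)"
    by (intro Bochner_Integration.integral_cong refl) (auto simp: indicator_def g_def F_def f_phase_zero)
  finally have "(\<integral>p. jac M (fst p) * (collision M F p * g p) \<partial>lborel) \<le> 0" using neg by simp
  then show ?thesis
    by (simp add: dissipated_phase F_def[abs_def] g_def mult_nonneg_nonpos)
qed

text \<open>A Borel version of \<open>dissipated\<close>: the joint measurability of the gain term
  in position and momentum is obtained only at momenta with finite rates.\<close>

definition dissipated' :: "phase_point \<Rightarrow> real" where
  "dissipated' z = (if good (momentum_of z) then dissipated z else 0)"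

lemma dissipated'_measurable [measurable]: "dissipated' \<in> borel_measurable borel"
proof -
  obtain C where C: "0 \<le> C" "\<And>z. \<bar>f z\<bar> \<le> C" using f_bounded by blast
  have [measurable]: "(\<lambda>p. emeasure (S_from M p) UNIV) \<in> borel_measurable borel"
    using kernel_measurable by simp
  note gain_measurable[OF f_measurable C(2), measurable]
  have [measurable]: "(\<lambda>z. if z \<in> Omega_C M then eH z else 0) \<in> borel_measurable borel"
  proof -
    have "(\<lambda>z. indicator (Omega_C M) z *\<^sub>R eH z) \<in> borel_measurable borel"
      by (rule borel_measurable_continuous_on_indicator[OF _ continuous_on_eH]) (simp add: Omega_C_def)
    also have "(\<lambda>z. indicator (Omega_C M) z *\<^sub>R eH z) = (\<lambda>z. if z \<in> Omega_C M then eH z else 0)"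
      by auto
    finally show ?thesis .
  qed
  have one: "measure (S_from M p) (space (S_from M p)) = enn2real (emeasure (S_from M p) UNIV)" for p
    using sets_eq_imp_space_eq[OF kernel_sets(2)[of p]] by (simp add: measure_def)
  have "dissipated' = (\<lambda>z. ((if good (momentum_of z) then \<integral>p'. f (phase (position z) p') \<partial>S_to M (momentum_of z) else 0)
     - (if good (momentum_of z) then f z * enn2real (emeasure (S_from M (momentum_of z)) UNIV) else 0)) *
     f z * (if z \<in> Omega_C M then eH z else 0) * jac M (z $ 3))"
    by (auto simp: fun_eq_iff dissipated'_def dissipated_def Qcoll_def collision_def one f_zero)
  also have "\<dots> \<in> borel_measurable borel" by measurable
  finally show ?thesis .
qed

text \<open>Failure of \<open>good\<close> concerns the momentum only, so one null set serves all
  positions. Where \<open>f\<close> or the Jacobian vanishes, both sides are 0.\<close>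

lemma AE_dissipated: "AE p in lborel. \<forall>x. dissipated (phase x p) = dissipated' (phase x p)"
  using AE_good
proof eventually_elim
  case (elim p)
  show ?case
  proof
    fix x
    show "dissipated (phase x p) = dissipated' (phase x p)"
    proof (cases "f (phase x p) = 0 \<or> jac M (fst p) = 0")
      case True
      then show ?thesis by (auto simp: dissipated'_def dissipated_def phase_nth)
    next
      case False
      then have "phase x p \<in> Omega_C M" using f_zero by blast
      moreover have "p \<in> momentum_domain M" using False f_phase_zero by blast
      ultimately have "good p" using elim False jac_nonneg[of "phase x p"] by (simp add: phase_nth less_le)
      then show ?thesis by (simp add: dissipated'_def)
    qed
  qed
qed

text \<open>At good momenta the collision term is at most C times \<open>rate\<close>, where C
  bounds the modulus of \<open>f\<close>. With B a bound of \<open>eH\<close> on the domain, the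
  majorant is the indicator of the rectangle times C C B times the Jacobian times
  \<open>rate\<close>, a product of an integrable function of position and one of momentum.\<close>

lemma integrable_dissipated': "integrable lborel dissipated'"
proof -
  obtain C where C: "0 \<le> C" "\<And>z. \<bar>f z\<bar> \<le> C" using f_bounded by blast
  obtain B where B: "0 \<le> B" "\<And>z. z \<in> Omega_C M \<Longrightarrow> \<bar>eH z\<bar> \<le> B"
    using bounded_on_Omega_C[OF continuous_on_eH] by blast
  have "integrable lborel (indicator (rect M) :: real \<times> real \<Rightarrow> real)"
    by (simp add: rect_def integrable_indicator_iff borel_Times emeasure_lborel_Times emeasure_lborel_Icc_eq
        ennreal_mult_less_top)
  from lborel_pair.integrable_prod_mult[OF this integrable_mult_right[OF integrable_rate, of "C * C * B"]]
  have dom: "integrable (lborel \<Otimes>\<^sub>M lborel) (\<lambda>(x, p). indicator (rect M) x *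
      (C * C * B * (indicator (momentum_domain M) p * jac M (fst p) * rate p)))" .
  have bound: "norm (dissipated' (phase x p)) \<le> norm (indicator (rect M) x *
      (C * C * B * (indicator (momentum_domain M) p * jac M (fst p) * rate p)))" for x p
  proof (cases "phase x p \<in> Omega_C M \<and> good p")
    case False
    then show ?thesis by (auto simp: dissipated'_def dissipated_def f_zero)
  next
    case True
    then have dom: "x \<in> rect M" "p \<in> momentum_domain M"
      by (auto simp: mem_Omega_C phase_nth rect_def momentum_domain_def mem_Times_iff)
    have jac: "0 \<le> jac M (fst p)" using jac_nonneg[of "phase x p"] True by (simp add: phase_nth)
    have sp: "space (S_to M p) = UNIV" "space (S_from M p) = UNIV"
      using sets_eq_imp_space_eq[OF kernel_sets(1)] sets_eq_imp_space_eq[OF kernel_sets(2)] by simp_all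
    have "finite_measure (S_to M p)" by (rule finite_measureI) (use True sp in \<open>simp add: good_def less_top\<close>)
    then have int: "integrable (S_to M p) (\<lambda>p'. C)" by (rule finite_measure.integrable_const)
    have "\<bar>\<integral>p'. f (phase x p') \<partial>S_to M p\<bar> \<le> (\<integral>p'. C \<partial>S_to M p)"
    proof -
      have "integrable (S_to M p) (\<lambda>p'. f (phase x p'))"
        by (rule finite_measure.integrable_const_bound[where B = C, OF \<open>finite_measure (S_to M p)\<close>])
           (auto simp: C measurable_cong_sets[OF kernel_sets(1) refl])
      from Bochner_Integration.integral_norm_bound_integral[OF this int] show ?thesis by (simp add: C)
    qed
    then have gain: "\<bar>\<integral>p'. f (phase x p') \<partial>S_to M p\<bar> \<le> C * measure (S_to M p) UNIV"
      by (simp add: sp mult.commute)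
    have "\<bar>Qcoll M f (phase x p)\<bar> \<le> \<bar>\<integral>p'. f (phase x p') \<partial>S_to M p\<bar> +
        \<bar>f (phase x p)\<bar> * measure (S_from M p) UNIV"
      unfolding Qcoll_def collision_def
      using abs_triangle_ineq4[of "\<integral>p'. f (phase x p') \<partial>S_to M p" "f (phase x p) * measure (S_from M p) UNIV"]
      by (simp add: sp abs_mult)
    also have "\<dots> \<le> C * measure (S_to M p) UNIV + C * measure (S_from M p) UNIV"
      by (intro add_mono gain mult_right_mono C) simp
    finally have Q: "\<bar>Qcoll M f (phase x p)\<bar> \<le> C * rate p" by (simp add: rate_def distrib_left)
    have rate: "0 \<le> rate p" by (simp add: rate_def)
    have "\<bar>dissipated (phase x p)\<bar> = \<bar>Qcoll M f (phase x p)\<bar> * \<bar>f (phase x p)\<bar> * \<bar>eH (phase x p)\<bar> * jac M (fst p)"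
      using jac by (simp add: dissipated_def phase_nth abs_mult)
    also have "\<dots> \<le> (C * rate p) * C * B * jac M (fst p)"
      using Q C B(2)[of "phase x p"] B(1) True rate jac by (intro mult_mono mult_right_mono) auto
    also have "\<dots> = norm (indicator (rect M) x *
      (C * C * B * (indicator (momentum_domain M) p * jac M (fst p) * rate p)))"
      using dom jac rate C(1) B(1) by (simp add: abs_mult mult_ac)
    finally show ?thesis using True by (simp add: dissipated'_def)
  qed
  have "integrable (lborel \<Otimes>\<^sub>M lborel) (\<lambda>(x, p). dissipated' (phase x p))"
    by (rule Bochner_Integration.integrable_bound[OF dom]) (use bound in \<open>auto simp: split_beta\<close>)
  then show ?thesis
    by (subst lborel_eq_distr_phase, subst integrable_distr_eq) (auto simp: case_prod_unfold)
qed

lemma integral_dissipated'_nonpos: "(\<integral>z. dissipated' z \<partial>lborel) \<le> 0"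
proof -
  have int: "integrable (lborel \<Otimes>\<^sub>M lborel) (\<lambda>(x, p). dissipated' (phase x p))"
    using integrable_dissipated'
    by (subst (asm) lborel_eq_distr_phase, subst (asm) integrable_distr_eq) (auto simp: case_prod_unfold)
  have "(\<integral>z. dissipated' z \<partial>lborel) = (\<integral>(x, p). dissipated' (phase x p) \<partial>(lborel \<Otimes>\<^sub>M lborel))"
    by (subst lborel_eq_distr_phase, subst integral_distr) (auto simp: case_prod_unfold)
  also have "\<dots> = (\<integral>x. (\<integral>p. dissipated' (phase x p) \<partial>lborel) \<partial>lborel)"
    using lborel_pair.integral_fst[OF int] by simp
  also have "\<dots> \<le> 0"
  proof -
    have "(\<integral>p. dissipated' (phase x p) \<partial>lborel) \<le> 0" for x
    proof -
      have "(\<lambda>p. f (phase x p)) \<in> borel_measurable borel" by measurable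
      from collision_measurable[OF this] have [measurable]: "(\<lambda>p. dissipated (phase x p)) \<in> borel_measurable borel"
        unfolding dissipated_phase by measurable
      have "(\<integral>p. dissipated' (phase x p) \<partial>lborel) = (\<integral>p. dissipated (phase x p) \<partial>lborel)"
      proof (rule integral_cong_AE)
        show "AE p in lborel. dissipated' (phase x p) = dissipated (phase x p)"
          using AE_dissipated by eventually_elim (drule spec[of _ x], simp only:)
      qed measurable
      with dissipated_momentum_integral[of x] show ?thesis by simp
    qed
    then have "0 \<le> (\<integral>x. - (\<integral>p. dissipated' (phase x p) \<partial>lborel) \<partial>lborel)"
      by (intro Bochner_Integration.integral_nonneg) simp
    then show ?thesis by simp
  qed
  finally show ?thesis .
qed

text \<open>The exceptional momenta lie in a null set independent of the position, and the cylinder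
  over it in phase space is null by Fubini.\<close>

lemma AE_dissipated': "AE z in lborel. dissipated z = dissipated' z"
proof -
  obtain N where N: "N \<in> null_sets lborel" "{p. \<not> (\<forall>x. dissipated (phase x p) = dissipated' (phase x p))} \<subseteq> N"
    using AE_dissipated by (auto elim!: AE_E simp: null_sets_def)
  then have [measurable]: "N \<in> sets borel" by auto
  have "AE p in lborel. p \<notin> N" using N(1) by (rule AE_not_in)
  then have "AE x in (lborel :: (real \<times> real) measure). AE p in lborel. p \<notin> N" by simp
  then have "AE w in (lborel :: (real \<times> real) measure) \<Otimes>\<^sub>M lborel. snd w \<notin> N"
    by (subst lborel_pair.AE_pair_iff[symmetric, where P = "\<lambda>_ p. p \<notin> N"]) measurable
  then have "AE z in lborel. momentum_of z \<notin> N"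
    by (subst lborel_eq_distr_phase, subst AE_distr_iff) (auto simp: case_prod_unfold)
  then show ?thesis
  proof eventually_elim
    case (elim z)
    then have "\<forall>x. dissipated (phase x (momentum_of z)) = dissipated' (phase x (momentum_of z))"
      using N(2) by blast
    then show ?case by (metis phase_position_momentum)
  qed
qed

lemma
  shows integrable_dissipated: "integrable lebesgue dissipated"
    and integral_dissipated_nonpos: "(\<integral>z. dissipated z \<partial>lebesgue) \<le> 0"
proof -
  have meas: "dissipated \<in> borel_measurable lebesgue"
    by (rule measurable_completion_AE[OF AE_dissipated']) simp
  have AE: "AE z in lebesgue. dissipated z = dissipated' z" by (rule AE_completion[OF AE_dissipated'])
  have meas': "dissipated' \<in> borel_measurable lebesgue" by (rule measurable_completion) simp
  have "integrable lebesgue dissipated'"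
    using integrable_dissipated' by (subst integrable_completion) auto
  then show "integrable lebesgue dissipated"
    using integrable_cong_AE[OF meas meas' AE] by simp
  have "(\<integral>z. dissipated z \<partial>lebesgue) = (\<integral>z. dissipated' z \<partial>lebesgue)"
    by (rule integral_cong_AE[OF meas meas' AE])
  also have "\<dots> = (\<integral>z. dissipated' z \<partial>lborel)" by (rule integral_completion) simp
  finally show "(\<integral>z. dissipated z \<partial>lebesgue) \<le> 0" using integral_dissipated'_nonpos by simp
qed

end

section \<open>The entropy estimate\<close>

context kane_dg
begin

text \<open>An open set disjoint from the interior of \<open>K\<close> is disjoint from the closure
  of that interior, which is \<open>K\<close> because cells are nondegenerate boxes.\<close>

lemma cell_unique:
  assumes "K \<in> cells" "K' \<in> cells" "z \<in> K" "z \<in> interior K'"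
  shows "K = K'"
proof (rule ccontr)
  assume "K \<noteq> K'"
  then have "interior K' \<inter> interior K = {}" using cell_disjoint[of K' K] assms by auto
  then have "interior K' \<inter> closure (interior K) = {}"
    using open_Int_closure_eq_empty[OF open_interior] by blast
  moreover have "box (lw K) (up K) \<noteq> {}"
    using lw_less_up[OF assms(1)] by (auto simp: interval_ne_empty_cart)
  then have "closure (interior K) = K"
    using closure_box cell_eq[OF assms(1)] interior_cell[OF assms(1)] by metis
  ultimately show False using assms(3,4) by blast
qed

lemma cell_measurable: "K \<in> cells \<Longrightarrow> K \<in> sets borel"
  using cell_eq[of K] closed_cbox borel_closed by metis

text \<open>Closed cells overlap only outside all cell interiors, where the representative of
  \<open>f\<close> is 0.\<close>

lemma sum_indicator_cells: "(\<Sum>K\<in>cells. indicator K z * f z) = f z"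
proof (cases "f z = 0")
  case False
  then obtain K where K: "K \<in> cells" "z \<in> interior K" using f_outside by blast
  have "(\<Sum>K'\<in>cells. indicator K' z * f z) = (\<Sum>K'\<in>cells. if K' = K then f z else 0)"
  proof (rule sum.cong[OF refl])
    fix K' assume "K' \<in> cells"
    then have "z \<notin> K'" if "K' \<noteq> K" using cell_unique[OF _ K(1) _ K(2)] that by blast
    moreover have "z \<in> K" using K(2) interior_subset by blast
    ultimately show "indicator K' z * f z = (if K' = K then f z else 0)" by (cases "K' = K") simp_all
  qed
  then show ?thesis using K finite_cells by simp
qed simp

lemma
  assumes int: "integrable lebesgue (\<lambda>z. X z * f z)"
  shows set_integrable_cell: "K \<in> cells \<Longrightarrow> set_integrable lebesgue K (\<lambda>z. X z * f z)"
    and sum_cell_integrals: "(\<Sum>K\<in>cells. LINT z:K|lebesgue. X z * f z) = (\<integral>z. X z * f z \<partial>lebesgue)"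
proof -
  show K: "set_integrable lebesgue K (\<lambda>z. X z * f z)" if "K \<in> cells" for K
    unfolding set_integrable_def
    by (rule integrable_mult_indicator[OF _ int]) (use cell_measurable[OF that] in auto)
  have "(\<Sum>K\<in>cells. LINT z:K|lebesgue. X z * f z) =
      (\<integral>z. (\<Sum>K\<in>cells. indicator K z *\<^sub>R (X z * f z)) \<partial>lebesgue)"
    unfolding set_lebesgue_integral_def
    by (rule Bochner_Integration.integral_sum[symmetric]) (use K in \<open>simp add: set_integrable_def\<close>)
  also have "(\<lambda>z. \<Sum>K\<in>cells. indicator K z *\<^sub>R (X z * f z)) = (\<lambda>z. X z * f z)"
  proof
    fix z
    have "(\<Sum>K\<in>cells. indicator K z *\<^sub>R (X z * f z)) = X z * (\<Sum>K\<in>cells. indicator K z * f z)"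
      by (simp add: sum_distrib_left mult_ac)
    then show "(\<Sum>K\<in>cells. indicator K z *\<^sub>R (X z * f z)) = X z * f z"
      by (simp add: sum_indicator_cells)
  qed
  finally show "(\<Sum>K\<in>cells. LINT z:K|lebesgue. X z * f z) = (\<integral>z. X z * f z \<partial>lebesgue)" .
qed

lemma AE_interior_cell:
  assumes "K \<in> cells"
  shows "AE z in lborel. z \<in> K \<longrightarrow> z \<in> interior K"
proof -
  have "negligible (frontier K)"
    using negligible_convex_frontier[of K] cell_eq[OF assms] convex_box(1) by metis
  then have "AE z in lebesgue. z \<notin> frontier K" by (simp add: negligible_iff_null_sets AE_not_in)
  then have "AE z in lborel. z \<notin> frontier K" by (simp add: AE_completion_iff)
  then show ?thesis by eventually_elim (use closure_subset in \<open>auto simp: frontier_def\<close>)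
qed

text \<open>On the cell boundary \<open>f\<close> may jump and its Frechet derivative is then
  unspecified. The boundary is null, so the integrand may be replaced by the Borel expression valid
  in the interior.\<close>

lemma transport_term:
  assumes K: "K \<in> cells"
  shows "set_integrable lebesgue K (\<lambda>z. f z * beta_deriv M t (\<lambda>z. f z * eH z) z)"
    and "(LINT z:K|lebesgue. f z * beta_deriv M t (\<lambda>z. f z * eH z) z) =
      (LINT z:K|lborel. \<Sum>i\<in>UNIV. wfield i z * cpoly K z * dpoly K i z)"
proof -
  let ?B = "\<lambda>z. indicator K z *\<^sub>R (f z * beta_deriv M t (\<lambda>z. f z * eH z) z)"
  let ?V = "\<lambda>z. indicator K z *\<^sub>R (\<Sum>i\<in>UNIV. wfield i z * cpoly K z * dpoly K i z)"
  have V: "integrable lborel ?V" using volume_term(1)[OF K] by (simp add: set_integrable_def)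
  then have V': "?V \<in> borel_measurable lborel" by simp
  have AE: "AE z in lborel. ?B z = ?V z"
    using AE_interior_cell[OF K] by eventually_elim (auto simp: beta_deriv_eq[OF K] indicator_def)
  have meas: "?B \<in> borel_measurable lebesgue" "?V \<in> borel_measurable lebesgue"
    by (rule measurable_completion_AE[OF AE V'], rule measurable_completion[OF V'])
  have "integrable lebesgue ?V" using V V' by (simp add: integrable_completion)
  then have "integrable lebesgue ?B" using integrable_cong_AE[OF meas AE_completion[OF AE]] by simp
  then show "set_integrable lebesgue K (\<lambda>z. f z * beta_deriv M t (\<lambda>z. f z * eH z) z)"
    by (simp add: set_integrable_def)
  have "integral\<^sup>L lebesgue ?B = integral\<^sup>L lebesgue ?V"
    by (rule integral_cong_AE[OF meas AE_completion[OF AE]])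
  also have "\<dots> = integral\<^sup>L lborel ?V" by (rule integral_completion[OF V'])
  finally show "(LINT z:K|lebesgue. f z * beta_deriv M t (\<lambda>z. f z * eH z) z) =
      (LINT z:K|lborel. \<Sum>i\<in>UNIV. wfield i z * cpoly K z * dpoly K i z)"
    by (simp add: set_lebesgue_integral_def)
qed

lemma integrable_weighted:
  assumes [measurable]: "g \<in> borel_measurable borel" and g: "\<And>z. \<bar>g z\<bar> \<le> C"
  shows "integrable lebesgue (\<lambda>z. g z * eH z * jac M (z $ 3) * f z)"
proof -
  obtain B where B: "0 \<le> B" "\<And>z. \<bar>f z\<bar> \<le> B" using f_bounded by blast
  have "continuous_on (Omega_C M) (\<lambda>z. eH z * jac M (z $ 3))"
    unfolding jac_def by (intro continuous_intros)
  then have [measurable]: "(\<lambda>z. indicator (Omega_C M) z *\<^sub>R (eH z * jac M (z $ 3))) \<in> borel_measurable borel"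
    and cont: "continuous_on (Omega_C M) (\<lambda>z. eH z * jac M (z $ 3))"
    by (auto intro!: borel_measurable_continuous_on_indicator simp: Omega_C_def simp del: real_scaleR_def)
  obtain D where D: "0 \<le> D" "\<And>z. z \<in> Omega_C M \<Longrightarrow> \<bar>eH z * jac M (z $ 3)\<bar> \<le> D"
    using bounded_on_Omega_C[OF cont] by blast
  let ?h = "\<lambda>z. g z * (f z * (indicator (Omega_C M) z *\<^sub>R (eH z * jac M (z $ 3))))"
  have "controlled (\<lambda>z. indicator (Omega_C M) z *\<^sub>R (eH z * jac M (z $ 3)))"
    unfolding controlled_def
  proof (intro conjI exI[of _ D] ballI)
    fix z assume z: "z \<in> Omega_C M"
    have "\<bar>indicator (Omega_C M) z *\<^sub>R (eH z * jac M (z $ 3))\<bar> \<le> D * 1" using D(2)[OF z] z by simp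
    \<comment> \<open>\<open>weight\<close> is at least 1 on the domain, so bounded functions are
      dominated as well.\<close>
    also have "\<dots> \<le> D * weight (z $ 4)"
      using weight_ge[OF z] D(1) by (intro mult_left_mono) (simp_all add: weight_def)
    finally show "\<bar>indicator (Omega_C M) z *\<^sub>R (eH z * jac M (z $ 3))\<bar> \<le> D * weight (z $ 4)" .
  qed measurable
  then have "controlled ?h"
    by (intro controlled_mult[where c = C] controlled_mult[where c = B] g B) auto
  then have "set_integrable lborel (Omega_C M) ?h"
    unfolding Omega_C_def by (rule set_integrable_controlled) auto
  moreover have "indicator (Omega_C M) z *\<^sub>R ?h z = g z * eH z * jac M (z $ 3) * f z" for z
    using f_zero[of z] by (auto simp: indicator_def)
  ultimately have int: "integrable lborel (\<lambda>z. g z * eH z * jac M (z $ 3) * f z)"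
    unfolding set_integrable_def by (simp only:)
  then have "(\<lambda>z. g z * eH z * jac M (z $ 3) * f z) \<in> borel_measurable lborel"
    by (rule borel_measurable_integrable)
  from integrable_completion[OF this] int show ?thesis by simp
qed

end

theorem theorem2p3:
  fixes M :: kane_model and cells :: "(real ^ 5) set set" and k :: nat
    and I :: "real set" and fh :: "real \<Rightarrow> real ^ 5 \<Rightarrow> real" and t :: real
  assumes constants: "admissible_constants M"
    and times: "open I"
    and potential: "\<And>\<tau>. \<tau> \<in> I \<Longrightarrow> C1_potential M \<tau>"
    and periodic: "\<And>\<tau>. \<tau> \<in> I \<Longrightarrow> periodic_potential M \<tau>"
    and hamiltonian_flow:
      "\<And>\<tau> z. \<tau> \<in> I \<Longrightarrow> z \<in> interior (Omega_C M) \<Longrightarrow> beta_deriv M \<tau> (ham M \<tau>) z = 0"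
    and kernel: "scattering_kernel M"
    and dissipation: "dissipative M"
    and mesh: "cell_partition M cells"
    and solution: "dg_solution M cells k I fh"
    and t: "t \<in> I"
  shows
    "0 \<ge> (LINT z:Omega_C M|lebesgue. fh t z * dt fh t z * exp (ham M t z) * jac M (z $ 3)) \<and>
     (LINT z:Omega_C M|lebesgue. fh t z * dt fh t z * exp (ham M t z) * jac M (z $ 3)) =
     1 / 2 * (LINT z:Omega_C M|lebesgue.
        dt (\<lambda>\<tau> z. (fh \<tau> z)\<^sup>2) t z * exp (ham M t z) * jac M (z $ 3))"
proof
  have fh: "fh t \<in> dg_space M cells k" and d: "dt fh t \<in> dg_space M cells k"
    and diff: "\<And>z. (\<lambda>\<tau>. fh \<tau> z) differentiable (at t)"
    and scheme: "\<And>K g. K \<in> cells \<Longrightarrow> g \<in> dg_space M cells k \<Longrightarrow> scheme_on_cell M fh t K g"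
    using solution t by (auto simp: dg_solution_def)
  interpret kane_dg_collision M t cells k "fh t"
    by unfold_locales (fact constants potential[OF t] periodic[OF t] hamiltonian_flow[OF t] mesh fh kernel dissipation)+
  \<comment> \<open>The time derivative lies in the same space, hence is bounded and Borel. This
    makes the time term of the scheme integrable.\<close>
  interpret D: kane_dg M t cells k "dt fh t"
    by unfold_locales (fact mesh d)+
  define X where "X z = dt fh t z * eH z * jac M (z $ 3)" for z
  define Y where "Y z = Qcoll M (fh t) z * eH z * jac M (z $ 3)" for z
  let ?B = "\<lambda>z. fh t z * beta_deriv M t (\<lambda>z. fh t z * eH z) z"
  let ?V = "\<lambda>K. LINT z:K|lborel. \<Sum>i\<in>UNIV. wfield i z * cpoly K z * dpoly K i z"
  let ?flux = "\<lambda>K. outward_flux K (\<lambda>i z. upwind M t (fh t) i z * beta M t z $ i * trace_in K (fh t) z * eH z)"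
  obtain C where "\<And>z. \<bar>dt fh t z\<bar> \<le> C" using D.f_bounded by blast
  from integrable_weighted[OF D.f_measurable this]
  have X: "integrable lebesgue (\<lambda>z. X z * fh t z)" by (simp add: X_def)
  have Y_eq: "(\<lambda>z. Y z * fh t z) = dissipated" by (auto simp: Y_def dissipated_def)
  then have Y: "integrable lebesgue (\<lambda>z. Y z * fh t z)" using integrable_dissipated by simp
  have cell: "(LINT z:K|lebesgue. X z * fh t z) = (LINT z:K|lebesgue. Y z * fh t z) - (?flux K - ?V K)"
    if K: "K \<in> cells" for K
  proof -
    have "(LINT z:K|lebesgue. X z * fh t z - ?B z) + ?flux K = (LINT z:K|lebesgue. Y z * fh t z)"
      using scheme[OF K fh] by (simp add: scheme_on_cell_def X_def Y_def mult_ac)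
    \<comment> \<open>The scheme has one integral over both volume terms; it can be split because
      each of them is integrable.\<close>
    moreover have "(LINT z:K|lebesgue. X z * fh t z - ?B z) =
        (LINT z:K|lebesgue. X z * fh t z) - (LINT z:K|lebesgue. ?B z)"
      by (rule set_integral_diff(2)[OF set_integrable_cell[OF X K] transport_term(1)[OF K]])
    ultimately show ?thesis by (simp add: transport_term(2)[OF K])
  qed
  have "(LINT z:Omega_C M|lebesgue. fh t z * dt fh t z * exp (ham M t z) * jac M (z $ 3)) =
      (\<integral>z. X z * fh t z \<partial>lebesgue)"
    unfolding set_lebesgue_integral_def
    by (intro Bochner_Integration.integral_cong refl) (use f_zero in \<open>auto simp: X_def indicator_def\<close>)
  also have "\<dots> = (\<Sum>K\<in>cells. LINT z:K|lebesgue. X z * fh t z)"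
    by (rule sum_cell_integrals[OF X, symmetric])
  also have "\<dots> = (\<Sum>K\<in>cells. LINT z:K|lebesgue. Y z * fh t z) - (\<Sum>K\<in>cells. ?flux K - ?V K)"
    by (simp only: cell sum_subtractf cong: sum.cong)
  also have "\<dots> = (\<integral>z. dissipated z \<partial>lebesgue) - (\<Sum>K\<in>cells. ?flux K - ?V K)"
    by (simp only: sum_cell_integrals[OF Y, unfolded Y_eq] Y_eq)
  also have "\<dots> \<le> 0" using integral_dissipated_nonpos transport_nonneg by linarith
  finally show "0 \<ge> (LINT z:Omega_C M|lebesgue. fh t z * dt fh t z * exp (ham M t z) * jac M (z $ 3))" .
  \<comment> \<open>Chain rule in time at a fixed point of phase space. Only the square is
    differentiated; the exponential enters afterwards as a factor at time \<open>t\<close>.\<close>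
  have "dt (\<lambda>\<tau> z. (fh \<tau> z)\<^sup>2) t z = 2 * (fh t z * dt fh t z)" for z
  proof -
    have "((\<lambda>\<tau>. fh \<tau> z) has_real_derivative dt fh t z) (at t)"
      using diff[of z] by (simp add: dt_def DERIV_deriv_iff_real_differentiable)
    then have "((\<lambda>\<tau>. (fh \<tau> z)\<^sup>2) has_real_derivative 2 * (fh t z * dt fh t z)) (at t)"
      by (auto intro!: derivative_eq_intros)
    then show ?thesis by (simp add: dt_def DERIV_imp_deriv)
  qed
  then show "(LINT z:Omega_C M|lebesgue. fh t z * dt fh t z * exp (ham M t z) * jac M (z $ 3)) =
     1 / 2 * (LINT z:Omega_C M|lebesgue.
        dt (\<lambda>\<tau> z. (fh \<tau> z)\<^sup>2) t z * exp (ham M t z) * jac M (z $ 3))"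
    by (simp add: mult.assoc)
qed

end
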